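(* Let $W$ be the right-angled Coxeter group with three generators $s_1,s_2,s_3$ and $m_{1,2}=m_{2,3}=\infty$, $m_{1,3}=2$, i.e. $W=\langle s_1,s_2,s_3\mid s_1^2=s_2^2=s_3^2=(s_1s_3)^2=1\rangle$. Let $B$ be its Tits form on $\mathbb{R}^3$. Then $B$ has signature $(2,1)$, and $W$ is isomorphic, via its geometric representation $\rho$, to a lattice in the group $\mathrm{O}(B)(\mathbb{R})=\mathrm{O}(2,1)$ of real rank $1$.
   Context: The Tits form is the symmetric bilinear form $B$ on $\mathbb{R}^3$ with basis $e_1,e_2,e_3$ given by $B(e_i,e_i)=1$, $B(e_1,e_2)=B(e_2,e_3)=-1$, $B(e_1,e_3)=0$. The geometric representation $\rho:W\to\mathrm{GL}(\mathbb{R}^3)$ is the homomorphism defined by $\rho(s_i)(e_j)=e_j-2B(e_j,e_i)e_i$; its image lies in $\mathrm{O}(B)(\mathbb{R})$, the group of linear automorphisms of $\mathbb{R}^3$ preserving $B$. A lattice in a Lie group $G$ is a discrete subgroup $\Gamma$ such that $\Gamma\backslash G$ carries a finite non-zero $G$-invariant measure. *)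

theory Defs
  imports "HOL-Analysis.Analysis" "HOL-Algebra.Coset"
begin

section \<open>Group presentations\<close>

text \<open>
  The letter \<open>(s, False)\<close> stands for the generator \<open>s\<close> and \<open>(s, True)\<close> for its formal inverse.
  The set of generators is the whole type \<open>'s\<close>.
\<close>

type_synonym 's word = "('s \<times> bool) list"

inductive pres_eq :: "'s word set \<Rightarrow> 's word \<Rightarrow> 's word \<Rightarrow> bool" for R where
  refl: "pres_eq R u u"
| sym: "pres_eq R u v \<Longrightarrow> pres_eq R v u"
| trans: "pres_eq R u v \<Longrightarrow> pres_eq R v w \<Longrightarrow> pres_eq R u w"
| cancel: "pres_eq R (u @ [(s, b), (s, \<not> b)] @ v) (u @ v)"
| relator: "r \<in> R \<Longrightarrow> pres_eq R (u @ r @ v) (u @ v)"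

definition pres_class :: "'s word set \<Rightarrow> 's word \<Rightarrow> 's word set" where
  "pres_class R u = {v. pres_eq R u v}"

definition presented_group :: "'s word set \<Rightarrow> 's word set monoid" where
  "presented_group R =
    \<lparr>carrier = range (pres_class R),
     mult = (\<lambda>X Y. \<Union>u\<in>X. \<Union>v\<in>Y. pres_class R (u @ v)),
     one = pres_class R []\<rparr>"

lemma pres_eq_context: "pres_eq R u v \<Longrightarrow> pres_eq R (a @ u @ b) (a @ v @ b)"
proof (induction rule: pres_eq.induct)
  case (cancel u s b' v)
  show ?case using pres_eq.cancel[of R "a @ u" s b' "v @ b"] by simp
next
  case (relator r u v)
  show ?case using pres_eq.relator[OF relator, of "a @ u" "v @ b"] by simp
qed (rule pres_eq.refl, erule pres_eq.sym, erule (1) pres_eq.trans)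

lemma pres_eq_append:
  assumes "pres_eq R u u'" "pres_eq R v v'"
  shows "pres_eq R (u @ v) (u' @ v')"
  using pres_eq.trans[OF pres_eq_context[OF assms(1), of "[]" v]]
    pres_eq_context[OF assms(2), of u' "[]"] by simp

lemma pres_class_eq_iff: "pres_class R u = pres_class R v \<longleftrightarrow> pres_eq R u v"
proof
  assume "pres_class R u = pres_class R v"
  then have "v \<in> pres_class R u" by (simp add: pres_class_def pres_eq.refl)
  then show "pres_eq R u v" by (simp add: pres_class_def)
next
  assume "pres_eq R u v"
  then show "pres_class R u = pres_class R v"
    unfolding pres_class_def
    by (intro Collect_cong iffI) (erule pres_eq.trans[OF pres_eq.sym] pres_eq.trans, assumption)+
qed

lemma presented_group_mult [simp]:
  "pres_class R u \<otimes>\<^bsub>presented_group R\<^esub> pres_class R v = pres_class R (u @ v)"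
proof -
  have *: "pres_class R (u' @ v') = pres_class R (u @ v)"
    if "u' \<in> pres_class R u" "v' \<in> pres_class R v" for u' v'
  proof -
    have "pres_eq R u u'" "pres_eq R v v'"
      using that by (simp_all add: pres_class_def)
    then show ?thesis
      unfolding pres_class_eq_iff by (rule pres_eq.sym[OF pres_eq_append])
  qed
  have "u \<in> pres_class R u" "v \<in> pres_class R v"
    by (simp_all add: pres_class_def pres_eq.refl)
  then have "(\<Union>u'\<in>pres_class R u. \<Union>v'\<in>pres_class R v. pres_class R (u' @ v')) = pres_class R (u @ v)"
    using * by blast
  then show ?thesis
    by (simp add: presented_group_def)
qed

lemma pres_eq_inverse: "pres_eq R (map (\<lambda>(s, b). (s, \<not> b)) (rev u) @ u) []"
proof (induction u)
  case (Cons a u)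
  obtain s b where a: "a = (s, b)" by fastforce
  show ?case
    using pres_eq.trans[OF pres_eq.cancel[of R "map (\<lambda>(s, b). (s, \<not> b)) (rev u)" s "\<not> b" u] Cons]
    by (simp add: a)
qed (simp add: pres_eq.refl)

lemma group_presented_group: "group (presented_group R)"
proof (rule groupI)
  fix x assume "x \<in> carrier (presented_group R)"
  then obtain u where u: "x = pres_class R u" by (auto simp: presented_group_def)
  have "pres_class R (map (\<lambda>(s, b). (s, \<not> b)) (rev u)) \<otimes>\<^bsub>presented_group R\<^esub> x = \<one>\<^bsub>presented_group R\<^esub>"
    unfolding u presented_group_mult by (simp add: presented_group_def pres_class_eq_iff pres_eq_inverse)
  then show "\<exists>y\<in>carrier (presented_group R). y \<otimes>\<^bsub>presented_group R\<^esub> x = \<one>\<^bsub>presented_group R\<^esub>"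
    by (auto simp: presented_group_def)
next
  have 1: "\<one>\<^bsub>presented_group R\<^esub> = pres_class R []" by (simp add: presented_group_def)
  have c: "\<exists>u. x = pres_class R u" if "x \<in> carrier (presented_group R)" for x
    using that by (auto simp: presented_group_def)
  have c': "pres_class R u \<in> carrier (presented_group R)" for u
    by (auto simp: presented_group_def)
  show "\<one>\<^bsub>presented_group R\<^esub> \<in> carrier (presented_group R)" by (simp add: 1 c')
  fix x y z
  assume "x \<in> carrier (presented_group R)"
  then obtain u where u: "x = pres_class R u" using c by blast
  show "\<one>\<^bsub>presented_group R\<^esub> \<otimes>\<^bsub>presented_group R\<^esub> x = x" by (simp add: 1 u)
  assume "y \<in> carrier (presented_group R)"
  then obtain v where v: "y = pres_class R v" using c by blast
  show "x \<otimes>\<^bsub>presented_group R\<^esub> y \<in> carrier (presented_group R)" by (simp add: u v c')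
  assume "z \<in> carrier (presented_group R)"
  then obtain w where w: "z = pres_class R w" using c by blast
  show "x \<otimes>\<^bsub>presented_group R\<^esub> y \<otimes>\<^bsub>presented_group R\<^esub> z =
        x \<otimes>\<^bsub>presented_group R\<^esub> (y \<otimes>\<^bsub>presented_group R\<^esub> z)"
    by (simp add: u v w)
qed

section \<open>The Coxeter group, its Tits form and its geometric representation\<close>

text \<open>Generators are indexed by the three-element type \<open>3\<close>, whose elements are \<open>1\<close>, \<open>2\<close> and \<open>3 = 0\<close>.\<close>

definition W_relators :: "3 word set" where
  "W_relators =
    {[(1, False), (1, False)],
     [(2, False), (2, False)],
     [(3, False), (3, False)],
     [(1, False), (3, False), (1, False), (3, False)]}"

definition W :: "3 word set monoid" where
  "W = presented_group W_relators"

definition cox_gen :: "3 \<Rightarrow> 3 word set" where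
  "cox_gen i = pres_class W_relators [(i, False)]"

definition tits_gram :: "real^3^3" where
  "tits_gram = vector [vector [ 1, -1,  0],
                       vector [-1,  1, -1],
                       vector [ 0, -1,  1]]"

definition tits_form :: "real^3 \<Rightarrow> real^3 \<Rightarrow> real" where
  "tits_form x y = (\<Sum>i\<in>UNIV. \<Sum>j\<in>UNIV. tits_gram $ i $ j * x $ i * y $ j)"

lemma tits_form_axis: "tits_form (axis i 1) (axis j 1) = tits_gram $ i $ j"
proof -
  have "tits_form (axis i 1) (axis j 1) =
        (\<Sum>k\<in>UNIV. \<Sum>l\<in>UNIV. if l = j then (if k = i then tits_gram $ k $ l else 0) else 0)"
    unfolding tits_form_def by (intro sum.cong) (auto simp: axis_def)
  then show ?thesis by simp
qed

lemma tits_form_values: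
  "tits_form (axis i 1) (axis i 1) = 1"
  "tits_form (axis 1 1) (axis 2 1) = -1" "tits_form (axis 2 1) (axis 1 1) = -1"
  "tits_form (axis 2 1) (axis 3 1) = -1" "tits_form (axis 3 1) (axis 2 1) = -1"
  "tits_form (axis 1 1) (axis 3 1) = 0" "tits_form (axis 3 1) (axis 1 1) = 0"
  using exhaust_3[of i] by (auto simp: tits_form_axis tits_gram_def vector_3)

text \<open>Linear automorphisms of \<open>\<real>\<^sup>n\<close> are represented by their matrices in the standard basis.\<close>

definition GL :: "(real^'n^'n) monoid" where
  "GL = \<lparr>carrier = {A. invertible A}, mult = (**), one = mat 1\<rparr>"

definition is_geometric_rep :: "(3 word set \<Rightarrow> real^3^3) \<Rightarrow> bool" where
  "is_geometric_rep \<rho> \<longleftrightarrow> \<rho> \<in> hom W GL \<and>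
    (\<forall>i j. \<rho> (cox_gen i) *v axis j 1 =
           axis j 1 - (2 * tits_form (axis j 1) (axis i 1)) *\<^sub>R axis i 1)"

section \<open>Bilinear forms and their orthogonal groups\<close>

text \<open>Nondegenerate symmetric forms only: the \<open>p + q\<close> vectors of the orthogonal basis span.\<close>

definition has_signature :: "('a::euclidean_space \<Rightarrow> 'a \<Rightarrow> real) \<Rightarrow> nat \<Rightarrow> nat \<Rightarrow> bool" where
  "has_signature B p q \<longleftrightarrow> bilinear B \<and> (\<forall>x y. B x y = B y x) \<and>
    (\<exists>P N. independent (P \<union> N) \<and> span (P \<union> N) = UNIV \<and>
       pairwise (\<lambda>x y. B x y = 0) (P \<union> N) \<and>
       (\<forall>x\<in>P. B x x > 0) \<and> (\<forall>x\<in>N. B x x < 0) \<and> card P = p \<and> card N = q)"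

definition orth_group :: "(real^'n \<Rightarrow> real^'n \<Rightarrow> real) \<Rightarrow> (real^'n^'n) monoid" where
  "orth_group B =
    \<lparr>carrier = {A. invertible A \<and> (\<forall>x y. B (A *v x) (A *v y) = B x y)},
     mult = (**), one = mat 1\<rparr>"

lemma group_orth_group: "group (orth_group B)"
proof (rule groupI)
  fix A assume "A \<in> carrier (orth_group B)"
  then have A: "invertible A" "\<And>x y. B (A *v x) (A *v y) = B x y"
    by (auto simp: orth_group_def)
  have I: "A ** matrix_inv A = mat 1" "matrix_inv A ** A = mat 1"
    using A(1) unfolding invertible_def matrix_inv_def by (rule someI2_ex, simp)+
  have "B (matrix_inv A *v x) (matrix_inv A *v y) = B x y" for x y
    using A(2)[of "matrix_inv A *v x" "matrix_inv A *v y"]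
    by (simp add: matrix_vector_mul_assoc I)
  moreover have "invertible (matrix_inv A)" using I invertible_def by blast
  ultimately show "\<exists>C\<in>carrier (orth_group B). C \<otimes>\<^bsub>orth_group B\<^esub> A = \<one>\<^bsub>orth_group B\<^esub>"
    using I by (auto simp: orth_group_def)
next
  show "\<one>\<^bsub>orth_group B\<^esub> \<in> carrier (orth_group B)"
    by (simp add: orth_group_def invertible_def)
next
  fix A C assume "A \<in> carrier (orth_group B)" "C \<in> carrier (orth_group B)"
  then show "A \<otimes>\<^bsub>orth_group B\<^esub> C \<in> carrier (orth_group B)"
    by (simp add: orth_group_def invertible_mult flip: matrix_vector_mul_assoc)
qed (simp_all add: orth_group_def matrix_mul_assoc)

definition form_2_1 :: "real^3 \<Rightarrow> real^3 \<Rightarrow> real" where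
  "form_2_1 x y = x $ 1 * y $ 1 + x $ 2 * y $ 2 - x $ 3 * y $ 3"

section \<open>Lattices\<close>

text \<open>
  Here and below \<open>G\<close> is a Lie group given as a closed linear group, so its topology is the
  subspace topology of \<open>carrier G\<close>. The points of \<open>\<Gamma>\G\<close> are the cosets \<open>\<Gamma>g\<close>, on which \<open>G\<close> acts by
  right translation. Its Borel sets are those of the quotient topology.
\<close>

definition coset_borel_sets :: "('a::topological_space) monoid \<Rightarrow> 'a set \<Rightarrow> 'a set set set" where
  "coset_borel_sets G \<Gamma> = sigma_sets (rcosets\<^bsub>G\<^esub> \<Gamma>)
    {U. U \<subseteq> rcosets\<^bsub>G\<^esub> \<Gamma> \<and> openin (top_of_set (carrier G)) {g \<in> carrier G. \<Gamma> #>\<^bsub>G\<^esub> g \<in> U}}"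

definition is_lattice :: "('a::topological_space) monoid \<Rightarrow> 'a set \<Rightarrow> bool" where
  "is_lattice G \<Gamma> \<longleftrightarrow> subgroup \<Gamma> G \<and> discrete \<Gamma> \<and>
    (\<exists>\<mu>. space \<mu> = rcosets\<^bsub>G\<^esub> \<Gamma> \<and> sets \<mu> = coset_borel_sets G \<Gamma> \<and>
       emeasure \<mu> (space \<mu>) < \<infinity> \<and> emeasure \<mu> (space \<mu>) \<noteq> 0 \<and>
       (\<forall>g\<in>carrier G. \<forall>E\<in>sets \<mu>. emeasure \<mu> ((\<lambda>C. C #>\<^bsub>G\<^esub> g) ` E) = emeasure \<mu> E))"

section \<open>Real rank\<close>

text \<open>
  The real rank of a linear Lie group is the dimension of a maximal \<open>\<real>\<close>-split torus, where an
  \<open>\<real>\<close>-split torus is a closed connected subgroup that is diagonalizable over \<open>\<real>\<close>.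
\<close>

definition split_torus :: "(real^'n^'n) monoid \<Rightarrow> (real^'n^'n) set \<Rightarrow> bool" where
  "split_torus G T \<longleftrightarrow> subgroup T G \<and> closedin (top_of_set (carrier G)) T \<and> connected T \<and>
    (\<exists>P :: real^'n^'n. invertible P \<and> (\<forall>A\<in>T. \<forall>i j. i \<noteq> j \<longrightarrow> (matrix_inv P ** A ** P) $ i $ j = 0))"

definition has_manifold_dim :: "('a::topological_space) set \<Rightarrow> nat \<Rightarrow> bool" where
  "has_manifold_dim T d \<longleftrightarrow>
    (\<forall>x\<in>T. \<exists>U. openin (top_of_set T) U \<and> x \<in> U \<and> top_of_set U homeomorphic_space Euclidean_space d)"

definition has_real_rank :: "(real^'n^'n) monoid \<Rightarrow> nat \<Rightarrow> bool" where
  "has_real_rank G r \<longleftrightarrow>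
    (\<exists>T. split_torus G T \<and> has_manifold_dim T r) \<and>
    (\<forall>T d. split_torus G T \<longrightarrow> has_manifold_dim T d \<longrightarrow> d \<le> r)"

end

theory Submission
  imports Defs
begin

text \<open>
  The key is a model of \<open>(\<real>\<^sup>3, B)\<close> in which everything is visible. Sending the coordinates
  \<open>(x\<^sub>1, x\<^sub>2, x\<^sub>3)\<close> to the symmetric matrix with rows \<open>(p, q)\<close>, \<open>(q, r)\<close>, where
  \<open>p = 2 x\<^sub>2 - x\<^sub>3\<close>, \<open>q = x\<^sub>2 - x\<^sub>1\<close>, \<open>r = x\<^sub>3\<close>, turns the Tits form into the polar form of
  \<open>q\<^sup>2 - p r\<close>, that is, of minus the determinant. A real \<open>2 \<times> 2\<close> matrix \<open>M\<close> with
  \<open>det M \<noteq> 0\<close> acts by \<open>S \<mapsto> M S M\<^sup>T / \<bar>det M\<bar>\<close>, and every element of \<open>O(B)\<close> is such an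
  action up to sign. The positive definite matrices up to scale form the hyperbolic plane, and the
  generators \<open>s\<^sub>1\<close>, \<open>s\<^sub>2\<close>, \<open>s\<^sub>3\<close> become the reflections in the sides \<open>q = 0\<close>, \<open>q = r\<close>, \<open>p = r\<close> of
  the triangle \<open>p \<ge> r \<ge> q \<ge> 0\<close>, which has one right angle and two ideal vertices.

  Discreteness is immediate, since the generators preserve \<open>\<int>\<^sup>3\<close>. Faithfulness is a ping-pong
  argument (\<open>ping_pong\<close>) for the free product of \<open>{1, s\<^sub>1, s\<^sub>3, s\<^sub>1 s\<^sub>3}\<close> and \<open>{1, s\<^sub>2}\<close>: each
  nontrivial syllable throws an interior point of the triangle across the wall that belongs to it.

  For the finite invariant measure there are three ingredients. A bi-invariant measure on \<open>O(B)\<close> is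
  the image of Lebesgue measure on pairs \<open>(M, t)\<close> with \<open>0 < \<bar>det M\<bar> \<le> 1\<close> and \<open>0 < \<bar>t\<bar> \<le> 1\<close> under
  \<open>(M, t) \<mapsto> sgn t \<cdot> M\<close>: left and right translations lift to linear maps of determinant
  \<open>\<plusminus>1\<close>. On the right it is enough to lift reflections and \<open>- 1\<close>, because these generate \<open>O(B)\<close>
  (\<open>OB_induct\<close>). The frames over the triangle meet every orbit of the group (\<open>word_to_chamber\<close>): among
  the translates of an integral vector inside the triangle, one that pairs minimally with a given
  point exists by integrality, and
  minimality says that the point is on the right side of all three walls. Finally these frames have
  finite measure (\<open>haar_chamber_frames_finite\<close>): they fall into three pieces which measure-preserving
  row operations move into a Siegel set of \<open>GL(2)\<close>. There the second row of \<open>M\<close> is bounded, and for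
  each second row the first row stays in a rectangle of area \<open>2\<close>. A general criterion, proved in the locale
  \<open>finite_volume_cover\<close>, turns a measurable set of finite measure that meets every orbit into a
  finite invariant measure on the coset space.

  The real rank is \<open>1\<close> because a diagonal matrix with entries \<open>t\<^sub>i\<close> that preserves a
  nondegenerate form \<open>(b\<^sub>i\<^sub>j)\<close> satisfies \<open>t\<^sub>i t\<^sub>j = 1\<close> whenever \<open>b\<^sub>i\<^sub>j \<noteq> 0\<close>. The entries are
  positive on a connected torus, so in dimension three at most one of them is free, and a split torus injects continuously into the line.
\<close>

section \<open>Matrices\<close>

lemma matrix_inv_cancel:
  assumes "invertible (P :: real^'n^'n)"
  shows "P ** matrix_inv P = mat 1" "matrix_inv P ** P = mat 1"
  using assms unfolding invertible_def matrix_inv_def by (rule someI2_ex, simp)+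

lemma matrix_of_columns:
  fixes q :: "3 \<Rightarrow> real^3"
  obtains Q :: "real^3^3" where "\<And>x. Q *v x = x $ 1 *\<^sub>R q 1 + x $ 2 *\<^sub>R q 2 + x $ 3 *\<^sub>R q 3"
proof -
  let ?f = "\<lambda>x :: real^3. x $ 1 *\<^sub>R q 1 + x $ 2 *\<^sub>R q 2 + x $ 3 *\<^sub>R q 3"
  have "linear ?f" by (rule linearI) (simp_all add: algebra_simps)
  then have "matrix ?f *v x = ?f x" for x by (subst matrix_vector_mul(2)) simp_all
  then show thesis by (rule that)
qed

lemma matrix_axis_nth: "(M *v axis j 1) $ i = M $ i $ j" for M :: "real^'n^'m"
  by (simp add: matrix_vector_mult_basis column_def)

lemma matrix_eq_on_axes: "(\<And>j. A *v axis j 1 = C *v axis j 1) \<Longrightarrow> A = (C :: real^'n^'m)"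
  by (simp add: matrix_vector_mult_basis column_def vec_eq_iff)

section \<open>Lattices from sets of finite measure that meet every orbit\<close>

text \<open>
  The hypotheses ask only for a measurable set \<open>D\<close> of finite measure that meets every
  \<open>\<Gamma>\<close>-orbit; its translates may overlap. An exact fundamental domain is then cut out of \<open>D\<close>.
\<close>

locale finite_volume_cover = group G for G :: "'a::second_countable_topology monoid" (structure) +
  fixes \<Gamma> :: "'a set" and \<nu> :: "'a measure" and D :: "'a set"
  assumes carrier_borel: "carrier G \<in> sets borel"
    and continuous_mult: "continuous_on (carrier G \<times> carrier G) (\<lambda>(x, y). x \<otimes> y)"
    and continuous_inv: "continuous_on (carrier G) (\<lambda>x. inv x)"
    and subgroup: "subgroup \<Gamma> G"
    and countable: "countable \<Gamma>"
    and discrete: "discrete \<Gamma>"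
    and sets_\<nu> [measurable_cong]: "sets \<nu> = sets borel"
    and left_invariant:
      "\<lbrakk>h \<in> \<Gamma>; E \<in> sets borel; E \<subseteq> carrier G\<rbrakk> \<Longrightarrow> emeasure \<nu> ((\<lambda>x. h \<otimes> x) ` E) = emeasure \<nu> E"
    and right_invariant:
      "\<lbrakk>g \<in> carrier G; E \<in> sets borel; E \<subseteq> carrier G\<rbrakk> \<Longrightarrow> emeasure \<nu> ((\<lambda>x. x \<otimes> g) ` E) = emeasure \<nu> E"
    and nonzero: "emeasure \<nu> (carrier G) \<noteq> 0"
    and D_borel: "D \<in> sets borel"
    and D_carrier: "D \<subseteq> carrier G"
    and D_covers: "g \<in> carrier G \<Longrightarrow> \<exists>h\<in>\<Gamma>. h \<otimes> g \<in> D"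
    and D_finite: "emeasure \<nu> D < \<infinity>"
begin

lemma \<Gamma>_carrier: "h \<in> \<Gamma> \<Longrightarrow> h \<in> carrier G"
  using subgroup subgroup.subset by blast

lemma continuous_left:
  assumes "h \<in> carrier G"
  shows "continuous_on (carrier G) (\<lambda>x. h \<otimes> x)"
proof -
  have "continuous_on (carrier G) (\<lambda>x. (h, x))"
    by (intro continuous_on_Pair continuous_on_id continuous_on_const)
  from continuous_on_compose2[OF continuous_mult this] assms show ?thesis
    by (simp add: image_subset_iff)
qed

lemma continuous_right:
  assumes "h \<in> carrier G"
  shows "continuous_on (carrier G) (\<lambda>x. x \<otimes> h)"
proof -
  have "continuous_on (carrier G) (\<lambda>x. (x, h))"
    by (intro continuous_on_Pair continuous_on_id continuous_on_const)
  from continuous_on_compose2[OF continuous_mult this] assms show ?thesis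
    by (simp add: image_subset_iff)
qed

lemma borel_preimage:
  assumes "continuous_on (carrier G) f" "E \<in> sets borel"
  shows "{x \<in> carrier G. f x \<in> E} \<in> sets borel"
proof -
  have "f \<in> restrict_space borel (carrier G) \<rightarrow>\<^sub>M borel"
    using assms(1) by (rule borel_measurable_continuous_on_restrict)
  from measurable_sets[OF this assms(2)]
  have "f -` E \<inter> carrier G \<in> sets (restrict_space borel (carrier G))"
    by (simp add: space_restrict_space)
  then have "f -` E \<inter> carrier G \<in> sets borel"
    using carrier_borel by (simp add: sets_restrict_space_iff)
  moreover have "f -` E \<inter> carrier G = {x \<in> carrier G. f x \<in> E}" by auto
  ultimately show ?thesis by simp
qed

lemma left_translate_eq:
  assumes "h \<in> carrier G" "E \<subseteq> carrier G"
  shows "(\<lambda>x. h \<otimes> x) ` E = {x \<in> carrier G. inv h \<otimes> x \<in> E}"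
proof (intro equalityI subsetI)
  fix x assume "x \<in> {x \<in> carrier G. inv h \<otimes> x \<in> E}"
  moreover from this have "x = h \<otimes> (inv h \<otimes> x)"
    using assms by (simp add: m_assoc[symmetric])
  ultimately show "x \<in> (\<lambda>x. h \<otimes> x) ` E" by blast
qed (use assms in \<open>auto simp: m_assoc[symmetric] subset_iff\<close>)

lemma right_translate_eq:
  assumes "h \<in> carrier G" "E \<subseteq> carrier G"
  shows "(\<lambda>x. x \<otimes> h) ` E = {x \<in> carrier G. x \<otimes> inv h \<in> E}"
proof (intro equalityI subsetI)
  fix x assume "x \<in> {x \<in> carrier G. x \<otimes> inv h \<in> E}"
  moreover from this have "x = (x \<otimes> inv h) \<otimes> h"
    using assms by (simp add: m_assoc)
  ultimately show "x \<in> (\<lambda>x. x \<otimes> h) ` E" by blast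
qed (use assms in \<open>auto simp: m_assoc subset_iff\<close>)

lemma left_translate_borel:
  "\<lbrakk>h \<in> carrier G; E \<subseteq> carrier G; E \<in> sets borel\<rbrakk> \<Longrightarrow> (\<lambda>x. h \<otimes> x) ` E \<in> sets borel"
  by (simp add: left_translate_eq borel_preimage continuous_left)

lemma right_translate_borel:
  "\<lbrakk>h \<in> carrier G; E \<subseteq> carrier G; E \<in> sets borel\<rbrakk> \<Longrightarrow> (\<lambda>x. x \<otimes> h) ` E \<in> sets borel"
  by (simp add: right_translate_eq borel_preimage continuous_right)

text \<open>
  A strict fundamental domain: exactly one representative of each coset, with no exceptional
  null set. This is possible because \<open>\<Gamma>\<close> acts freely on \<open>G\<close> by translations.
\<close>

definition fundamental_domain :: "'a set \<Rightarrow> bool" where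
  "fundamental_domain F \<longleftrightarrow> F \<in> sets borel \<and> F \<subseteq> carrier G \<and>
     (\<forall>g\<in>carrier G. \<exists>!h. h \<in> \<Gamma> \<and> h \<otimes> g \<in> F)"

definition wandering :: "'a set \<Rightarrow> bool" where
  "wandering U \<longleftrightarrow> (\<forall>h\<in>\<Gamma>. \<forall>x\<in>U. x \<in> carrier G \<longrightarrow> h \<otimes> x \<in> U \<longrightarrow> h = \<one>)"

text \<open>
  Discreteness of \<open>\<Gamma>\<close> isolates \<open>\<one>\<close>, and \<open>(x, y) \<mapsto> x y\<inverse>\<close> sends \<open>(g, g)\<close> to \<open>\<one>\<close>. By
  continuity it maps a product neighbourhood of \<open>(g, g)\<close> into the isolating set.
\<close>

lemma wandering_nhd:
  assumes g: "g \<in> carrier G"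
  obtains U where "open U" "g \<in> U" "wandering U"
proof -
  have "\<one> \<in> \<Gamma>" using subgroup by (rule subgroup.one_closed)
  then obtain T where T: "open T" "T \<inter> \<Gamma> = {\<one>}"
    using discrete by (auto simp: discrete_def isolated_in_def)
  let ?f = "\<lambda>(x, y). x \<otimes> inv y"
  have "continuous_on (carrier G \<times> carrier G) (\<lambda>p. (fst p, inv (snd p)))"
    by (intro continuous_intros continuous_on_compose2[OF continuous_inv]) auto
  then have "continuous_on (carrier G \<times> carrier G) ?f"
    using continuous_on_compose2[OF continuous_mult, of _ "\<lambda>p. (fst p, inv (snd p))"]
    by (force simp: case_prod_unfold)
  then obtain A where A: "open A" "A \<inter> (carrier G \<times> carrier G) = ?f -` T \<inter> (carrier G \<times> carrier G)"
    using T(1) unfolding continuous_on_open_invariant by blast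
  have "\<one> \<in> T" using T(2) by auto
  then have "(g, g) \<in> ?f -` T \<inter> (carrier G \<times> carrier G)" using g by simp
  then have "(g, g) \<in> A" using A(2) by blast
  with \<open>open A\<close> obtain U V where UV: "open U" "open V" "(g, g) \<in> U \<times> V" "U \<times> V \<subseteq> A"
    by (rule open_prod_elim)
  have "wandering (U \<inter> V)"
    unfolding wandering_def
  proof (intro ballI impI)
    fix h x assume h: "h \<in> \<Gamma>" and x: "x \<in> U \<inter> V" "x \<in> carrier G" "h \<otimes> x \<in> U \<inter> V"
    then have "(h \<otimes> x, x) \<in> A \<inter> (carrier G \<times> carrier G)" using UV(4) \<Gamma>_carrier by auto
    then have "(h \<otimes> x) \<otimes> inv x \<in> T" using A(2) by auto
    moreover have "(h \<otimes> x) \<otimes> inv x = h" using h x \<Gamma>_carrier by (simp add: m_assoc)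
    ultimately show "h = \<one>" using T(2) h by auto
  qed
  then show thesis using UV that[of "U \<inter> V"] by auto
qed

text \<open>
  Countably many open sets \<open>U\<^sub>0, U\<^sub>1, \<dots>\<close> without self-intersections under \<open>\<Gamma>\<close> cover \<open>G\<close>. A coset
  is represented by its unique point in \<open>D \<inter> U\<^sub>n\<close> for the least \<open>n\<close> for which there is one.
\<close>

lemma ex_fundamental_domain: "\<exists>F. fundamental_domain F \<and> F \<subseteq> D"
proof -
  obtain \<B> :: "'a set set" where \<B>: "countable \<B>" "\<And>U. U \<in> \<B> \<Longrightarrow> open U"
      "\<And>g W. open W \<Longrightarrow> g \<in> W \<Longrightarrow> \<exists>U\<in>\<B>. g \<in> U \<and> U \<subseteq> W"
    using ex_countable_basis topological_basisE topological_basis_open by metis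
  define \<U> where "\<U> = {U \<in> \<B>. wandering U}"
  have cov: "\<exists>U\<in>\<U>. g \<in> U" if g: "g \<in> carrier G" for g
  proof -
    obtain W where W: "open W" "g \<in> W" "wandering W" using wandering_nhd[OF g] by blast
    obtain U where "U \<in> \<B>" "g \<in> U" "U \<subseteq> W" using \<B>(3)[OF W(1,2)] by blast
    then show ?thesis using W(3) by (fastforce simp: \<U>_def wandering_def)
  qed
  have "\<one> \<in> carrier G" by simp
  then have ne: "\<U> \<noteq> {}" using cov by blast
  have cU: "countable \<U>" using \<B>(1) by (simp add: \<U>_def)
  define U where "U = from_nat_into \<U>"
  have U: "U n \<in> \<U>" for n using ne by (simp add: U_def from_nat_into)
  have covU: "\<exists>n. g \<in> U n" if "g \<in> carrier G" for g
    using cov[OF that] from_nat_into_surj[OF cU] by (auto simp: U_def)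
  define E where "E n = D \<inter> U n" for n
  define S where "S n = (\<Union>h\<in>\<Gamma>. (\<lambda>x. h \<otimes> x) ` E n)" for n
  define F where "F = (\<Union>n. E n - (\<Union>m<n. S m))"
  have EB: "E n \<in> sets borel" "E n \<subseteq> carrier G" for n
    using U[of n] \<B>(2) D_borel D_carrier by (auto simp: E_def \<U>_def)
  have SB: "S n \<in> sets borel" for n
    unfolding S_def using countable EB \<Gamma>_carrier
    by (intro sets.countable_UN'') (auto intro!: left_translate_borel)
  have S_iff: "x \<in> S n \<longleftrightarrow> (\<exists>h\<in>\<Gamma>. h \<otimes> x \<in> E n)" if x: "x \<in> carrier G" for x n
  proof
    assume "x \<in> S n"
    then obtain h where h: "h \<in> \<Gamma>" "x \<in> (\<lambda>x. h \<otimes> x) ` E n" by (auto simp: S_def)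
    have "inv h \<otimes> x \<in> E n"
      using h(2) unfolding left_translate_eq[OF \<Gamma>_carrier[OF h(1)] EB(2)[of n]] by simp
    then show "\<exists>h\<in>\<Gamma>. h \<otimes> x \<in> E n" using subgroup.m_inv_closed[OF subgroup h(1)] by blast
  next
    assume "\<exists>h\<in>\<Gamma>. h \<otimes> x \<in> E n"
    then obtain h where h: "h \<in> \<Gamma>" "h \<otimes> x \<in> E n" by blast
    have "x \<in> (\<lambda>x. inv h \<otimes> x) ` E n"
      unfolding left_translate_eq[OF inv_closed[OF \<Gamma>_carrier[OF h(1)]] EB(2)[of n]]
      using h x \<Gamma>_carrier by simp
    then show "x \<in> S n" unfolding S_def using subgroup.m_inv_closed[OF subgroup h(1)] by blast
  qed
  have S_shift: "h \<otimes> x \<in> S n \<longleftrightarrow> x \<in> S n" if "x \<in> carrier G" "h \<in> \<Gamma>" for x n h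
  proof -
    have "(\<exists>k\<in>\<Gamma>. k \<otimes> (h \<otimes> x) \<in> E n) \<longleftrightarrow> (\<exists>k\<in>\<Gamma>. k \<otimes> x \<in> E n)"
    proof
      assume "\<exists>k\<in>\<Gamma>. k \<otimes> (h \<otimes> x) \<in> E n"
      then obtain k where "k \<in> \<Gamma>" "k \<otimes> (h \<otimes> x) \<in> E n" by blast
      then show "\<exists>k\<in>\<Gamma>. k \<otimes> x \<in> E n"
        using that \<Gamma>_carrier subgroup.m_closed[OF subgroup] by (intro bexI[of _ "k \<otimes> h"]) (auto simp: m_assoc)
    next
      assume "\<exists>k\<in>\<Gamma>. k \<otimes> x \<in> E n"
      then obtain k where k: "k \<in> \<Gamma>" "k \<otimes> x \<in> E n" by blast
      have "k \<otimes> inv h \<otimes> (h \<otimes> x) = k \<otimes> x"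
        using k that \<Gamma>_carrier by (metis inv_closed inv_solve_right m_assoc m_closed)
      then show "\<exists>k\<in>\<Gamma>. k \<otimes> (h \<otimes> x) \<in> E n"
        using that k subgroup.m_closed[OF subgroup] subgroup.m_inv_closed[OF subgroup]
        by (intro bexI[of _ "k \<otimes> inv h"]) auto
    qed
    then show ?thesis using S_iff that \<Gamma>_carrier by simp
  qed
  have "fundamental_domain F"
    unfolding fundamental_domain_def
  proof (intro conjI ballI)
    show "F \<in> sets borel" using EB SB by (auto simp: F_def)
    show "F \<subseteq> carrier G" using EB by (auto simp: F_def)
    fix g assume g: "g \<in> carrier G"
    obtain h0 where h0: "h0 \<in> \<Gamma>" "h0 \<otimes> g \<in> D" using D_covers[OF g] by blast
    obtain n0 where "h0 \<otimes> g \<in> U n0" using covU[of "h0 \<otimes> g"] g h0 \<Gamma>_carrier by blast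
    then have "g \<in> S n0" using S_iff[OF g] h0 by (auto simp: E_def)
    define n where "n = (LEAST n. g \<in> S n)"
    have n: "g \<in> S n" "\<And>m. m < n \<Longrightarrow> g \<notin> S m"
      using \<open>g \<in> S n0\<close> by (auto simp: n_def intro: LeastI dest: not_less_Least)
    obtain h where h: "h \<in> \<Gamma>" "h \<otimes> g \<in> E n" using n(1) S_iff[OF g] by blast
    show "\<exists>!h. h \<in> \<Gamma> \<and> h \<otimes> g \<in> F"
    proof (rule ex1I[of _ h])
      show "h \<in> \<Gamma> \<and> h \<otimes> g \<in> F"
        using h n(2) S_shift[OF g h(1)] by (auto simp: F_def)
      fix k assume k: "k \<in> \<Gamma> \<and> k \<otimes> g \<in> F"
      then obtain m where m: "k \<otimes> g \<in> E m" "\<And>l. l < m \<Longrightarrow> k \<otimes> g \<notin> S l" by (auto simp: F_def)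
      have "g \<in> S m" using m(1) k S_iff[OF g] by blast
      moreover have "\<And>l. l < m \<Longrightarrow> g \<notin> S l" using m(2) S_shift[OF g] k by blast
      ultimately have [simp]: "m = n" using n by (metis linorder_neqE_nat)
      have "(k \<otimes> inv h) \<otimes> (h \<otimes> g) = k \<otimes> g"
        using k h g \<Gamma>_carrier by (metis inv_closed inv_solve_right m_assoc m_closed)
      moreover have "wandering (U n)" using U[of n] by (simp add: \<U>_def)
      moreover have "k \<otimes> inv h \<in> \<Gamma>"
        using k h subgroup.m_closed[OF subgroup] subgroup.m_inv_closed[OF subgroup] by blast
      ultimately have "k \<otimes> inv h = \<one>"
        using m(1) h g \<Gamma>_carrier unfolding wandering_def E_def by (metis IntD2 \<open>m = n\<close> m_closed)
      then show "k = h" using k h \<Gamma>_carrier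
        by (metis inv_equality inv_inv inv_closed)
    qed
  qed
  moreover have "F \<subseteq> D" by (auto simp: F_def E_def)
  ultimately show ?thesis by blast
qed

text \<open>
  These are the preimages in \<open>G\<close> of measurable subsets of the coset space.
\<close>

definition saturated :: "'a set \<Rightarrow> bool" where
  "saturated A \<longleftrightarrow> A \<in> sets borel \<and> A \<subseteq> carrier G \<and> (\<forall>h\<in>\<Gamma>. \<forall>x\<in>carrier G. h \<otimes> x \<in> A \<longleftrightarrow> x \<in> A)"

text \<open>
  Cut \<open>A \<inter> F\<close> into the pieces that a fixed \<open>h \<in> \<Gamma>\<close> carries into \<open>F'\<close>. Their translates are the
  pieces of \<open>A \<inter> F'\<close>, and left invariance compares them one by one. This is what makes the measure
  of a subset of the coset space independent of the fundamental domain, and hence \<open>G\<close>-invariant.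
\<close>

lemma measure_fundamental_domains_eq:
  assumes F: "fundamental_domain F" and F': "fundamental_domain F'" and A: "saturated A"
  shows "emeasure \<nu> (A \<inter> F) = emeasure \<nu> (A \<inter> F')"
proof -
  define X where "X h = {x \<in> A \<inter> F. inv h \<otimes> x \<in> F'}" for h
  define Y where "Y h = {x \<in> A \<inter> F'. h \<otimes> x \<in> F}" for h
  have bF: "F \<in> sets borel" "F \<subseteq> carrier G" "F' \<in> sets borel" "F' \<subseteq> carrier G"
    using F F' by (auto simp: fundamental_domain_def)
  have bA: "A \<in> sets borel" "A \<subseteq> carrier G" using A by (auto simp: saturated_def)
  have invG: "inv h \<in> \<Gamma>" if "h \<in> \<Gamma>" for h
    using that subgroup by (rule subgroup.m_inv_closed[rotated])
  have Xe: "X h = (A \<inter> F) \<inter> {x \<in> carrier G. inv h \<otimes> x \<in> F'}" for h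
    using bF by (auto simp: X_def)
  have Ye: "Y h = (A \<inter> F') \<inter> {x \<in> carrier G. h \<otimes> x \<in> F}" for h
    using bF by (auto simp: Y_def)
  have Xb: "X h \<in> sets borel" if "h \<in> \<Gamma>" for h
    unfolding Xe using bF bA that \<Gamma>_carrier
    by (intro sets.Int borel_preimage continuous_left) auto
  have Yb: "Y h \<in> sets borel" if "h \<in> \<Gamma>" for h
    unfolding Ye using bF bA that \<Gamma>_carrier
    by (intro sets.Int borel_preimage continuous_left) auto
  have XY: "X h = (\<lambda>x. h \<otimes> x) ` Y h" if "h \<in> \<Gamma>" for h
  proof -
    have "(\<lambda>x. h \<otimes> x) ` Y h = {x \<in> carrier G. inv h \<otimes> x \<in> Y h}"
      using that \<Gamma>_carrier bA by (intro left_translate_eq) (auto simp: Y_def)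
    also have "\<dots> = X h"
    proof -
      have "h \<otimes> (inv h \<otimes> x) = x" if "x \<in> carrier G" for x
        using that \<Gamma>_carrier[OF \<open>h \<in> \<Gamma>\<close>] by (simp add: m_assoc[symmetric])
      then show ?thesis
        using A bA bF that invG by (auto simp: X_def Y_def saturated_def)
    qed
    finally show ?thesis by simp
  qed
  have uF: "h = k" if "h \<in> \<Gamma>" "k \<in> \<Gamma>" "x \<in> carrier G" "h \<otimes> x \<in> F" "k \<otimes> x \<in> F" for h k x
    using F that unfolding fundamental_domain_def by blast
  have uF': "h = k" if "h \<in> \<Gamma>" "k \<in> \<Gamma>" "x \<in> carrier G" "inv h \<otimes> x \<in> F'" "inv k \<otimes> x \<in> F'" for h k x
  proof -
    have "inv h = inv k" using F' that invG unfolding fundamental_domain_def by blast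
    then show ?thesis using that \<Gamma>_carrier by (metis inv_inv)
  qed
  have "A \<inter> F = (\<Union>h\<in>\<Gamma>. X h)"
  proof (intro equalityI subsetI)
    fix x assume x: "x \<in> A \<inter> F"
    then obtain h where h: "h \<in> \<Gamma>" "h \<otimes> x \<in> F'" using F' bF unfolding fundamental_domain_def by blast
    then have "x \<in> X (inv h)" using x \<Gamma>_carrier by (simp add: X_def)
    then show "x \<in> (\<Union>h\<in>\<Gamma>. X h)" using invG[OF h(1)] by blast
  qed (auto simp: X_def)
  moreover have "disjoint_family_on X \<Gamma>"
    using uF' bA unfolding disjoint_family_on_def X_def by blast
  ultimately have "emeasure \<nu> (A \<inter> F) = (\<integral>\<^sup>+h. emeasure \<nu> (X h) \<partial>count_space \<Gamma>)"
    using emeasure_UN_countable[of \<Gamma> X \<nu>] Xb countable by (simp add: sets_\<nu>)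
  also have "\<dots> = (\<integral>\<^sup>+h. emeasure \<nu> (Y h) \<partial>count_space \<Gamma>)"
  proof (intro nn_integral_cong)
    fix h assume "h \<in> space (count_space \<Gamma>)"
    then have h: "h \<in> \<Gamma>" by simp
    moreover have "Y h \<subseteq> carrier G" using bA by (auto simp: Y_def)
    ultimately show "emeasure \<nu> (X h) = emeasure \<nu> (Y h)"
      using XY Yb left_invariant by simp
  qed
  also have "\<dots> = emeasure \<nu> (A \<inter> F')"
  proof -
    have "A \<inter> F' = (\<Union>h\<in>\<Gamma>. Y h)"
      using F F' unfolding fundamental_domain_def Y_def by blast
    moreover have "disjoint_family_on Y \<Gamma>"
      using uF bA unfolding disjoint_family_on_def Y_def by blast
    ultimately show ?thesis
      using emeasure_UN_countable[of \<Gamma> Y \<nu>] Yb countable by (simp add: sets_\<nu>)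
  qed
  finally show ?thesis .
qed

lemma fundamental_domain_translate:
  assumes F: "fundamental_domain F" and g: "g \<in> carrier G"
  shows "fundamental_domain ((\<lambda>x. x \<otimes> g) ` F)"
proof -
  have bF: "F \<in> sets borel" "F \<subseteq> carrier G" using F by (auto simp: fundamental_domain_def)
  have *: "(\<lambda>x. x \<otimes> g) ` F = {x \<in> carrier G. x \<otimes> inv g \<in> F}"
    using right_translate_eq[OF g bF(2)] .
  have "\<exists>!h. h \<in> \<Gamma> \<and> h \<otimes> x \<in> (\<lambda>x. x \<otimes> g) ` F" if x: "x \<in> carrier G" for x
  proof -
    have "\<exists>!h. h \<in> \<Gamma> \<and> h \<otimes> (x \<otimes> inv g) \<in> F"
      using F x g unfolding fundamental_domain_def by simp
    moreover have "h \<otimes> (x \<otimes> inv g) = h \<otimes> x \<otimes> inv g" if "h \<in> \<Gamma>" for h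
      using that x g \<Gamma>_carrier by (simp add: m_assoc)
    ultimately show ?thesis unfolding * using x \<Gamma>_carrier by (metis (no_types, lifting) mem_Collect_eq m_closed)
  qed
  then show ?thesis
    unfolding fundamental_domain_def using right_translate_borel[OF g bF(2,1)] bF g by auto
qed

lemma coset_mem_rcosets: "g \<in> carrier G \<Longrightarrow> \<Gamma> #> g \<in> rcosets \<Gamma>"
  by (auto simp: RCOSETS_def)

lemma coset_left_mult: "h \<in> \<Gamma> \<Longrightarrow> g \<in> carrier G \<Longrightarrow> \<Gamma> #> (h \<otimes> g) = \<Gamma> #> g"
  using subgroup \<Gamma>_carrier coset_mult_assoc[of \<Gamma> h g] coset_join2[of h \<Gamma>]
  by (metis subgroup.subset)

text \<open>
  The measure of a set of cosets is the \<open>\<nu>\<close>-measure of its preimage inside a fundamental domain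
  \<open>F\<close>. Right translation by \<open>g\<close> replaces \<open>F\<close> by \<open>F g\<inverse>\<close>, which is again a fundamental domain.
\<close>

theorem lattice: "is_lattice G \<Gamma>"
proof -
  let ?Q = "{U. U \<subseteq> rcosets \<Gamma> \<and> openin (top_of_set (carrier G)) {g \<in> carrier G. \<Gamma> #> g \<in> U}}"
  define \<Sigma> where "\<Sigma> = sigma (rcosets \<Gamma>) ?Q"
  have space_\<Sigma>: "space \<Sigma> = rcosets \<Gamma>" by (auto simp: \<Sigma>_def intro!: space_measure_of)
  have sets_\<Sigma>: "sets \<Sigma> = coset_borel_sets G \<Gamma>"
    unfolding \<Sigma>_def coset_borel_sets_def by (rule sets_measure_of) auto
  let ?\<pi> = "\<lambda>g. \<Gamma> #> g"
  have \<pi>: "?\<pi> \<in> restrict_space borel (carrier G) \<rightarrow>\<^sub>M \<Sigma>"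
    unfolding \<Sigma>_def
  proof (rule measurable_sigma_sets[OF _ _ _ ])
    show "sets (sigma (rcosets \<Gamma>) ?Q) = sigma_sets (rcosets \<Gamma>) ?Q"
      by (rule sets_measure_of) auto
    show "?Q \<subseteq> Pow (rcosets \<Gamma>)" by auto
    show "?\<pi> \<in> space (restrict_space borel (carrier G)) \<rightarrow> rcosets \<Gamma>"
      using coset_mem_rcosets by (auto simp: space_restrict_space)
    fix U assume "U \<in> ?Q"
    then obtain T where T: "open T" "{g \<in> carrier G. \<Gamma> #> g \<in> U} = carrier G \<inter> T"
      by (auto simp: openin_open)
    have "?\<pi> -` U \<inter> space (restrict_space borel (carrier G)) = carrier G \<inter> T"
      using T(2) by (auto simp: space_restrict_space)
    then show "?\<pi> -` U \<inter> space (restrict_space borel (carrier G)) \<in> sets (restrict_space borel (carrier G))"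
      using T(1) by (auto simp: sets_restrict_space)
  qed
  have sat: "saturated {g \<in> carrier G. \<Gamma> #> g \<in> E}" if E: "E \<in> sets \<Sigma>" for E
  proof -
    have "?\<pi> -` E \<inter> carrier G \<in> sets (restrict_space borel (carrier G))"
      using measurable_sets[OF \<pi> E] by (simp add: space_restrict_space)
    then have "?\<pi> -` E \<inter> carrier G \<in> sets borel"
      using carrier_borel by (simp add: sets_restrict_space_iff)
    moreover have "?\<pi> -` E \<inter> carrier G = {g \<in> carrier G. \<Gamma> #> g \<in> E}" by auto
    ultimately show ?thesis
      unfolding saturated_def using \<Gamma>_carrier by (auto simp: coset_left_mult)
  qed
  obtain F where F: "fundamental_domain F" "F \<subseteq> D" using ex_fundamental_domain by blast
  have bF: "F \<in> sets borel" "F \<subseteq> carrier G" using F by (auto simp: fundamental_domain_def)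
  define \<mu> where "\<mu> = distr (restrict_space \<nu> F) \<Sigma> ?\<pi>"
  have \<pi>F: "?\<pi> \<in> restrict_space \<nu> F \<rightarrow>\<^sub>M \<Sigma>"
  proof -
    have "?\<pi> \<in> restrict_space (restrict_space borel (carrier G)) F \<rightarrow>\<^sub>M \<Sigma>"
      by (rule measurable_restrict_space1[OF \<pi>])
    also have "measurable (restrict_space (restrict_space borel (carrier G)) F) \<Sigma> =
        measurable (restrict_space \<nu> F) \<Sigma>"
      using bF carrier_borel by (intro measurable_cong_sets)
        (auto simp: restrict_restrict_space sets_restrict_space sets_\<nu> Int_absorb1)
    finally show ?thesis .
  qed
  have \<mu>: "emeasure \<mu> E = emeasure \<nu> ({g \<in> carrier G. \<Gamma> #> g \<in> E} \<inter> F)" if E: "E \<in> sets \<Sigma>" for E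
  proof -
    have "?\<pi> -` E \<inter> space (restrict_space \<nu> F) = {g \<in> carrier G. \<Gamma> #> g \<in> E} \<inter> F"
      using bF sets_eq_imp_space_eq[OF sets_\<nu>] by (auto simp: space_restrict_space)
    then show ?thesis
      using bF unfolding \<mu>_def emeasure_distr[OF \<pi>F E]
      by (simp add: emeasure_restrict_space sets_\<nu> sets_eq_imp_space_eq[OF sets_\<nu>])
  qed
  have inv1: "emeasure \<mu> ((\<lambda>C. C #> g) ` E) = emeasure \<mu> E"
    if g: "g \<in> carrier G" and E: "E \<in> sets \<Sigma>" for g E
  proof -
    let ?E' = "(\<lambda>C. C #> g) ` E"
    let ?A = "{x \<in> carrier G. \<Gamma> #> x \<in> E}"
    let ?r = "\<lambda>C. C #> inv g"
    have subE: "E \<subseteq> rcosets \<Gamma>" using sets.sets_into_space[OF E] space_\<Sigma> by simp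
    have sub: "C \<subseteq> carrier G" if "C \<in> rcosets \<Gamma>" for C
      using that \<Gamma>_carrier by (auto simp: RCOSETS_def r_coset_def)
    have r1: "?r ` {C} \<subseteq> rcosets \<Gamma>" if "C \<in> rcosets \<Gamma>" for C
      using that g \<Gamma>_carrier coset_mult_assoc[of \<Gamma> _ "inv g"] coset_mem_rcosets
      by (auto simp: RCOSETS_def subset_iff)
    have r1': "C #> g \<in> rcosets \<Gamma>" if "C \<in> rcosets \<Gamma>" for C
      using that g \<Gamma>_carrier coset_mult_assoc[of \<Gamma> _ "g"] coset_mem_rcosets
      by (auto simp: RCOSETS_def subset_iff)
    have r2: "(C #> g) #> inv g = C" "(C #> inv g) #> g = C" if "C \<in> rcosets \<Gamma>" for C
      using sub[OF that] g by (simp_all add: coset_mult_assoc)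
    have r\<Sigma>: "?r \<in> \<Sigma> \<rightarrow>\<^sub>M \<Sigma>"
      unfolding \<Sigma>_def
    proof (rule measurable_sigma_sets[OF _ _ _ ])
      show "sets (sigma (rcosets \<Gamma>) ?Q) = sigma_sets (rcosets \<Gamma>) ?Q"
        by (rule sets_measure_of) auto
      show "?Q \<subseteq> Pow (rcosets \<Gamma>)" by auto
      show "?r \<in> space (sigma (rcosets \<Gamma>) ?Q) \<rightarrow> rcosets \<Gamma>"
        using r1 space_\<Sigma> by (auto simp: \<Sigma>_def)
      fix U assume U: "U \<in> ?Q"
      let ?V = "?r -` U \<inter> rcosets \<Gamma>"
      have "{x \<in> carrier G. \<Gamma> #> x \<in> ?V} = {x \<in> carrier G. x \<otimes> inv g \<in> {x \<in> carrier G. \<Gamma> #> x \<in> U}}"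
        using g \<Gamma>_carrier coset_mem_rcosets by (auto simp: coset_mult_assoc subset_iff)
      also have "openin (top_of_set (carrier G)) \<dots>"
      proof -
        have "continuous_map (top_of_set (carrier G)) (top_of_set (carrier G)) (\<lambda>x. x \<otimes> inv g)"
          using continuous_right[of "inv g"] g by (auto simp: continuous_map_in_subtopology)
        from openin_continuous_map_preimage[OF this, of "{x \<in> carrier G. \<Gamma> #> x \<in> U}"] U
        show ?thesis by simp
      qed
      finally have "?V \<in> ?Q" by simp
      moreover have "space (sigma (rcosets \<Gamma>) ?Q) = rcosets \<Gamma>" using space_\<Sigma> by (simp add: \<Sigma>_def)
      ultimately show "?r -` U \<inter> space (sigma (rcosets \<Gamma>) ?Q) \<in> sets (sigma (rcosets \<Gamma>) ?Q)"
        by (metis (no_types, lifting) \<open>?Q \<subseteq> Pow (rcosets \<Gamma>)\<close> in_measure_of)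
    qed
    have E'_eq: "?E' = ?r -` E \<inter> space \<Sigma>"
    proof (intro equalityI subsetI)
      fix C assume "C \<in> ?E'"
      then show "C \<in> ?r -` E \<inter> space \<Sigma>" using subE r1' r2 space_\<Sigma> by auto
    next
      fix C assume C: "C \<in> ?r -` E \<inter> space \<Sigma>"
      then have "C = (C #> inv g) #> g" using r2 space_\<Sigma> by simp
      then show "C \<in> ?E'" using C by blast
    qed
    have E': "?E' \<in> sets \<Sigma>" unfolding E'_eq by (rule measurable_sets[OF r\<Sigma> E])
    have A': "{x \<in> carrier G. \<Gamma> #> x \<in> ?E'} = {x \<in> carrier G. x \<otimes> inv g \<in> ?A}"
      unfolding E'_eq space_\<Sigma> using g \<Gamma>_carrier coset_mem_rcosets by (auto simp: coset_mult_assoc subset_iff)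
    \<comment> \<open>Translating the set of cosets by \<open>g\<close> amounts to translating the fundamental domain by \<open>g\<inverse>\<close>.\<close>
    let ?F' = "(\<lambda>x. x \<otimes> inv g) ` F"
    have F': "fundamental_domain ?F'" using fundamental_domain_translate[OF F(1)] g by simp
    have F'_eq: "?F' = {x \<in> carrier G. x \<otimes> g \<in> F}" using right_translate_eq[of "inv g" F] g bF by simp
    have "(\<lambda>x. x \<otimes> g) ` (?A \<inter> ?F') = {x \<in> carrier G. x \<otimes> inv g \<in> ?A \<inter> ?F'}"
      using g by (intro right_translate_eq) auto
    also have "\<dots> = {x \<in> carrier G. \<Gamma> #> x \<in> ?E'} \<inter> F"
      unfolding A' F'_eq using g bF by (auto simp: m_assoc)
    finally have "emeasure \<mu> ?E' = emeasure \<nu> ((\<lambda>x. x \<otimes> g) ` (?A \<inter> ?F'))"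
      using \<mu>[OF E'] by simp
    also have "\<dots> = emeasure \<nu> (?A \<inter> ?F')"
      using sat[OF E] F' g by (intro right_invariant) (auto simp: fundamental_domain_def saturated_def)
    also have "\<dots> = emeasure \<nu> (?A \<inter> F)"
      by (rule measure_fundamental_domains_eq[OF F' F(1) sat[OF E]])
    also have "\<dots> = emeasure \<mu> E" using \<mu>[OF E] by simp
    finally show ?thesis .
  qed
  have tot: "emeasure \<mu> (space \<mu>) = emeasure \<nu> F"
  proof -
    have "emeasure \<mu> (space \<Sigma>) = emeasure \<nu> ({g \<in> carrier G. \<Gamma> #> g \<in> space \<Sigma>} \<inter> F)"
      by (rule \<mu>) simp
    moreover have "{g \<in> carrier G. \<Gamma> #> g \<in> space \<Sigma>} \<inter> F = F"
      using bF coset_mem_rcosets space_\<Sigma> by auto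
    ultimately show ?thesis by (simp add: \<mu>_def)
  qed
  have "emeasure \<nu> F \<noteq> 0"
  proof
    assume 0: "emeasure \<nu> F = 0"
    have "carrier G = (\<Union>h\<in>\<Gamma>. (\<lambda>x. h \<otimes> x) ` F)"
    proof (intro equalityI subsetI)
      fix g assume g: "g \<in> carrier G"
      then obtain h where h: "h \<in> \<Gamma>" "h \<otimes> g \<in> F" using F unfolding fundamental_domain_def by blast
      then have "g \<in> (\<lambda>x. inv h \<otimes> x) ` F"
        using left_translate_eq[of "inv h" F] bF \<Gamma>_carrier g by auto
      then show "g \<in> (\<Union>h\<in>\<Gamma>. (\<lambda>x. h \<otimes> x) ` F)"
        using subgroup.m_inv_closed[OF subgroup h(1)] by blast
    qed (use bF \<Gamma>_carrier in auto)
    moreover have "(\<Union>h\<in>\<Gamma>. (\<lambda>x. h \<otimes> x) ` F) \<in> null_sets \<nu>"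
      using countable bF 0 \<Gamma>_carrier left_invariant left_translate_borel
      by (intro null_sets_UN') (auto simp: null_sets_def sets_\<nu>)
    ultimately show False using nonzero by (simp add: null_sets_def)
  qed
  moreover have "emeasure \<nu> F < \<infinity>"
    using emeasure_mono[OF F(2), of \<nu>] D_borel D_finite by (simp add: sets_\<nu>)
  ultimately show ?thesis
    unfolding is_lattice_def using subgroup discrete inv1 tot space_\<Sigma> sets_\<Sigma>
    by (intro conjI exI[of _ \<mu>]) (auto simp: \<mu>_def)
qed

end

section \<open>The Tits form on symmetric matrices\<close>

lemma tits_form_expand:
  "tits_form x y = x$1 * y$1 + x$2 * y$2 + x$3 * y$3 - x$1 * y$2 - x$2 * y$1 - x$2 * y$3 - x$3 * y$2"
  by (simp add: tits_form_def sum_3 tits_gram_def vector_3 algebra_simps)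

lemma tits_form_bilinear: "bilinear tits_form"
  by (auto simp: bilinear_def linear_iff tits_form_expand algebra_simps)

lemmas tits_form_algebra =
  bilinear_ladd[OF tits_form_bilinear] bilinear_radd[OF tits_form_bilinear]
  bilinear_lsub[OF tits_form_bilinear] bilinear_rsub[OF tits_form_bilinear]
  bilinear_lneg[OF tits_form_bilinear] bilinear_rneg[OF tits_form_bilinear]
  bilinear_lmul[OF tits_form_bilinear] bilinear_rmul[OF tits_form_bilinear]

lemma tits_form_commute: "tits_form x y = tits_form y x"
  by (simp add: tits_form_expand algebra_simps)

text \<open>
  The entries \<open>p\<close>, \<open>q\<close>, \<open>r\<close> of the symmetric \<open>2 \<times> 2\<close> matrix with rows \<open>(p, q)\<close>, \<open>(q, r)\<close> that
  corresponds to a vector. They are chosen so that the Tits form becomes minus the polarised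
  determinant and the three walls become \<open>q = 0\<close>, \<open>q = r\<close> and \<open>p = r\<close>.
\<close>

definition sP :: "real^3 \<Rightarrow> real" where "sP x = 2 * x$2 - x$3"
definition sQ :: "real^3 \<Rightarrow> real" where "sQ x = x$2 - x$1"
definition sR :: "real^3 \<Rightarrow> real" where "sR x = x$3"

definition of_sym :: "real \<Rightarrow> real \<Rightarrow> real \<Rightarrow> real^3" where
  "of_sym p q r = vector [(p + r) / 2 - q, (p + r) / 2, r]"

lemma of_sym_coords [simp]: "sP (of_sym p q r) = p" "sQ (of_sym p q r) = q" "sR (of_sym p q r) = r"
  by (simp_all add: sP_def sQ_def sR_def of_sym_def field_simps)

lemma of_sym_inverse: "of_sym (sP x) (sQ x) (sR x) = x"
  by (simp add: vec_eq_iff forall_3 sP_def sQ_def sR_def of_sym_def)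

lemma sym_eqI: "\<lbrakk>sP x = sP y; sQ x = sQ y; sR x = sR y\<rbrakk> \<Longrightarrow> x = y"
  using of_sym_inverse by metis

lemma sym_linear [simp]:
  "sP (x + y) = sP x + sP y" "sQ (x + y) = sQ x + sQ y" "sR (x + y) = sR x + sR y"
  "sP (x - y) = sP x - sP y" "sQ (x - y) = sQ x - sQ y" "sR (x - y) = sR x - sR y"
  "sP (- x) = - sP x" "sQ (- x) = - sQ x" "sR (- x) = - sR x"
  "sP (c *\<^sub>R x) = c * sP x" "sQ (c *\<^sub>R x) = c * sQ x" "sR (c *\<^sub>R x) = c * sR x"
  by (simp_all add: sP_def sQ_def sR_def algebra_simps)

lemma sym_axis [simp]:
  "sP (axis 1 1) = 0" "sQ (axis 1 1) = -1" "sR (axis 1 1) = 0"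
  "sP (axis 2 1) = 2" "sQ (axis 2 1) = 1" "sR (axis 2 1) = 0"
  "sP (axis 3 1) = -1" "sQ (axis 3 1) = 0" "sR (axis 3 1) = 1"
  by (simp_all add: sP_def sQ_def sR_def axis_def)

lemma tits_form_sym: "tits_form x y = sQ x * sQ y - (sP x * sR y + sR x * sP y) / 2"
  by (simp add: tits_form_expand sP_def sQ_def sR_def field_simps)

definition reflection :: "real^3 \<Rightarrow> real^3^3" where
  "reflection v = matrix (\<lambda>x. x - (2 * tits_form x v / tits_form v v) *\<^sub>R v)"

lemma reflection_apply: "reflection v *v x = x - (2 * tits_form x v / tits_form v v) *\<^sub>R v"
proof -
  have "linear (\<lambda>x. x - (2 * tits_form x v / tits_form v v) *\<^sub>R v)"
    by (rule linearI) (simp_all add: tits_form_algebra algebra_simps add_divide_distrib scaleR_add_left)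
  then show ?thesis unfolding reflection_def by (subst matrix_vector_mul(2)) auto
qed

lemma reflection_axis: "reflection (axis i 1) *v x = x - (2 * tits_form x (axis i 1)) *\<^sub>R axis i 1"
  by (simp add: reflection_apply tits_form_values)

lemma reflection_apply_self: "tits_form v v \<noteq> 0 \<Longrightarrow> reflection v *v v = - v"
  by (simp add: reflection_apply scaleR_2)

lemma reflection_involution: "tits_form v v \<noteq> 0 \<Longrightarrow> reflection v ** reflection v = mat 1"
  by (simp add: matrix_eq matrix_vector_mul_assoc[symmetric] reflection_apply tits_form_algebra)
   
lemma reflection_isometry: "tits_form v v \<noteq> 0 \<Longrightarrow> tits_form (reflection v *v x) (reflection v *v y) = tits_form x y"
  by (simp add: reflection_apply tits_form_algebra tits_form_commute field_simps)

abbreviation OB :: "(real^3^3) monoid" where "OB \<equiv> orth_group tits_form"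

lemma OB_simps [simp]: "x \<otimes>\<^bsub>OB\<^esub> y = x ** y" "\<one>\<^bsub>OB\<^esub> = mat 1"
  by (simp_all add: orth_group_def)

lemma OB_I: "\<lbrakk>A ** C = mat 1; C ** A = mat 1; \<And>x y. tits_form (A *v x) (A *v y) = tits_form x y\<rbrakk>
  \<Longrightarrow> A \<in> carrier OB"
  by (auto simp: orth_group_def invertible_def)

lemma reflection_OB: "tits_form v v \<noteq> 0 \<Longrightarrow> reflection v \<in> carrier OB"
  by (rule OB_I[of _ "reflection v"]) (auto simp: reflection_involution reflection_isometry)

lemma minus_one_apply: "- mat 1 *v (x::real^3) = - x"
  by (simp add: vec_eq_iff forall_3 matrix_vector_mult_def sum_3 mat_def)

lemma minus_one_involution: "- mat 1 ** - mat 1 = (mat 1 :: real^3^3)"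
  by (simp add: matrix_eq matrix_vector_mul_assoc[symmetric] minus_one_apply)

lemma minus_one_OB: "- mat 1 \<in> carrier OB"
  by (rule OB_I[OF minus_one_involution minus_one_involution])
    (simp add: minus_one_apply tits_form_algebra)

lemma OB_isometry: "g \<in> carrier OB \<Longrightarrow> tits_form (g *v x) (g *v y) = tits_form x y"
  by (auto simp: orth_group_def)

lemma OB_mult: "\<lbrakk>g \<in> carrier OB; h \<in> carrier OB\<rbrakk> \<Longrightarrow> g ** h \<in> carrier OB"
  using group.subgroup_self[OF group_orth_group, of tits_form] monoid.m_closed[OF group.is_monoid[OF group_orth_group], of g tits_form h]
  by simp

text \<open>
  The identity matrix; in the coordinates of \<open>\<real>\<^sup>3\<close> it is \<open>(1, 1, 1)\<close>. It serves as the base point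
  of the hyperbolic plane and completes \<open>e\<^sub>1\<close>, \<open>e\<^sub>3\<close> to an orthogonal basis.
\<close>

definition base_point :: "real^3" where "base_point = of_sym 1 0 1"

lemma orthogonal_expansion:
  "y = tits_form y (axis 1 1) *\<^sub>R axis 1 1 + tits_form y (axis 3 1) *\<^sub>R axis 3 1 - tits_form y base_point *\<^sub>R base_point"
  by (rule sym_eqI) (simp_all add: base_point_def tits_form_sym field_simps)

lemma base_point_products:
  "tits_form base_point base_point = -1" "tits_form (axis 1 1) base_point = 0" "tits_form base_point (axis 1 1) = 0"
  "tits_form (axis 3 1) base_point = 0" "tits_form base_point (axis 3 1) = 0"
  by (simp_all add: base_point_def tits_form_sym)

lemma continuous_matrix_vector_nth: "continuous_on S (\<lambda>A :: real^'n^'m. (A *v x) $ i)"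
  unfolding matrix_vector_mult_def by (auto intro!: continuous_intros)

lemma continuous_sym_coords:
  "continuous_on S (\<lambda>A :: real^3^3. sP (A *v x))" "continuous_on S (\<lambda>A :: real^3^3. sQ (A *v x))"
  "continuous_on S (\<lambda>A :: real^3^3. sR (A *v x))"
  unfolding sP_def sQ_def sR_def
  by (intro continuous_on_diff continuous_on_mult continuous_on_const continuous_matrix_vector_nth)+

lemma tits_form_nondegenerate: "(\<And>y. tits_form x y = 0) \<Longrightarrow> x = 0"
proof -
  assume *: "\<And>y. tits_form x y = 0"
  show "x = 0"
    using *[of "axis 1 1"] *[of "axis 2 1"] *[of "axis 3 1"]
    by (intro sym_eqI) (simp_all add: tits_form_sym sP_def sQ_def sR_def axis_def)
qed

text \<open>
  An isometry of a nondegenerate form is injective, hence invertible.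
\<close>

lemma OB_iff: "A \<in> carrier OB \<longleftrightarrow> (\<forall>x y. tits_form (A *v x) (A *v y) = tits_form x y)"
proof
  assume *: "\<forall>x y. tits_form (A *v x) (A *v y) = tits_form x y"
  have "x = y" if "A *v x = A *v y" for x y
  proof -
    have "tits_form (x - y) z = 0" for z
      using * [rule_format, of "x - y" z] that
      by (simp add: matrix_vector_mult_diff_distrib tits_form_expand)
    then show ?thesis using tits_form_nondegenerate[of "x - y"] by simp
  qed
  then have "inj ((*v) A)" by (simp add: inj_def)
  then have "invertible A" by (simp add: invertible_left_inverse matrix_left_invertible_injective)
  then show "A \<in> carrier OB" using * by (simp add: orth_group_def)
qed (simp add: orth_group_def)

text \<open>
  The invertibility in the definition of the group is automatic for isometries, so that only closed
  conditions remain.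
\<close>

lemma closed_OB: "closed (carrier OB)"
proof -
  have "carrier OB = (\<Inter>x y. {A. tits_form (A *v x) (A *v y) = tits_form x y})"
    by (auto simp: OB_iff)
  also have "closed \<dots>"
    unfolding tits_form_expand matrix_vector_mult_def sum_3
    by (intro closed_INT ballI closed_Collect_eq continuous_intros) 
  finally show ?thesis .
qed

section \<open>Reflections generate the orthogonal group\<close>

text \<open>
  By the parallelogram identity \<open>B(x - y, x - y) + B(x + y, x + y) = 4 B(x, x) \<noteq> 0\<close>, one of
  \<open>x - y\<close> and \<open>x + y\<close> is anisotropic, and the reflection in it takes \<open>y\<close> to \<open>x\<close> or to \<open>- x\<close>.
\<close>

lemma move_by_reflection:
  assumes "tits_form x x = tits_form y y" "tits_form x x \<noteq> 0"
  obtains v c where "tits_form v v \<noteq> 0" "c = 1 \<or> c = (-1::real)" "c *\<^sub>R (reflection v *v y) = x"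
    "\<And>z. \<lbrakk>tits_form z x = 0; tits_form z y = 0\<rbrakk> \<Longrightarrow> reflection v *v z = z"
proof (cases "tits_form (x - y) (x - y) = 0")
  case False
  have s: "tits_form (x - y) (x - y) = 2 * tits_form x x - 2 * tits_form x y"
    using assms by (simp add: tits_form_algebra tits_form_commute)
  have "2 * tits_form y (x - y) = - tits_form (x - y) (x - y)"
    using assms s by (simp add: tits_form_algebra tits_form_commute)
  then have "reflection (x - y) *v y = x" using False unfolding reflection_apply by simp
  then show thesis using that[of "x - y" 1] False by (simp add: reflection_apply tits_form_algebra)
next
  case True
  have s: "tits_form (x - y) (x - y) = 2 * tits_form x x - 2 * tits_form x y"
    using assms by (simp add: tits_form_algebra tits_form_commute)
  have s': "tits_form (x + y) (x + y) = 2 * tits_form x x + 2 * tits_form x y"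
    using assms by (simp add: tits_form_algebra tits_form_commute)
  have "tits_form (x + y) (x + y) = 4 * tits_form x x" using s s' True by simp
  then have nz: "tits_form (x + y) (x + y) \<noteq> 0" using assms by simp
  have "2 * tits_form y (x + y) = tits_form (x + y) (x + y)"
    using assms s' by (simp add: tits_form_algebra tits_form_commute)
  then have "reflection (x + y) *v y = - x" using nz unfolding reflection_apply by simp
  then show thesis using that[of "x + y" "-1"] nz by (simp add: reflection_apply tits_form_algebra)
qed

text \<open>
  A form of the Cartan-Dieudonne theorem: reflections and \<open>- 1\<close> generate the orthogonal group.
  Signed reflections first bring the image of \<open>e\<^sub>1\<close> back to \<open>e\<^sub>1\<close>, then the image of \<open>e\<^sub>3\<close> back to
  \<open>e\<^sub>3\<close> while fixing \<open>e\<^sub>1\<close> up to sign. What remains is diagonal with signs on an orthogonal basis.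
\<close>

lemma OB_induct [consumes 1, case_names minus_one reflection mult]:
  assumes g: "g \<in> carrier OB"
    and m1: "P (- mat 1)"
    and rf: "\<And>v. tits_form v v \<noteq> 0 \<Longrightarrow> P (reflection v)"
    and mult: "\<And>a b. \<lbrakk>a \<in> carrier OB; b \<in> carrier OB; P a; P b\<rbrakk> \<Longrightarrow> P (a ** b)"
  shows "P g"
proof -
  let ?B = tits_form
  define Q where "Q a \<longleftrightarrow> a \<in> carrier OB \<and> P a" for a
  have Qm: "Q (a ** b)" if "Q a" "Q b" for a b using that mult OB_mult by (simp add: Q_def)
  have Qr: "Q (reflection v)" if "?B v v \<noteq> 0" for v using that rf reflection_OB by (simp add: Q_def)
  have Qn: "Q (- mat 1)" using m1 minus_one_OB by (simp add: Q_def)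
  have Q1: "Q (mat 1)" using Qm[OF Qn Qn] by (simp only: minus_one_involution)
  have step: "\<exists>h h'. Q h \<and> Q h' \<and> h ** h' = mat 1 \<and> h' ** h = mat 1 \<and> h *v y = x \<and>
      (\<forall>z. ?B z x = 0 \<longrightarrow> ?B z y = 0 \<longrightarrow> h *v z = z \<or> h *v z = - z)"
    if xy: "?B x x = ?B y y" "?B x x \<noteq> 0" for x y
  proof -
    obtain v c where v: "?B v v \<noteq> 0" "c = 1 \<or> c = (-1::real)" "c *\<^sub>R (reflection v *v y) = x"
        "\<And>z. \<lbrakk>?B z x = 0; ?B z y = 0\<rbrakk> \<Longrightarrow> reflection v *v z = z"
      using move_by_reflection[OF xy] by blast
    show ?thesis
    proof (cases "c = 1")
      case True
      then show ?thesis using v Qr reflection_involution by (intro exI[of _ "reflection v"]) auto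
    next
      case False
      then have "c = -1" using v by simp
      have c: "- mat 1 ** (reflection v ** (- mat 1 ** reflection v)) = (mat 1 :: real^3^3)"
        using reflection_apply_self[OF v(1)] reflection_involution[OF v(1)]
        by (simp add: matrix_eq matrix_vector_mul_assoc[symmetric] minus_one_apply reflection_apply tits_form_algebra v(1))
      show ?thesis
        using v Qm[OF Qn Qr[OF v(1)]] c \<open>c = -1\<close>
        by (intro exI[of _ "- mat 1 ** reflection v"])
          (auto simp: matrix_mul_assoc[symmetric] minus_one_apply simp flip: matrix_vector_mul_assoc)
    qed
  qed
  let ?e1 = "axis 1 1 :: real^3" and ?e3 = "axis 3 1 :: real^3" and ?f = "base_point"
  have B: "?B ?e1 ?e1 = 1" "?B ?e3 ?e3 = 1" "?B ?f ?f = -1" "?B ?e1 ?e3 = 0" "?B ?e3 ?e1 = 0"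
      "?B ?e1 ?f = 0" "?B ?f ?e1 = 0" "?B ?e3 ?f = 0" "?B ?f ?e3 = 0"
    by (simp_all add: tits_form_values base_point_products)
  have ext: "a = b" if "a *v ?e1 = b *v ?e1" "a *v ?e3 = b *v ?e3" "a *v ?f = b *v ?f" for a b :: "real^3^3"
  proof -
    have "a *v x = b *v x" for x
    proof -
      have "a *v x = ?B x ?e1 *\<^sub>R (a *v ?e1) + ?B x ?e3 *\<^sub>R (a *v ?e3) - ?B x ?f *\<^sub>R (a *v ?f)" for a :: "real^3^3"
        using arg_cong[OF orthogonal_expansion[of x], of "\<lambda>x. a *v x"]
        by (simp only: matrix_vector_right_distrib matrix_vector_mult_diff_distrib matrix_vector_mult_scaleR)
      then show ?thesis by (simp only: that)
    qed
    then show ?thesis by (simp add: matrix_eq)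
  qed
  have "?B (g *v ?e1) (g *v ?e1) = 1" using g B OB_isometry by simp
  then obtain h k where h: "Q h" "Q k" "k ** h = mat 1" "h *v (g *v ?e1) = ?e1"
    using step[of ?e1 "g *v ?e1"] B by auto
  define g1 where "g1 = h ** g"
  have g1: "g1 \<in> carrier OB" using h g OB_mult by (simp add: g1_def Q_def)
  have g1e: "g1 *v ?e1 = ?e1" using h by (simp add: g1_def flip: matrix_vector_mul_assoc)
  have "?B (g1 *v ?e3) (g1 *v ?e3) = 1" "?B ?e1 (g1 *v ?e3) = 0"
    using OB_isometry[OF g1, of ?e3 ?e3] OB_isometry[OF g1, of ?e1 ?e3] B g1e by simp_all
  then obtain h2 k2 where h2: "Q h2" "Q k2" "k2 ** h2 = mat 1" "h2 *v (g1 *v ?e3) = ?e3"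
      "h2 *v ?e1 = ?e1 \<or> h2 *v ?e1 = - ?e1"
  proof -
    obtain h2 k2 where "Q h2" "Q k2" "k2 ** h2 = mat 1" "h2 *v (g1 *v ?e3) = ?e3"
        "\<forall>z. ?B z ?e3 = 0 \<longrightarrow> ?B z (g1 *v ?e3) = 0 \<longrightarrow> h2 *v z = z \<or> h2 *v z = - z"
      using step[of ?e3 "g1 *v ?e3"] B \<open>?B (g1 *v ?e3) (g1 *v ?e3) = 1\<close> by auto
    then show thesis using that B(4) \<open>?B ?e1 (g1 *v ?e3) = 0\<close> by blast
  qed
  define g2 where "g2 = h2 ** g1"
  have g2: "g2 \<in> carrier OB" using h2 g1 OB_mult by (simp add: g2_def Q_def)
  have e1: "g2 *v ?e1 = ?e1 \<or> g2 *v ?e1 = - ?e1" and e3: "g2 *v ?e3 = ?e3"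
    using h2 g1e by (simp_all add: g2_def flip: matrix_vector_mul_assoc)
  have f0: "?B (g2 *v ?f) ?e1 = 0" "?B (g2 *v ?f) ?e3 = 0"
    using OB_isometry[OF g2, of ?f ?e1] OB_isometry[OF g2, of ?f ?e3] B e1 e3
    by (auto simp: tits_form_algebra)
  define c where "c = - ?B (g2 *v ?f) ?f"
  have fc: "g2 *v ?f = c *\<^sub>R ?f" using orthogonal_expansion[of "g2 *v ?f"] f0 by (simp add: c_def)
  have "c * c = 1" using OB_isometry[OF g2, of ?f ?f] B by (simp add: fc tits_form_algebra)
  then have c: "c = 1 \<or> c = -1" by (simp add: square_eq_1_iff)
  have r1: "reflection ?e1 *v ?e1 = - ?e1" "reflection ?e1 *v ?e3 = ?e3" "reflection ?e1 *v ?f = ?f"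
     "reflection ?f *v ?e1 = ?e1" "reflection ?f *v ?e3 = ?e3" "reflection ?f *v ?f = - ?f"
    by (simp_all add: reflection_apply B scaleR_2)
  have Q2: "Q g2"
  proof -
    consider "g2 *v ?e1 = ?e1" "c = 1" | "g2 *v ?e1 = ?e1" "c = -1" |
      "g2 *v ?e1 = - ?e1" "c = 1" | "g2 *v ?e1 = - ?e1" "c = -1" using e1 c by blast
    then show ?thesis
    proof cases
      case 1 then have "g2 = mat 1" using e3 fc by (intro ext) auto
      then show ?thesis using Q1 by simp
    next
      case 2 then have "g2 = reflection ?f" using e3 fc r1 by (intro ext) auto
      then show ?thesis using Qr B by simp
    next
      case 3 then have "g2 = reflection ?e1" using e3 fc r1 by (intro ext) auto
      then show ?thesis using Qr B by simp
    next
      case 4 then have "g2 = reflection ?e1 ** reflection ?f" using e3 fc r1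
        by (intro ext) (auto simp flip: matrix_vector_mul_assoc simp: linear_neg)
      then show ?thesis using Qr Qm B by simp
    qed
  qed
  have "k ** (k2 ** g2) = k ** ((k2 ** h2) ** h) ** g" by (simp add: g2_def g1_def matrix_mul_assoc)
  also have "\<dots> = g" using h h2 by simp
  finally have "Q g" using Qm h(2) h2(2) Q2 by metis
  then show ?thesis by (simp add: Q_def)
qed

section \<open>Lebesgue-preserving maps\<close>

text \<open>
  Change of variables for an invertible matrix and arbitrary Borel sets, where both sides may be
  infinite. By the uniqueness of Lebesgue measure it is enough to compare the measures of boxes.
\<close>

lemma emeasure_lborel_matrix_preimage:
  fixes A :: "real^'n::{finite,wellorder}^'n::_"
  assumes A: "det A \<noteq> 0" and S: "S \<in> sets borel"
  shows "ennreal \<bar>det A\<bar> * emeasure lborel {u. A *v u \<in> S} = emeasure lborel S"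
proof -
  define f where "f = (\<lambda>u. A *v u)"
  have fm: "f \<in> borel_measurable borel"
    unfolding f_def by (intro borel_measurable_continuous_onI matrix_vector_mult_linear_continuous_on)
  define M where "M = density (distr lborel borel f) (\<lambda>_. ennreal \<bar>det A\<bar>)"
  have M: "emeasure M S = ennreal \<bar>det A\<bar> * emeasure lborel {u. A *v u \<in> S}" if "S \<in> sets borel" for S
  proof -
    have "emeasure M S = ennreal \<bar>det A\<bar> * emeasure (distr lborel borel f) S"
      using that by (simp add: M_def emeasure_density nn_integral_cmult)
    also have "emeasure (distr lborel borel f) S = emeasure lborel (f -` S)"
      using that fm by (simp add: emeasure_distr)
    finally show ?thesis by (simp add: f_def vimage_def)
  qed
  have "lborel = M"
  proof (rule lborel_eqI)
    show "sets M = sets borel" by (simp add: M_def)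
    fix l u :: "real^'n::_" assume lu: "\<And>b. b \<in> Basis \<Longrightarrow> l \<bullet> b \<le> u \<bullet> b"
    let ?C = "matrix_inv A"
    have inv: "invertible A" using A by (simp add: invertible_det_nz)
    note C = matrix_inv_cancel[OF inv]
    have pre: "{x. A *v x \<in> box l u} = (\<lambda>x. ?C *v x) ` box l u"
    proof (intro equalityI subsetI)
      fix x assume "x \<in> {x. A *v x \<in> box l u}"
      moreover have "x = ?C *v (A *v x)" by (simp add: matrix_vector_mul_assoc C)
      ultimately show "x \<in> (\<lambda>x. ?C *v x) ` box l u" by blast
    qed (auto simp: matrix_vector_mul_assoc C)
    have dC: "\<bar>det A\<bar> * \<bar>det ?C\<bar> = 1"
      using arg_cong[OF C(1), of "\<lambda>X. \<bar>det X\<bar>"] by (simp add: det_mul abs_mult)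
    have lin: "linear (\<lambda>x. ?C *v x)" by simp
    have bx: "box l u \<in> lmeasurable" by simp
    have "measure lebesgue {x. A *v x \<in> box l u} = \<bar>det ?C\<bar> * measure lebesgue (box l u)"
      unfolding pre using measure_linear_image[OF lin bx] by simp
    moreover have "{x. A *v x \<in> box l u} \<in> lmeasurable"
      unfolding pre by (rule measurable_linear_image[OF lin bx])
    moreover have "{x. A *v x \<in> box l u} \<in> sets borel"
      using measurable_sets[OF fm, of "box l u"] by (simp add: f_def vimage_def)
    ultimately have e: "emeasure lborel {x. A *v x \<in> box l u} = ennreal (\<bar>det ?C\<bar> * measure lborel (box l u))"
      using emeasure_eq_measure2[of "{x. A *v x \<in> box l u}" lebesgue] by simp
    have "emeasure M (box l u) = ennreal \<bar>det A\<bar> * emeasure lborel {x. A *v x \<in> box l u}"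
      by (rule M) simp
    also have "\<dots> = ennreal ((\<bar>det A\<bar> * \<bar>det ?C\<bar>) * measure lborel (box l u))"
      unfolding e by (simp add: ennreal_mult' mult.assoc)
    also have "\<dots> = (\<Prod>b\<in>Basis. (u - l) \<bullet> b)" using dC lu by (simp add: measure_lborel_box_eq)
    finally show "emeasure M (box l u) = (\<Prod>b\<in>Basis. (u - l) \<bullet> b)" .
  qed
  then show ?thesis using M[OF S] by metis
qed

definition lborel_preserving :: "('a::euclidean_space \<Rightarrow> 'a) \<Rightarrow> bool" where
  "lborel_preserving f \<longleftrightarrow> f \<in> borel \<rightarrow>\<^sub>M borel \<and>
     (\<forall>S\<in>sets borel. emeasure lborel (f -` S) = emeasure lborel S)"

lemma lborel_preserving_measurable: "lborel_preserving f \<Longrightarrow> f \<in> borel \<rightarrow>\<^sub>M borel"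
  by (simp add: lborel_preserving_def)

lemma lborel_preserving_vimage:
  "\<lbrakk>lborel_preserving f; S \<in> sets borel\<rbrakk> \<Longrightarrow> emeasure lborel (f -` S) = emeasure lborel S"
  by (simp add: lborel_preserving_def)

lemma lborel_preserving_comp:
  assumes "lborel_preserving f" "lborel_preserving g"
  shows "lborel_preserving (\<lambda>x. f (g x))"
proof -
  have "f -` S \<in> sets borel" if "S \<in> sets borel" for S
    using measurable_sets[OF lborel_preserving_measurable[OF assms(1)] that] by simp
  moreover have "(\<lambda>x. f (g x)) -` S = g -` (f -` S)" for S by auto
  ultimately show ?thesis
    using assms measurable_compose[of g borel borel f borel] by (simp add: lborel_preserving_def)
qed

lemma lborel_preserving_matrix:
  fixes A :: "real^'n::{finite,wellorder}^'n::_"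
  assumes A: "\<bar>det A\<bar> = 1"
  shows "lborel_preserving (\<lambda>u. A *v u)"
  unfolding lborel_preserving_def
proof (intro conjI ballI)
  show "(*v) A \<in> borel_measurable borel"
    by (intro borel_measurable_continuous_onI matrix_vector_mult_linear_continuous_on)
  have d: "det A \<noteq> 0" using A by auto
  fix S :: "(real^'n::_) set" assume "S \<in> sets borel"
  then show "emeasure lborel ((*v) A -` S) = emeasure lborel S"
    using emeasure_lborel_matrix_preimage[OF d] A by (simp add: vimage_def)
qed

text \<open>
  The map \<open>u \<mapsto> c - u\<close> rather than a translation, because the row operations needed below are
  \<open>(u, v) \<mapsto> (m v - u, v)\<close>.
\<close>

lemma lborel_preserving_reflect: "lborel_preserving (\<lambda>u. c - (u :: 'a::euclidean_space))"
proof -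
  have "distr lborel borel (\<lambda>u. c - u) = lborel"
  proof -
    have "lborel = density (distr lborel borel (\<lambda>u. c + (-1) *\<^sub>R u)) (\<lambda>_. ennreal (\<bar>-1\<bar> ^ DIM('a)))"
      by (rule lborel_affine) simp
    then show ?thesis by (simp add: density_1)
  qed
  then have "emeasure lborel ((\<lambda>u. c - u) -` S) = emeasure lborel S" if "S \<in> sets borel" for S
    using emeasure_distr[of "\<lambda>u. c - u" lborel borel S] that by simp
  then show ?thesis by (simp add: lborel_preserving_def)
qed

text \<open>
  Fubini: a map that preserves the second coordinate and preserves measure in each fibre preserves
  the product measure. A row operation \<open>(u, v) \<mapsto> (m v - u, v)\<close> is a point reflection in each fibre.
\<close>

lemma lborel_preserving_fiber:
  fixes f :: "'a::euclidean_space \<Rightarrow> 'b::euclidean_space \<Rightarrow> 'a"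
  assumes m: "(\<lambda>(x, y). f x y) \<in> borel \<rightarrow>\<^sub>M borel" and f: "\<And>y. lborel_preserving (\<lambda>x. f x y)"
  shows "lborel_preserving (\<lambda>(x, y). (f x y, y))"
  unfolding lborel_preserving_def
proof (intro conjI ballI)
  let ?F = "\<lambda>(x, y). (f x y, y)"
  have "(\<lambda>p. f (fst p) (snd p)) \<in> borel \<rightarrow>\<^sub>M borel"
    using m by (simp add: case_prod_unfold)
  then show F: "?F \<in> borel \<rightarrow>\<^sub>M borel"
    unfolding case_prod_unfold by (intro borel_measurable_Pair) (auto simp: borel_prod[symmetric])
  fix S :: "('a \<times> 'b) set" assume S: "S \<in> sets borel"
  have S': "S \<in> sets (lborel \<Otimes>\<^sub>M lborel)" by (subst lborel_prod) (simp add: S)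
  have F': "?F -` S \<in> sets (lborel \<Otimes>\<^sub>M lborel)"
    using measurable_sets[OF F S] by (subst lborel_prod) simp
  have "emeasure lborel (?F -` S) = emeasure (lborel \<Otimes>\<^sub>M lborel) (?F -` S)"
    by (simp add: lborel_prod)
  also have "\<dots> = (\<integral>\<^sup>+y. emeasure lborel ((\<lambda>x. (x, y)) -` (?F -` S)) \<partial>lborel)"
    by (rule lborel_pair.emeasure_pair_measure_alt2[OF F'])
  also have "\<dots> = (\<integral>\<^sup>+y. emeasure lborel ((\<lambda>x. (x, y)) -` S) \<partial>lborel)"
  proof (rule nn_integral_cong)
    fix y :: 'b
    have "(\<lambda>x. (x, y)) -` S \<in> sets borel"
      using sets_Pair2[OF S'] by simp
    from lborel_preserving_vimage[OF f this, of y]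
    show "emeasure lborel ((\<lambda>x. (x, y)) -` (?F -` S)) = emeasure lborel ((\<lambda>x. (x, y)) -` S)"
      by (simp add: vimage_def)
  qed
  also have "\<dots> = emeasure (lborel \<Otimes>\<^sub>M lborel) S"
    by (rule lborel_pair.emeasure_pair_measure_alt2[OF S', symmetric])
  finally show "emeasure lborel (?F -` S) = emeasure lborel S" by (simp add: lborel_prod)
qed

lemma lborel_prod_swap:
  fixes S :: "('a::euclidean_space \<times> 'b::euclidean_space) set"
  assumes S: "S \<in> sets borel"
  shows "emeasure lborel (prod.swap -` S) = emeasure lborel S"
proof -
  have m: "(\<lambda>(x, y). (y, x)) \<in> (lborel :: 'b measure) \<Otimes>\<^sub>M (lborel :: 'a measure) \<rightarrow>\<^sub>M lborel \<Otimes>\<^sub>M lborel"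
    by (rule measurable_pair_swap')
  have "emeasure lborel S = emeasure (lborel \<Otimes>\<^sub>M lborel) S" by (simp add: lborel_prod)
  also have "\<dots> = emeasure (distr (lborel \<Otimes>\<^sub>M lborel) (lborel \<Otimes>\<^sub>M lborel) (\<lambda>(x, y). (y, x))) S"
    by (subst lborel_pair.distr_pair_swap) simp
  also have "\<dots> = emeasure (lborel \<Otimes>\<^sub>M lborel) ((\<lambda>(x, y). (y, x)) -` S \<inter> space (lborel \<Otimes>\<^sub>M lborel))"
    by (rule emeasure_distr[OF m]) (subst lborel_prod, simp add: S)
  also have "(\<lambda>(x, y). (y, x)) -` S \<inter> space (lborel \<Otimes>\<^sub>M lborel) = prod.swap -` S"
    by (auto simp: space_pair_measure)
  finally show ?thesis by (simp add: lborel_prod)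
qed

lemma swap_measurable: "prod.swap \<in> borel_measurable (borel :: ('a::euclidean_space \<times> 'b::euclidean_space) measure)"
  by (intro borel_measurable_continuous_onI continuous_on_swap)

lemma lborel_preserving_swap: "lborel_preserving (prod.swap :: 'a::euclidean_space \<times> 'a \<Rightarrow> 'a \<times> 'a)"
  by (simp add: lborel_preserving_def lborel_prod_swap swap_measurable)

lemma lborel_preserving_fst:
  assumes "lborel_preserving f"
  shows "lborel_preserving (\<lambda>(x, y). (f x, y :: 'b::euclidean_space))"
proof (rule lborel_preserving_fiber)
  show "(\<lambda>(x, y). f x) \<in> borel_measurable borel"
    unfolding case_prod_unfold
    by (intro measurable_compose[OF _ lborel_preserving_measurable[OF assms]]
          borel_measurable_continuous_onI continuous_on_fst continuous_on_id)
qed (use assms in simp)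

lemma lborel_preserving_snd:
  fixes f :: "'b::euclidean_space \<Rightarrow> 'b"
  assumes f: "lborel_preserving f"
  shows "lborel_preserving (\<lambda>(x :: 'a::euclidean_space, y). (x, f y))"
  unfolding lborel_preserving_def
proof (intro conjI ballI)
  have 1: "(\<lambda>(x, y). (f x, y :: 'a)) \<in> borel \<rightarrow>\<^sub>M borel"
    by (rule lborel_preserving_measurable[OF lborel_preserving_fst[OF f]])
  have eq: "(\<lambda>(x :: 'a, y). (x, f y)) = (\<lambda>p. prod.swap ((\<lambda>(x, y). (f x, y)) (prod.swap p)))"
    by auto
  show "(\<lambda>(x :: 'a, y). (x, f y)) \<in> borel \<rightarrow>\<^sub>M borel"
    unfolding eq by (intro measurable_compose[OF swap_measurable] measurable_compose[OF 1 swap_measurable])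
  fix S :: "('a \<times> 'b) set" assume S: "S \<in> sets borel"
  have s: "prod.swap -` S \<in> sets borel" using measurable_sets[OF swap_measurable S] by simp
  then have s': "(\<lambda>(x, y). (f x, y)) -` (prod.swap -` S) \<in> sets borel"
    using measurable_sets[OF 1] by fastforce
  have "(\<lambda>(x, y). (x, f y)) -` S = prod.swap -` ((\<lambda>(x, y). (f x, y)) -` (prod.swap -` S))"
    by auto
  then show "emeasure lborel ((\<lambda>(x, y). (x, f y)) -` S) = emeasure lborel S"
    using lborel_prod_swap[OF s'] lborel_preserving_vimage[OF lborel_preserving_fst[OF f] s] lborel_prod_swap[OF S]
    by simp
qed

section \<open>Invariant measure on the orthogonal group\<close>

type_synonym mat2 = "(real^2) \<times> (real^2)"

definition det2 :: "mat2 \<Rightarrow> real" where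
  "det2 w = fst w $ 1 * snd w $ 2 - fst w $ 2 * snd w $ 1"

text \<open>
  The pair \<open>w = (u, v)\<close> of rows stands for a matrix \<open>M\<close>, and the formula is
  \<open>S \<mapsto> M S M\<^sup>T / \<bar>det M\<bar>\<close> in the coordinates \<open>p\<close>, \<open>q\<close>, \<open>r\<close>. The absolute value keeps positive definite
  matrices positive definite.
\<close>

definition congruence :: "mat2 \<Rightarrow> real^3 \<Rightarrow> real^3" where
  "congruence w x = (let a = fst w $ 1; b = fst w $ 2; c = snd w $ 1; d = snd w $ 2;
       p = sP x; q = sQ x; r = sR x in
     of_sym ((a * a * p + 2 * a * b * q + b * b * r) / \<bar>det2 w\<bar>)
            ((a * c * p + (a * d + b * c) * q + b * d * r) / \<bar>det2 w\<bar>)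
            ((c * c * p + 2 * c * d * q + d * d * r) / \<bar>det2 w\<bar>))"

lemma congruence_coords:
  "sP (congruence w x) = (fst w $ 1 * fst w $ 1 * sP x + 2 * fst w $ 1 * fst w $ 2 * sQ x + fst w $ 2 * fst w $ 2 * sR x) / \<bar>det2 w\<bar>"
  "sQ (congruence w x) = (fst w $ 1 * snd w $ 1 * sP x + (fst w $ 1 * snd w $ 2 + fst w $ 2 * snd w $ 1) * sQ x + fst w $ 2 * snd w $ 2 * sR x) / \<bar>det2 w\<bar>"
  "sR (congruence w x) = (snd w $ 1 * snd w $ 1 * sP x + 2 * snd w $ 1 * snd w $ 2 * sQ x + snd w $ 2 * snd w $ 2 * sR x) / \<bar>det2 w\<bar>"
  by (simp_all add: congruence_def Let_def)

definition spin :: "mat2 \<Rightarrow> real^3^3" where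
  "spin w = matrix (congruence w)"

lemma spin_apply: "spin w *v x = congruence w x"
proof -
  have "linear (congruence w)"
    by (rule linearI; rule sym_eqI)
      (simp_all add: congruence_coords add_divide_distrib[symmetric], simp_all add: algebra_simps)
  then show ?thesis unfolding spin_def by (subst matrix_vector_mul(2)) auto
qed

text \<open>
  The determinant of \<open>M S M\<^sup>T\<close> is \<open>(det M)\<^sup>2 det S\<close>, and the same holds after polarisation.
\<close>

lemma spin_OB:
  assumes "det2 w \<noteq> 0"
  shows "spin w \<in> carrier OB"
  unfolding OB_iff spin_apply
proof (intro allI)
  fix x y
  let ?D = "det2 w"
  obtain u v where w: "w = (u, v)" by fastforce
  have "\<bar>?D\<bar> * \<bar>?D\<bar> * tits_form (congruence w x) (congruence w y) = ?D * ?D * tits_form x y"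
    using assms unfolding tits_form_sym congruence_coords
    by (simp add: field_simps) (simp add: w det2_def algebra_simps)
  then show "tits_form (congruence w x) (congruence w y) = tits_form x y"
    using assms by (simp add: abs_mult_self_eq)
qed

text \<open>
  Scalar multiples of \<open>M\<close> act alike. The cutoff \<open>\<bar>det M\<bar> \<le> 1\<close> keeps the measure of bounded sets of
  group elements finite and is invariant under multiplication of \<open>M\<close> by matrices of determinant \<open>\<plusminus>1\<close>. The matrices \<open>M\<close> reach only the half
  of \<open>O(B)\<close> that preserves positive definiteness; the sign of \<open>t\<close> supplies the factor \<open>\<plusminus>1\<close>.
\<close>

definition chart_dom :: "(mat2 \<times> real) set" where
  "chart_dom = {(w, t). det2 w \<noteq> 0 \<and> \<bar>det2 w\<bar> \<le> 1 \<and> t \<noteq> 0 \<and> \<bar>t\<bar> \<le> 1}"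

definition chart :: "mat2 \<times> real \<Rightarrow> real^3^3" where
  "chart = (\<lambda>(w, t). sgn t *\<^sub>R spin w)"

lemma chart_apply: "chart (w, t) *v x = sgn t *\<^sub>R congruence w x"
  by (simp add: chart_def scaleR_matrix_vector_assoc[symmetric] spin_apply)

lemma chart_OB:
  assumes "(w, t) \<in> chart_dom"
  shows "chart (w, t) \<in> carrier OB"
proof -
  have "sgn t * sgn t = 1" using assms by (auto simp: chart_dom_def sgn_if)
  moreover have "tits_form (congruence w x) (congruence w y) = tits_form x y" for x y
    using OB_isometry[OF spin_OB[of w]] assms by (auto simp: spin_apply chart_dom_def)
  ultimately show ?thesis
    unfolding OB_iff chart_apply by (simp add: tits_form_algebra mult.assoc[symmetric])
qed

lemma continuous_det2: "continuous_on S det2"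
  unfolding det2_def by (intro continuous_intros)

lemma continuous_chart: "continuous_on {(w, t). det2 w \<noteq> 0 \<and> t \<noteq> 0} chart"
proof -
  let ?S = "{(w, t). det2 w \<noteq> 0 \<and> (t::real) \<noteq> 0}"
  have d: "continuous_on T (\<lambda>p. det2 (fst p))" for T :: "(mat2 \<times> real) set"
    by (rule continuous_on_compose2[OF continuous_det2[of UNIV]]) (auto intro!: continuous_intros)
  have c: "continuous_on ?S (\<lambda>p. congruence (fst p) x $ i)" for x i
    using exhaust_3[of i] unfolding congruence_def Let_def of_sym_def
    by (elim disjE) (auto simp: vector_3 intro!: continuous_intros d)
  have "continuous_on ?S (\<lambda>p. sgn (snd p) *\<^sub>R spin (fst p))"
    unfolding spin_def matrix_def
    by (intro continuous_intros c continuous_on_sgn) auto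
  then show ?thesis by (simp add: chart_def case_prod_unfold)
qed

lemma chart_dom_borel: "chart_dom \<in> sets borel"
proof -
  have d: "continuous_on UNIV (\<lambda>p::mat2 \<times> real. det2 (fst p))"
    by (rule continuous_on_compose2[OF continuous_det2[of UNIV]]) (auto intro!: continuous_intros)
  have "chart_dom = ({p. det2 (fst p) \<noteq> 0} \<inter> {p. snd p \<noteq> 0}) \<inter> ({p. \<bar>det2 (fst p)\<bar> \<le> 1} \<inter> {p. \<bar>snd p\<bar> \<le> 1})"
    by (auto simp: chart_dom_def)
  also have "\<dots> \<in> sets borel"
    by (intro sets.Int borel_open borel_closed open_Collect_neq closed_Collect_le open_Int closed_Int
        continuous_intros d)
  finally show ?thesis .
qed

lemma chart_measurable: "chart \<in> restrict_space lborel chart_dom \<rightarrow>\<^sub>M borel"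
proof -
  have "chart \<in> restrict_space borel chart_dom \<rightarrow>\<^sub>M borel"
    by (intro borel_measurable_continuous_on_restrict continuous_on_subset[OF continuous_chart])
      (auto simp: chart_dom_def)
  also have "measurable (restrict_space borel chart_dom) borel = measurable (restrict_space lborel chart_dom) (borel :: (real^3^3) measure)"
    by (intro measurable_cong_sets) (auto simp: sets_restrict_space)
  finally show ?thesis .
qed

lemma chart_preimage_borel:
  assumes "E \<in> sets borel"
  shows "chart_dom \<inter> chart -` E \<in> sets borel"
proof -
  have "chart -` E \<inter> chart_dom \<in> sets (restrict_space lborel chart_dom)"
    using measurable_sets[OF chart_measurable assms] by (simp add: space_restrict_space)
  then show ?thesis using chart_dom_borel by (simp add: sets_restrict_space_iff Int_commute)
qed

text \<open>
  A Haar measure on \<open>O(B)\<close>: the cone construction of Haar measure on the matrices of determinant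
  \<open>\<plusminus>1\<close>, transported by the double covering onto half of \<open>O(B)\<close> and extended by the sign.
\<close>

definition haar :: "(real^3^3) measure" where
  "haar = distr (restrict_space lborel chart_dom) borel chart"

lemma sets_haar: "sets haar = sets borel"
  by (simp add: haar_def)

lemma emeasure_haar: "E \<in> sets borel \<Longrightarrow> emeasure haar E = emeasure lborel (chart_dom \<inter> chart -` E)"
proof -
  assume E: "E \<in> sets borel"
  have "emeasure haar E = emeasure (restrict_space lborel chart_dom) (chart -` E \<inter> chart_dom)"
    unfolding haar_def by (subst emeasure_distr[OF chart_measurable E]) (simp add: space_restrict_space)
  then show ?thesis
    using chart_dom_borel by (simp add: emeasure_restrict_space Int_commute)
qed

text \<open>
  A translation \<open>f\<close> of the group preserves the measure as soon as it lifts through the chart to a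
  measure-preserving map \<open>T\<close>.
\<close>

lemma haar_image:
  assumes T: "lborel_preserving T" "\<And>p. T p \<in> chart_dom \<longleftrightarrow> p \<in> chart_dom"
    "\<And>p. p \<in> chart_dom \<Longrightarrow> chart (T p) = f (chart p)"
    and f: "inj f" and E: "E \<in> sets borel" "f ` E \<in> sets borel"
  shows "emeasure haar (f ` E) = emeasure haar E"
proof -
  have "T -` (chart_dom \<inter> chart -` (f ` E)) = chart_dom \<inter> chart -` E"
  proof (rule Set.set_eqI)
    fix p
    show "p \<in> T -` (chart_dom \<inter> chart -` (f ` E)) \<longleftrightarrow> p \<in> chart_dom \<inter> chart -` E"
      using T(2,3)[of p] inj_image_mem_iff[OF f] by (cases "p \<in> chart_dom") simp_all
  qed
  then show ?thesis
    using lborel_preserving_vimage[OF T(1) chart_preimage_borel[OF E(2)]] E by (simp add: emeasure_haar)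
qed

lemma chart_eqI:
  assumes "\<And>x. sgn t' *\<^sub>R congruence w' x = A *v (sgn t *\<^sub>R congruence w (C *v x))"
  shows "chart (w', t') = A ** chart (w, t) ** C"
  using assms by (simp add: matrix_eq chart_apply flip: matrix_vector_mul_assoc)

definition row_reflect :: "real \<Rightarrow> mat2 \<Rightarrow> mat2" where
  "row_reflect m = (\<lambda>(u, v). (m *\<^sub>R v - u, v))"

lemma row_reflect_preserving: "lborel_preserving (row_reflect m)"
  unfolding row_reflect_def
  by (intro lborel_preserving_fiber lborel_preserving_reflect)
    (auto simp: case_prod_unfold intro!: borel_measurable_continuous_onI continuous_intros)

lemma det2_row_reflect: "det2 (row_reflect m w) = - det2 w"
  by (simp add: row_reflect_def det2_def case_prod_unfold algebra_simps)

lemma det2_swap: "det2 (prod.swap w) = - det2 w"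
  by (simp add: det2_def)

lemma reflection_axis_coords:
  "sP (reflection (axis 1 1) *v x) = sP x" "sQ (reflection (axis 1 1) *v x) = - sQ x" "sR (reflection (axis 1 1) *v x) = sR x"
  "sP (reflection (axis 2 1) *v x) = sP x - 4 * sQ x + 4 * sR x" "sQ (reflection (axis 2 1) *v x) = 2 * sR x - sQ x" "sR (reflection (axis 2 1) *v x) = sR x"
  "sP (reflection (axis 3 1) *v x) = sR x" "sQ (reflection (axis 3 1) *v x) = sQ x" "sR (reflection (axis 3 1) *v x) = sP x"
  by (simp_all add: reflection_axis tits_form_sym field_simps)

lemma row_reflect_coords [simp]:
  "fst (row_reflect m w) = m *\<^sub>R snd w - fst w" "snd (row_reflect m w) = snd w"
  by (simp_all add: row_reflect_def case_prod_unfold)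

text \<open>
  Left multiplication by the generators lifts to row operations: \<open>(u, v) \<mapsto> (- u, v)\<close>,
  \<open>(u, v) \<mapsto> (2 v - u, v)\<close> and \<open>(u, v) \<mapsto> (v, u)\<close>.
\<close>

lemma congruence_generators:
  "congruence (row_reflect 0 w) x = reflection (axis 1 1) *v congruence w x"
  "congruence (row_reflect 2 w) x = reflection (axis 2 1) *v congruence w x"
  "congruence (prod.swap w) x = reflection (axis 3 1) *v congruence w x"
  by (rule sym_eqI; simp add: congruence_coords reflection_axis_coords det2_row_reflect det2_swap
        add_divide_distrib diff_divide_distrib algebra_simps)+

lemma haar_left_generator:
  assumes E: "E \<in> sets borel" "(\<lambda>A. reflection (axis i 1) ** A) ` E \<in> sets borel"
  shows "emeasure haar ((\<lambda>A. reflection (axis i 1) ** A) ` E) = emeasure haar E"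
proof -
  let ?r = "reflection (axis i 1)"
  have i: "i = 1 \<or> i = 2 \<or> i = 3" using exhaust_3[of i] by auto
  have "inj (\<lambda>A. ?r ** A)"
  proof (rule injI)
    fix A C assume "?r ** A = ?r ** C"
    then have "?r ** ?r ** A = ?r ** ?r ** C" by (simp flip: matrix_mul_assoc)
    then show "A = C" by (simp add: reflection_involution tits_form_values)
  qed
  moreover obtain L where L: "lborel_preserving L" "\<And>w. det2 (L w) = - det2 w"
      "\<And>w x. congruence (L w) x = ?r *v congruence w x"
  proof -
    note lems = row_reflect_preserving lborel_preserving_swap det2_row_reflect det2_swap congruence_generators
    from i show thesis
    proof (elim disjE)
      assume "i = 1" then show thesis by (intro that[of "row_reflect 0"]) (simp_all add: lems)
    next
      assume "i = 2" then show thesis by (intro that[of "row_reflect 2"]) (simp_all add: lems)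
    next
      assume "i = 3" then show thesis by (intro that[of prod.swap]) (simp_all only: lems)
    qed
  qed
  moreover have "chart ((\<lambda>(w, t). (L w, t)) p) = ?r ** chart p" for p
    using chart_eqI[of "snd p" "L (fst p)" ?r "snd p" "fst p" "mat 1"] L(3)
    by (simp add: case_prod_unfold matrix_vector_mult_scaleR)
  ultimately show ?thesis
    by (intro haar_image[OF lborel_preserving_fst[OF L(1)] _ _ _ E]) (auto simp: chart_dom_def)
qed

lemma haar_right_minus_one:
  assumes E: "E \<in> sets borel" "(\<lambda>A. A ** (- mat 1)) ` E \<in> sets borel"
  shows "emeasure haar ((\<lambda>A. A ** (- mat 1)) ` E) = emeasure haar E"
proof -
  let ?T = "\<lambda>(w :: mat2, t :: real). (w, 0 - t)"
  have inj: "inj (\<lambda>A :: real^3^3. A ** (- mat 1))"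
  proof (rule injI)
    fix A C :: "real^3^3" assume *: "A ** (- mat 1) = C ** (- mat 1)"
    have "A *v x = C *v x" for x
      using arg_cong[OF *, of "\<lambda>Z. Z *v (- x)"] by (simp add: minus_one_apply flip: matrix_vector_mul_assoc)
    then show "A = C" by (simp add: matrix_eq)
  qed
  have ct: "chart (?T p) = chart p ** (- mat 1)" for p
    using chart_eqI[of "- snd p" "fst p" "mat 1" "snd p" "fst p" "- mat 1"]
    by (simp add: case_prod_unfold minus_one_apply sgn_minus linear_neg[OF matrix_vector_mul_linear] flip: spin_apply)
  show ?thesis
    by (rule haar_image[OF lborel_preserving_snd[OF lborel_preserving_reflect] _ ct inj E])
      (auto simp: chart_dom_def)
qed

text \<open>
  If \<open>V\<close> is a symmetric matrix with \<open>\<bar>det V\<bar> = 1\<close>, its reflection is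
  \<open>S \<mapsto> - V adj(S) V / det V\<close>, and \<open>adj(S) = J S J\<^sup>T\<close> for the rotation \<open>J\<close> by a right angle. Up to
  sign it is therefore the action of \<open>V J\<close>, which is multiplied to \<open>M\<close> from the right. The matrix \<open>N\<close>
  below is the transpose of \<open>V J\<close>, acting on the rows of \<open>M\<close>, and \<open>\<epsilon> = - det V\<close> is the sign.
\<close>

lemma haar_right_reflection:
  assumes V: "tits_form V V \<noteq> 0" and E: "E \<in> sets borel" "(\<lambda>A. A ** reflection V) ` E \<in> sets borel"
  shows "emeasure haar ((\<lambda>A. A ** reflection V) ` E) = emeasure haar E"
proof -
  \<comment> \<open>Reflections do not depend on the length of \<open>V\<close>; the determinant of the lift does.\<close>
  define V' where "V' = (1 / sqrt \<bar>tits_form V V\<bar>) *\<^sub>R V"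
  define \<epsilon> where "\<epsilon> = tits_form V' V'"
  have "\<epsilon> = tits_form V V / \<bar>tits_form V V\<bar>"
    by (simp add: \<epsilon>_def V'_def tits_form_algebra)
  then have \<epsilon>: "\<epsilon> = 1 \<or> \<epsilon> = -1" using V by (auto simp: abs_if split: if_splits)
  have rV: "reflection V' = reflection V"
  proof -
    have "2 * tits_form x V' / tits_form V' V' * (1 / sqrt \<bar>tits_form V V\<bar>) = 2 * tits_form x V / tits_form V V" for x
      using V by (simp add: V'_def tits_form_algebra field_simps)
    then show ?thesis unfolding matrix_eq reflection_apply by (simp add: V'_def)
  qed
  have V': "tits_form V' V' \<noteq> 0" using \<epsilon> by (auto simp: \<epsilon>_def)
  define p q r where "p = sP V'" "q = sQ V'" "r = sR V'"
  have \<epsilon>pqr: "\<epsilon> = q * q - p * r" by (simp add: \<epsilon>_def p_q_r_def tits_form_sym)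
  define N :: "real^2^2" where "N = vector [vector [- q, - r], vector [p, q]]"
  have N: "(N *v u) $ 1 = - q * u $ 1 - r * u $ 2" "(N *v u) $ 2 = p * u $ 1 + q * u $ 2" for u
    by (simp_all add: N_def matrix_vector_mult_def sum_2)
  have "det N = - \<epsilon>" by (simp add: N_def det_2 \<epsilon>pqr)
  then have "\<bar>det N\<bar> = 1" using \<epsilon> by auto
  then have pN: "lborel_preserving (\<lambda>u. N *v u)" by (rule lborel_preserving_matrix)
  have p\<epsilon>: "lborel_preserving (\<lambda>t. \<epsilon> * t)"
    using \<epsilon> lborel_preserving_reflect[of "0::real"] by (auto simp: lborel_preserving_def vimage_def)
  define L :: "mat2 \<Rightarrow> mat2" where "L = (\<lambda>(u, v). (N *v u, N *v v))"
  have L: "lborel_preserving L"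
    using lborel_preserving_comp[OF lborel_preserving_fst[OF pN] lborel_preserving_snd[OF pN]]
    by (simp add: L_def case_prod_unfold)
  have dL: "det2 (L w) = - \<epsilon> * det2 w" for w
    by (simp add: L_def det2_def case_prod_unfold N \<epsilon>pqr algebra_simps)
  then have adL: "\<bar>det2 (L w)\<bar> = \<bar>det2 w\<bar>" for w using \<epsilon> by (auto simp: abs_mult)
  have ref: "\<epsilon> * sP (reflection V' *v x) = \<epsilon> * sP x - 2 * tits_form x V' * p"
     "\<epsilon> * sQ (reflection V' *v x) = \<epsilon> * sQ x - 2 * tits_form x V' * q"
     "\<epsilon> * sR (reflection V' *v x) = \<epsilon> * sR x - 2 * tits_form x V' * r" for x
    using V' by (simp_all add: reflection_apply p_q_r_def \<epsilon>_def right_diff_distrib)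
  have cL: "congruence (L w) x = \<epsilon> *\<^sub>R congruence w (reflection V' *v x)" for w x
  proof -
    have *: "\<epsilon> *\<^sub>R congruence w y = congruence w (\<epsilon> *\<^sub>R y)" for y
      by (simp add: matrix_vector_mult_scaleR flip: spin_apply)
    have c: "sP (\<epsilon> *\<^sub>R (reflection V' *v x)) = (q * q - p * r) * sP x - 2 * (sQ x * q - (sP x * r + sR x * p) / 2) * p"
     "sQ (\<epsilon> *\<^sub>R (reflection V' *v x)) = (q * q - p * r) * sQ x - 2 * (sQ x * q - (sP x * r + sR x * p) / 2) * q"
     "sR (\<epsilon> *\<^sub>R (reflection V' *v x)) = (q * q - p * r) * sR x - 2 * (sQ x * q - (sP x * r + sR x * p) / 2) * r"
      by (simp_all add: ref, simp_all add: \<epsilon>pqr tits_form_sym p_q_r_def)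
    have Lc: "fst (L w) $ 1 = - q * fst w $ 1 - r * fst w $ 2" "fst (L w) $ 2 = p * fst w $ 1 + q * fst w $ 2"
        "snd (L w) $ 1 = - q * snd w $ 1 - r * snd w $ 2" "snd (L w) $ 2 = p * snd w $ 1 + q * snd w $ 2"
      by (simp_all add: L_def case_prod_unfold N)
    show ?thesis
      unfolding *
    proof (rule sym_eqI)
      show "sP (congruence (L w) x) = sP (congruence w (\<epsilon> *\<^sub>R (reflection V' *v x)))"
        unfolding congruence_coords c adL Lc
        by (rule arg_cong2[where f = "(/)"]) (simp_all add: field_simps)
      show "sQ (congruence (L w) x) = sQ (congruence w (\<epsilon> *\<^sub>R (reflection V' *v x)))"
        unfolding congruence_coords c adL Lc
        by (rule arg_cong2[where f = "(/)"]) (simp_all add: field_simps)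
      show "sR (congruence (L w) x) = sR (congruence w (\<epsilon> *\<^sub>R (reflection V' *v x)))"
        unfolding congruence_coords c adL Lc
        by (rule arg_cong2[where f = "(/)"]) (simp_all add: field_simps)
    qed
  qed
  have inj: "inj (\<lambda>A. A ** reflection V)"
  proof (rule injI)
    fix A C assume "A ** reflection V = C ** reflection V"
    then have "A ** (reflection V ** reflection V) = C ** (reflection V ** reflection V)"
      by (simp add: matrix_mul_assoc)
    then show "A = C" by (simp add: reflection_involution V)
  qed
  let ?T = "\<lambda>(w, t). (L w, \<epsilon> * t)"
  have T: "lborel_preserving ?T"
    using lborel_preserving_comp[OF lborel_preserving_fst[OF L] lborel_preserving_snd[OF p\<epsilon>]]
    by (simp add: case_prod_unfold)
  have sg: "sgn (\<epsilon> * t) = \<epsilon> * sgn t" for t using \<epsilon> by (auto simp: sgn_minus)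
  have ee: "\<epsilon> * \<epsilon> = 1" using \<epsilon> by auto
  have ct: "chart (?T p) = chart p ** reflection V" for p
    using chart_eqI[of "\<epsilon> * snd p" "L (fst p)" "mat 1" "snd p" "fst p" "reflection V"] ee
    by (simp add: case_prod_unfold sg cL rV mult.commute mult.left_commute)
  show ?thesis
    using \<epsilon> adL dL by (intro haar_image[OF T _ ct inj E]) (auto simp: chart_dom_def)
qed

section \<open>Finite volume of a Siegel set\<close>

text \<open>
  With \<open>z = M \<cdot> i\<close> in the upper half-plane the conditions say \<open>\<bar>z\<bar> \<ge> 1\<close> and \<open>0 \<le> Re z \<le> 1/2\<close>, the
  triangle of the extended modular group. Unlike the triangle of the Coxeter group it has a single
  cusp, which is why the second row of \<open>M\<close> is bounded on it.
\<close>

definition siegel :: "mat2 set" where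
  "siegel = {w. det2 w \<noteq> 0 \<and> \<bar>det2 w\<bar> \<le> 1 \<and> snd w \<bullet> snd w \<le> fst w \<bullet> fst w \<and>
     0 \<le> fst w \<bullet> snd w \<and> 2 * (fst w \<bullet> snd w) \<le> snd w \<bullet> snd w}"

lemma siegel_borel: "siegel \<in> sets borel"
proof -
  have "siegel = {w. det2 w \<noteq> 0} \<inter> ({w. \<bar>det2 w\<bar> \<le> 1} \<inter> ({w. snd w \<bullet> snd w \<le> fst w \<bullet> fst w} \<inter>
      ({w. 0 \<le> fst w \<bullet> snd w} \<inter> {w. 2 * (fst w \<bullet> snd w) \<le> snd w \<bullet> snd w})))"
    by (auto simp: siegel_def)
  also have "\<dots> \<in> sets borel"
    by (intro sets.Int borel_open borel_closed open_Collect_neq closed_Collect_le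
        continuous_intros continuous_det2)
  finally show ?thesis .
qed

lemma inner_real2: "(u :: real^2) \<bullet> v = u $ 1 * v $ 1 + u $ 2 * v $ 2"
  by (simp add: inner_vec_def sum_2)

lemma det2_squared: "(det2 (u, v))\<^sup>2 = (u \<bullet> u) * (v \<bullet> v) - (u \<bullet> v)\<^sup>2"
  by (simp add: det2_def inner_real2 power2_eq_square algebra_simps)

text \<open>
  By \<open>det(u, v)\<^sup>2 = \<bar>u\<bar>\<^sup>2 \<bar>v\<bar>\<^sup>2 - (u \<bullet> v)\<^sup>2\<close>, the conditions \<open>2 (u \<bullet> v) \<le> \<bar>v\<bar>\<^sup>2 \<le> \<bar>u\<bar>\<^sup>2\<close> and
  \<open>\<bar>det(u, v)\<bar> \<le> 1\<close> give \<open>3 \<bar>v\<bar>\<^sup>4 \<le> 4\<close>. For fixed \<open>v\<close> the linear map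
  \<open>u \<mapsto> (u \<bullet> v, det(u, v))\<close> has determinant \<open>- \<bar>v\<bar>\<^sup>2\<close> and carries the slice into the box
  \<open>[0, \<bar>v\<bar>\<^sup>2] \<times> [-1, 1]\<close>, so the slice has area at most \<open>2\<close>.
\<close>

lemma siegel_slice: "emeasure lborel ((\<lambda>u. (u, v)) -` siegel) \<le> 2 * indicator (cball 0 2) v"
proof (cases "(\<lambda>u. (u, v)) -` siegel = {}")
  case False
  then obtain u where u: "(u, v) \<in> siegel" by auto
  have v0: "v \<noteq> 0" using u by (auto simp: siegel_def det2_def)
  let ?s = "v \<bullet> v"
  have s: "?s > 0" using v0 by simp
  have "(2 * (u \<bullet> v))\<^sup>2 \<le> ?s\<^sup>2" using u by (intro power_mono) (auto simp: siegel_def)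
  moreover have "?s * ?s \<le> (u \<bullet> u) * ?s" using u s by (simp add: siegel_def)
  moreover have "(det2 (u, v))\<^sup>2 \<le> 1" using u by (simp add: siegel_def abs_square_le_1)
  ultimately have "3 * (?s * ?s) \<le> 4" unfolding det2_squared by (simp add: power2_eq_square)
  then have "?s \<le> 4"
    using mult_mono[of 4 ?s 4 ?s] by (cases "?s \<le> 4") auto
  then have "norm v \<le> 2" by (simp add: norm_eq_sqrt_inner real_le_lsqrt)
  then have vi: "v \<in> cball 0 2" by simp
  define A :: "real^2^2" where "A = vector [vector [v $ 1, v $ 2], vector [v $ 2, - v $ 1]]"
  have A: "(A *v x) $ 1 = x \<bullet> v" "(A *v x) $ 2 = det2 (x, v)" for x
    by (simp_all add: A_def matrix_vector_mult_def sum_2 inner_real2 det2_def mult.commute)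
  have dA: "det A = - ?s" by (simp add: A_def det_2 inner_real2)
  define l h :: "real^2" where "l = vector [0, -1]" and "h = vector [?s, 1]"
  have lh: "l $ 1 = 0" "l $ 2 = -1" "h $ 1 = ?s" "h $ 2 = 1" by (simp_all add: l_def h_def)
  have sub: "(\<lambda>u. (u, v)) -` siegel \<subseteq> {x. A *v x \<in> cbox l h}"
    using s by (auto simp: siegel_def mem_box_cart forall_2 A lh abs_le_iff)
  have "measure lborel (cbox l h) = 2 * ?s"
  proof -
    have "cbox l h \<noteq> {}" using s by (simp add: interval_ne_empty_cart forall_2 lh)
    then show ?thesis by (simp add: content_cbox_cart UNIV_2 lh)
  qed
  then have "emeasure lborel (cbox l h) = ennreal (2 * ?s)"
    by (metis emeasure_eq_ennreal_measure emeasure_lborel_cbox_finite infinity_ennreal_def less_irrefl)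
  then have e: "ennreal ?s * emeasure lborel {x. A *v x \<in> cbox l h} = ennreal ?s * 2"
    using emeasure_lborel_matrix_preimage[of A "cbox l h"] dA s by (simp add: ennreal_mult mult.commute)
  have "emeasure lborel {x. A *v x \<in> cbox l h} = 2"
    using e s ennreal_mult_cancel_left[of "ennreal ?s"] by simp
  moreover have "{x. A *v x \<in> cbox l h} \<in> sets lborel"
  proof -
    have "(\<lambda>x. A *v x) \<in> borel_measurable borel"
      by (intro borel_measurable_continuous_onI matrix_vector_mult_linear_continuous_on)
    from measurable_sets[OF this, of "cbox l h"] show ?thesis by (simp add: vimage_def)
  qed
  ultimately have "emeasure lborel ((\<lambda>u. (u, v)) -` siegel) \<le> 2"
    using emeasure_mono[OF sub, of lborel] by simp
  then show ?thesis using vi by simp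
qed simp

lemma siegel_finite: "emeasure lborel siegel < \<infinity>"
proof -
  have S: "siegel \<in> sets (lborel \<Otimes>\<^sub>M lborel)" by (subst lborel_prod) (simp add: siegel_borel)
  have "emeasure lborel siegel = emeasure (lborel \<Otimes>\<^sub>M lborel) siegel" by (simp add: lborel_prod)
  also have "\<dots> = (\<integral>\<^sup>+v. emeasure lborel ((\<lambda>u. (u, v)) -` siegel) \<partial>lborel)"
    by (rule lborel_pair.emeasure_pair_measure_alt2[OF S])
  also have "\<dots> \<le> (\<integral>\<^sup>+v. 2 * indicator (cball 0 2) (v :: real^2) \<partial>lborel)"
    by (intro nn_integral_mono siegel_slice)
  also have "\<dots> = 2 * emeasure lborel (cball 0 2 :: (real^2) set)"
    by (subst nn_integral_cmult) (auto intro!: borel_measurable_indicator)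
  also have "\<dots> < \<infinity>"
    using emeasure_bounded_finite[of "cball 0 2 :: (real^2) set"] by (simp add: ennreal_mult_less_top)
  finally show ?thesis .
qed

definition chamber :: "(real^3) set" where
  "chamber = {x. sR x \<le> sP x \<and> 0 \<le> sQ x \<and> sQ x \<le> sR x}"

text \<open>
  Both signs are needed, since \<open>O(B)\<close> also contains elements that exchange positive and negative
  definite matrices, while the Coxeter group does not.
\<close>

definition chamber_frames :: "(real^3^3) set" where
  "chamber_frames = {g \<in> carrier OB. g *v base_point \<in> chamber \<or> - (g *v base_point) \<in> chamber}"

lemma chamber_frames_borel: "chamber_frames \<in> sets borel"
proof -
  have "chamber_frames = carrier OB \<inter> (
     ({A. sR (A *v base_point) \<le> sP (A *v base_point)} \<inter> {A. 0 \<le> sQ (A *v base_point)} \<inter> {A. sQ (A *v base_point) \<le> sR (A *v base_point)}) \<union>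
     ({A. sP (A *v base_point) \<le> sR (A *v base_point)} \<inter> {A. sQ (A *v base_point) \<le> 0} \<inter> {A. sR (A *v base_point) \<le> sQ (A *v base_point)}))"
    by (auto simp: chamber_frames_def chamber_def)
  also have "\<dots> \<in> sets borel"
    by (intro borel_closed closed_Int closed_Un closed_OB closed_Collect_le continuous_on_const continuous_sym_coords)
  finally show ?thesis .
qed

lemma congruence_base:
  "sP (congruence (u, v) base_point) = (u \<bullet> u) / \<bar>det2 (u, v)\<bar>"
  "sQ (congruence (u, v) base_point) = (u \<bullet> v) / \<bar>det2 (u, v)\<bar>"
  "sR (congruence (u, v) base_point) = (v \<bullet> v) / \<bar>det2 (u, v)\<bar>"
  by (simp_all add: congruence_coords base_point_def inner_real2)

text \<open>
  The triangle \<open>p \<ge> r \<ge> q \<ge> 0\<close> with angles \<open>(\<pi>/2, 0, 0)\<close> is the union of three triangles with angles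
  \<open>(\<pi>/2, \<pi>/3, 0)\<close>. If \<open>2 q \<le> r\<close>, the point is in the first; otherwise the reflection in the line
  \<open>2 q = r\<close>, followed by an exchange of \<open>p\<close> and \<open>r\<close> if necessary, brings it there.
\<close>

lemma chamber_frames_preimage:
  "chart_dom \<inter> chart -` chamber_frames \<subseteq>
    (siegel \<union> row_reflect 1 -` siegel \<union> (\<lambda>w. prod.swap (row_reflect 1 w)) -` siegel) \<times> {-1..1}"
proof
  fix p assume p: "p \<in> chart_dom \<inter> chart -` chamber_frames"
  obtain u v t where [simp]: "p = ((u, v), t)" by (metis prod.collapse)
  let ?D = "\<bar>det2 (u, v)\<bar>" and ?y = "congruence (u, v) base_point"
  have d: "0 < ?D" "?D \<le> 1" "t \<noteq> 0" "\<bar>t\<bar> \<le> 1" using p by (auto simp: chart_dom_def)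
  have "sgn t *\<^sub>R ?y \<in> chamber \<or> - (sgn t *\<^sub>R ?y) \<in> chamber"
    using p by (auto simp: chamber_frames_def chart_apply)
  then have "?y \<in> chamber \<or> - ?y \<in> chamber"
    using d by (auto simp: sgn_if split: if_splits)
  moreover have "- ?y \<notin> chamber"
  proof
    assume "- ?y \<in> chamber"
    then have "sR ?y \<le> 0" "sP ?y \<le> 0" by (auto simp: chamber_def)
    then have "v \<bullet> v \<le> 0" "u \<bullet> u \<le> 0"
      using d by (simp_all add: congruence_base divide_le_0_iff)
    then have "v = 0" by (metis inner_eq_zero_iff inner_ge_zero order_antisym)
    then show False using d by (simp add: det2_def)
  qed
  ultimately have y: "v \<bullet> v \<le> u \<bullet> u" "0 \<le> u \<bullet> v" "u \<bullet> v \<le> v \<bullet> v"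
    using d by (auto simp: chamber_def congruence_base divide_right_mono_neg divide_le_cancel zero_le_divide_iff)
  have "(u, v) \<in> siegel \<or> row_reflect 1 (u, v) \<in> siegel \<or> prod.swap (row_reflect 1 (u, v)) \<in> siegel"
    using y d unfolding siegel_def
    by (auto simp: det2_row_reflect det2_swap inner_diff_left inner_diff_right inner_commute)
  then show "p \<in> (siegel \<union> row_reflect 1 -` siegel \<union> (\<lambda>w. prod.swap (row_reflect 1 w)) -` siegel) \<times> {-1..1}"
    using d by auto
qed

lemma haar_chamber_frames_finite: "emeasure haar chamber_frames < \<infinity>"
proof -
  let ?Z2 = "row_reflect 1 -` siegel" and ?Z3 = "(\<lambda>w. prod.swap (row_reflect 1 w)) -` siegel"
  note p2 = row_reflect_preserving[of 1]
  note p3 = lborel_preserving_comp[OF lborel_preserving_swap p2]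
  have b: "?Z2 \<in> sets borel" "?Z3 \<in> sets borel"
    using measurable_sets[OF lborel_preserving_measurable[OF p2] siegel_borel]
      measurable_sets[OF lborel_preserving_measurable[OF p3] siegel_borel] by simp_all
  let ?Z = "siegel \<union> ?Z2 \<union> ?Z3"
  have Z: "?Z \<in> sets borel" using b siegel_borel by simp
  have "emeasure lborel ?Z \<le> emeasure lborel (siegel \<union> ?Z2) + emeasure lborel ?Z3"
    using b siegel_borel by (intro emeasure_subadditive) auto
  also have "\<dots> \<le> (emeasure lborel siegel + emeasure lborel ?Z2) + emeasure lborel ?Z3"
    using b siegel_borel by (intro add_right_mono emeasure_subadditive) auto
  also have "\<dots> < \<infinity>"
    using siegel_finite lborel_preserving_vimage[OF p2 siegel_borel] lborel_preserving_vimage[OF p3 siegel_borel]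
    by simp
  finally have fin: "emeasure lborel ?Z < \<infinity>" .
  have "emeasure haar chamber_frames = emeasure lborel (chart_dom \<inter> chart -` chamber_frames)"
    by (rule emeasure_haar[OF chamber_frames_borel])
  also have "\<dots> \<le> emeasure lborel (?Z \<times> {-1..1::real})"
  proof (rule emeasure_mono[OF chamber_frames_preimage])
    show "?Z \<times> {-1..1::real} \<in> sets lborel" using Z by (simp add: borel_prod[symmetric])
  qed
  also have "\<dots> = emeasure (lborel \<Otimes>\<^sub>M lborel) (?Z \<times> {-1..1::real})" by (simp add: lborel_prod)
  also have "\<dots> = emeasure lborel ?Z * emeasure lborel {-1..1::real}"
    using Z by (intro lborel.emeasure_pair_measure_Times) auto
  also have "\<dots> < \<infinity>" using fin by (simp add: ennreal_mult_less_top)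
  finally show ?thesis .
qed

text \<open>
  The chart domain contains a nonempty open set.
\<close>

lemma haar_OB_nonzero: "emeasure haar (carrier OB) \<noteq> 0"
proof -
  have "chart p \<in> carrier OB" if "p \<in> chart_dom" for p
    using that chart_OB[of "fst p" "snd p"] by simp
  then have "chart_dom \<inter> chart -` carrier OB = chart_dom" by blast
  then have e: "emeasure haar (carrier OB) = emeasure lborel chart_dom"
    using emeasure_haar[OF borel_closed[OF closed_OB]] by (simp only:)
  let ?U = "{p :: mat2 \<times> real. det2 (fst p) \<noteq> 0} \<inter> {p. snd p \<noteq> 0} \<inter> {p. \<bar>det2 (fst p)\<bar> < 1} \<inter> {p. \<bar>snd p\<bar> < 1}"
  have d: "continuous_on UNIV (\<lambda>p::mat2 \<times> real. det2 (fst p))"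
    by (rule continuous_on_compose2[OF continuous_det2[of UNIV]]) (auto intro!: continuous_intros)
  have U: "open ?U"
    by (intro open_Int open_Collect_neq open_Collect_less continuous_intros d)
  have "(((1/2) *\<^sub>R axis 1 1, axis 2 1), 1/2) \<in> ?U"
    by (simp add: det2_def axis_def)
  then have "\<not> negligible ?U" using open_not_negligible[OF U] by blast
  then have "emeasure lborel ?U \<noteq> 0"
    using borel_open[OF U] by (auto simp: negligible_iff_null_sets null_sets_def)
  moreover have "?U \<subseteq> chart_dom" by (auto simp: chart_dom_def)
  ultimately show ?thesis
    unfolding e using emeasure_mono[of ?U chart_dom lborel] chart_dom_borel by fastforce
qed

section \<open>Words in the generators and the fundamental chamber\<close>

text \<open>
  Formal inverses are sent to the same matrices as the generators, which are involutions.
\<close>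

fun word_mat :: "3 word \<Rightarrow> real^3^3" where
  "word_mat [] = mat 1"
| "word_mat ((s, b) # w) = reflection (axis s 1) ** word_mat w"

lemma word_mat_append: "word_mat (u @ v) = word_mat u ** word_mat v"
  by (induction u rule: word_mat.induct) (simp_all add: matrix_mul_assoc)

lemma reflection_axis_involution: "reflection (axis s 1) ** reflection (axis s 1) = mat 1"
  by (simp add: reflection_involution tits_form_values)

lemma word_mat_rev: "word_mat (rev w) ** word_mat w = mat 1" "word_mat w ** word_mat (rev w) = mat 1"
proof -
  have *: "word_mat (rev w) ** word_mat w = mat 1" for w
  proof (induction w rule: word_mat.induct)
    case (2 s b w)
    have "word_mat (rev ((s, b) # w)) ** word_mat ((s, b) # w) =
        word_mat (rev w) ** (reflection (axis s 1) ** reflection (axis s 1)) ** word_mat w"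
      by (simp add: word_mat_append matrix_mul_assoc)
    then show ?case using 2 by (simp add: reflection_axis_involution)
  qed simp
  from *[of w] *[of "rev w"] show "word_mat (rev w) ** word_mat w = mat 1" "word_mat w ** word_mat (rev w) = mat 1"
    by simp_all
qed

lemma mat_1_OB: "mat 1 \<in> carrier OB"
  by (simp add: OB_iff)

lemma word_mat_OB: "word_mat w \<in> carrier OB"
proof (induction w rule: word_mat.induct)
  case (2 s b w)
  then show ?case by (simp add: OB_mult reflection_OB tits_form_values)
qed (simp add: mat_1_OB)

lemma word_mat_integral: "word_mat w $ i $ j \<in> \<int>"
proof (induction w arbitrary: i j rule: word_mat.induct)
  case 1
  show ?case by (simp add: mat_def)
next
  case (2 s b w)
  have "reflection (axis s 1) $ k $ l \<in> \<int>" for k l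
  proof -
    have "reflection (axis s 1) $ k $ l = (reflection (axis s 1) *v axis l 1) $ k"
      by (simp add: matrix_vector_mult_basis column_def)
    also have "\<dots> = axis l 1 $ k - 2 * tits_gram $ l $ s * axis s 1 $ k"
      by (simp add: reflection_axis tits_form_axis)
    also have "\<dots> \<in> \<int>"
    proof -
      have "tits_gram $ l $ s \<in> \<int>"
        using exhaust_3[of l] exhaust_3[of s] by (auto simp: tits_gram_def vector_3)
      moreover have "axis n 1 $ k \<in> (\<int> :: real set)" for n by (simp add: axis_def)
      ultimately show ?thesis by (intro Ints_diff Ints_mult) auto
    qed
    finally show ?thesis .
  qed
  then show ?case using 2 by (auto simp: matrix_matrix_mult_def intro!: Ints_sum Ints_mult)
qed

text \<open>
  Distinct integral matrices have distance at least \<open>1\<close>.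
\<close>

lemma word_mat_discrete: "discrete (range word_mat)"
proof (rule discreteI)
  fix A assume A: "A \<in> range word_mat"
  have "ball A 1 \<inter> range word_mat = {A}"
  proof (intro equalityI subsetI)
    fix C assume C: "C \<in> ball A 1 \<inter> range word_mat"
    have "C $ i $ j = A $ i $ j" for i j
    proof -
      have "\<bar>C $ i $ j - A $ i $ j\<bar> \<le> norm (C - A)"
        using order_trans[OF component_le_norm_cart[of "(C - A) $ i" j] Finite_Cartesian_Product.norm_nth_le[of "C - A" i]] by simp
      also have "\<dots> < 1" using C by (simp add: dist_norm norm_minus_commute)
      finally have "\<bar>C $ i $ j - A $ i $ j\<bar> < 1" .
      moreover have "C $ i $ j - A $ i $ j \<in> \<int>" using A C word_mat_integral by (auto intro: Ints_diff)
      ultimately show ?thesis using Ints_nonzero_abs_less1 by force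
    qed
    then show "C \<in> {A}" by (simp add: vec_eq_iff)
  qed (use A in auto)
  then show "A isolated_in range word_mat"
    using A by (auto simp: isolated_in_def intro!: exI[of _ "ball A 1"])
qed

lemma word_mat_subgroup: "subgroup (range word_mat) OB"
proof
  fix x assume "x \<in> range word_mat"
  then obtain w where w: "x = word_mat w" by auto
  have "inv\<^bsub>OB\<^esub> x = word_mat (rev w)"
    using group.inv_equality[OF group_orth_group, of tits_form "word_mat (rev w)" x] word_mat_OB word_mat_rev w by simp
  then show "inv\<^bsub>OB\<^esub> x \<in> range word_mat" by simp
next
  show "\<one>\<^bsub>OB\<^esub> \<in> range word_mat" using word_mat.simps(1) by (metis OB_simps(2) rangeI)
qed (auto simp: word_mat_OB simp flip: word_mat_append)

text \<open>
  Positive definiteness of the symmetric matrix: a positive diagonal entry and a positive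
  determinant.
\<close>

definition posdef :: "real^3 \<Rightarrow> bool" where
  "posdef x \<longleftrightarrow> 0 < sR x \<and> tits_form x x < 0"

lemma posdef_sP: "posdef x \<Longrightarrow> 0 < sP x"
proof -
  assume "posdef x"
  then have "0 < sR x" "sQ x * sQ x < sP x * sR x" by (auto simp: posdef_def tits_form_sym)
  then have "0 < sP x * sR x" using zero_le_square[of "sQ x"] by linarith
  then show ?thesis using \<open>0 < sR x\<close> by (simp add: zero_less_mult_iff)
qed

lemma posdef_or_neg:
  assumes "tits_form x x < 0"
  shows "posdef x \<or> posdef (- x)"
proof -
  have "sR x \<noteq> 0" using assms by (auto simp: tits_form_sym not_less)
  then show ?thesis using assms by (auto simp: posdef_def tits_form_algebra)
qed

lemma posdef_reflection: "posdef x \<Longrightarrow> posdef (reflection (axis i 1) *v x)"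
  using exhaust_3[of i] posdef_sP[of x]
  by (auto simp: posdef_def reflection_isometry tits_form_values reflection_axis_coords)

lemma posdef_word: "posdef x \<Longrightarrow> posdef (word_mat w *v x)"
  by (induction w rule: word_mat.induct) (auto simp: posdef_reflection simp flip: matrix_vector_mul_assoc)

text \<open>
  The pairing of two positive definite forms dominates the diagonal entries of the second: with \<open>d\<close>
  the determinant of \<open>x\<close>, the difference of the two sides is the value of the quadratic form \<open>u\<close> at \<open>(q, - p)\<close>, respectively at
  \<open>(r, - q)\<close>, where \<open>p\<close>, \<open>q\<close>, \<open>r\<close> are the entries of \<open>x\<close>.
\<close>

lemma posdef_pairing_bound:
  assumes x: "posdef x" and u: "posdef u"
  shows "(- tits_form x x) * sP u \<le> 2 * sP x * (- tits_form x u)"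
    "(- tits_form x x) * sR u \<le> 2 * sR x * (- tits_form x u)"
proof -
  have key: "0 \<le> r * a * a - 2 * q * a * b + p * b * b" if "0 < p" "q * q < p * r" for p q r a b :: real
  proof -
    have "p * (r * a * a - 2 * q * a * b + p * b * b) = (p * r - q * q) * (a * a) + (p * b - q * a) * (p * b - q * a)"
      by (simp add: algebra_simps)
    also have "\<dots> \<ge> 0" using that by simp
    finally show ?thesis using that by (simp add: zero_le_mult_iff)
  qed
  have q: "sQ u * sQ u < sP u * sR u" using u by (simp add: posdef_def tits_form_sym)
  show "(- tits_form x x) * sP u \<le> 2 * sP x * (- tits_form x u)"
    using key[of "sP u" "sQ u" "sR u" "sP x" "sQ x"] q posdef_sP[OF u] by (simp add: tits_form_sym field_simps)
  show "(- tits_form x x) * sR u \<le> 2 * sR x * (- tits_form x u)"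
    using key[of "sR u" "sQ u" "sP u" "sR x" "sQ x"] q u by (simp add: posdef_def tits_form_sym field_simps)
qed

text \<open>
  The previous bound confines \<open>p\<close> and \<open>r\<close>, and then \<open>q\<^sup>2 < p r\<close> confines \<open>q\<close>.
\<close>

lemma finite_integral_posdef:
  assumes x: "posdef x"
  shows "finite {u. posdef u \<and> (\<forall>i. u $ i \<in> \<int>) \<and> - tits_form x u \<le> c}" (is "finite ?S")
proof -
  let ?d = "- tits_form x x"
  have d: "?d > 0" using x by (simp add: posdef_def)
  define K where "K = (2 * sP x * c + 2 * sR x * c) / ?d"
  define Z where "Z = {k \<in> \<int>. \<bar>k\<bar> \<le> K}"
  have "?S \<subseteq> (\<lambda>(p, q, r). of_sym p q r) ` (Z \<times> Z \<times> Z)"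
  proof
    fix u assume "u \<in> ?S"
    then have u: "posdef u" "\<And>i. u $ i \<in> \<int>" "- tits_form x u \<le> c" by auto
    have pos: "0 < sP u" "0 < sR u" "0 < sP x" "0 < sR x"
      using u(1) x posdef_sP by (auto simp: posdef_def)
    have "?d * sP u \<le> 2 * sP x * c" "?d * sR u \<le> 2 * sR x * c"
      using posdef_pairing_bound[OF x u(1)] u(3) pos
        mult_left_mono[OF u(3), of "2 * sP x"] mult_left_mono[OF u(3), of "2 * sR x"] by linarith+
    then have "?d * (sP u + sR u) \<le> 2 * sP x * c + 2 * sR x * c" by (simp add: distrib_left)
    then have K: "sP u + sR u \<le> K"
      unfolding K_def by (subst pos_le_divide_eq[OF d]) (simp add: mult.commute)
    have "sQ u * sQ u < sP u * sR u" using u by (simp add: posdef_def tits_form_sym)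
    also have "\<dots> \<le> (sP u + sR u) * (sP u + sR u)" using pos by (intro mult_mono) auto
    finally have "\<bar>sQ u\<bar> \<le> \<bar>sP u + sR u\<bar>" by (simp add: abs_le_square_iff power2_eq_square)
    then have "sP u \<in> Z" "sQ u \<in> Z" "sR u \<in> Z"
      using K pos u(2) by (auto simp: Z_def sP_def sQ_def sR_def intro!: Ints_diff Ints_mult)
    then show "u \<in> (\<lambda>(p, q, r). of_sym p q r) ` (Z \<times> Z \<times> Z)"
      by (intro image_eqI[of _ _ "(sP u, sQ u, sR u)"]) (simp_all add: of_sym_inverse)
  qed
  moreover have "finite Z" unfolding Z_def by (rule finite_abs_int_segment)
  ultimately show ?thesis by (meson finite_SigmaI finite_imageI finite_subset)
qed

text \<open>
  The solution of \<open>B(x, e\<^sub>i) = - 1\<close> for all \<open>i\<close>. It is an integral interior point of the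
  chamber at the same height above all three walls.
\<close>

definition chamber_point :: "real^3" where "chamber_point = of_sym 4 1 2"

lemma tits_chamber_point: "tits_form chamber_point (axis i 1) = -1"
  using exhaust_3[of i] by (auto simp: tits_form_sym chamber_point_def)

lemma posdef_chamber_point: "posdef chamber_point"
  by (simp add: posdef_def tits_form_sym chamber_point_def)

lemma chamber_point_integral: "chamber_point $ i \<in> \<int>"
  using exhaust_3[of i] by (auto simp: chamber_point_def of_sym_def vector_3)

lemma chamberI: "(\<And>i. tits_form x (axis i 1) \<le> 0) \<Longrightarrow> x \<in> chamber"
proof -
  assume *: "\<And>i. tits_form x (axis i 1) \<le> 0"
  show ?thesis using *[of 1] *[of 2] *[of 3] by (simp add: chamber_def tits_form_sym)
qed

text \<open>
  Reduction theory. By integrality the pairing of \<open>x\<close> with the orbit of the chamber point attains a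
  minimum, say at the translate by \<open>w\<close>. Put \<open>y = w\<inverse> x\<close>. Since the generator \<open>s\<^sub>i\<close> moves the chamber
  point by \<open>2 e\<^sub>i\<close>, minimality against \<open>w s\<^sub>i\<close> gives \<open>B(y, e\<^sub>i) \<le> 0\<close>.
\<close>

lemma word_to_chamber:
  assumes x: "posdef x"
  shows "\<exists>w. word_mat w *v x \<in> chamber"
proof -
  define \<phi> where "\<phi> u = - tits_form x u" for u
  define Orb where "Orb = range (\<lambda>w. word_mat w *v chamber_point)"
  define A where "A = {u \<in> Orb. \<phi> u \<le> \<phi> chamber_point}"
  have int: "u $ i \<in> \<int>" if "u \<in> Orb" for u i
    using that word_mat_integral chamber_point_integral
    by (auto simp: Orb_def matrix_vector_mult_def intro!: Ints_sum Ints_mult)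
  have "A \<subseteq> {u. posdef u \<and> (\<forall>i. u $ i \<in> \<int>) \<and> - tits_form x u \<le> \<phi> chamber_point}"
    using int posdef_word[OF posdef_chamber_point] by (auto simp: A_def \<phi>_def Orb_def)
  then have fin: "finite A" using finite_integral_posdef[OF x] finite_subset by blast
  have "word_mat [] *v chamber_point \<in> Orb" unfolding Orb_def by (rule rangeI)
  then have ne: "chamber_point \<in> A" by (simp add: A_def)
  obtain u where u: "u \<in> A" "\<And>v. v \<in> A \<Longrightarrow> \<phi> u \<le> \<phi> v"
  proof -
    have "Min (\<phi> ` A) \<in> \<phi> ` A" using fin ne by (intro Min_in) auto
    then obtain u where "u \<in> A" "\<phi> u = Min (\<phi> ` A)" by auto
    then show thesis using that fin by simp
  qed
  have u': "\<phi> u \<le> \<phi> v" if "v \<in> Orb" for v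
    using u(2)[of v] u(2)[OF ne] that by (cases "\<phi> v \<le> \<phi> chamber_point") (auto simp: A_def)
  obtain w where w: "u = word_mat w *v chamber_point" using u(1) by (auto simp: A_def Orb_def)
  define y where "y = word_mat (rev w) *v x"
  have y: "tits_form x (word_mat w *v z) = tits_form y z" for z
    using OB_isometry[OF word_mat_OB[of "rev w"], of x "word_mat w *v z"]
    by (simp add: y_def matrix_vector_mul_assoc word_mat_rev)
  have "tits_form y (axis i 1) \<le> 0" for i
  proof -
    have r: "word_mat [(i, False)] *v chamber_point = chamber_point + 2 *\<^sub>R axis i 1"
      by (simp add: reflection_axis tits_chamber_point)
    have "word_mat (w @ [(i, False)]) *v chamber_point \<in> Orb" unfolding Orb_def by (rule rangeI)
    then have "\<phi> u \<le> \<phi> (word_mat w *v (chamber_point + 2 *\<^sub>R axis i 1))"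
      using u' r by (metis word_mat_append matrix_vector_mul_assoc)
    then show ?thesis unfolding \<phi>_def w y by (simp add: tits_form_algebra)
  qed
  then have "y \<in> chamber" by (rule chamberI)
  then show ?thesis unfolding y_def by blast
qed

lemma chamber_frames_cover:
  assumes g: "g \<in> carrier OB"
  shows "\<exists>h\<in>range word_mat. h ** g \<in> chamber_frames"
proof -
  have "tits_form base_point base_point < 0" by (simp add: tits_form_sym base_point_def)
  then have "tits_form (g *v base_point) (g *v base_point) < 0" by (simp add: OB_isometry[OF g])
  then consider "posdef (g *v base_point)" | "posdef (- (g *v base_point))" using posdef_or_neg by blast
  then obtain w where "word_mat w *v (g *v base_point) \<in> chamber \<or> word_mat w *v (- (g *v base_point)) \<in> chamber"
    using word_to_chamber by cases blast+
  moreover have "word_mat w *v (- (g *v base_point)) = - (word_mat w *v (g *v base_point))"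
    using matrix_vector_mult_scaleR[of "word_mat w" "-1" "g *v base_point"] by simp
  ultimately have "word_mat w ** g \<in> chamber_frames"
    using g word_mat_OB OB_mult by (auto simp: chamber_frames_def simp flip: matrix_vector_mul_assoc)
  then show ?thesis by blast
qed

section \<open>The image of the Coxeter group is a lattice\<close>

lemma left_image_borel:
  fixes A C :: "real^3^3" and E :: "(real^3^3) set"
  assumes "A ** C = mat 1" "C ** A = mat 1" "E \<in> sets borel"
  shows "(\<lambda>x. A ** x) ` E \<in> sets borel"
proof -
  have "(\<lambda>x. A ** x) ` E = (\<lambda>x. C ** x) -` E"
  proof (intro equalityI subsetI)
    fix x assume "x \<in> (\<lambda>x. C ** x) -` E"
    moreover have "x = A ** (C ** x)" by (simp add: matrix_mul_assoc assms)
    ultimately show "x \<in> (\<lambda>x. A ** x) ` E" by blast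
  qed (auto simp: matrix_mul_assoc assms)
  moreover have "(\<lambda>x::real^3^3. C ** x) \<in> borel_measurable borel"
    unfolding matrix_matrix_mult_def by (intro borel_measurable_continuous_onI continuous_intros)
  ultimately show ?thesis using measurable_sets[of "\<lambda>x. C ** x" borel borel E] assms(3) by simp
qed

lemma right_image_borel:
  fixes A C :: "real^3^3" and E :: "(real^3^3) set"
  assumes "A ** C = mat 1" "C ** A = mat 1" "E \<in> sets borel"
  shows "(\<lambda>x. x ** A) ` E \<in> sets borel"
proof -
  have "(\<lambda>x. x ** A) ` E = (\<lambda>x. x ** C) -` E"
  proof (intro equalityI subsetI)
    fix x assume "x \<in> (\<lambda>x. x ** C) -` E"
    moreover have "x = (x ** C) ** A" by (simp add: matrix_mul_assoc[symmetric] assms)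
    ultimately show "x \<in> (\<lambda>x. x ** A) ` E" by blast
  qed (auto simp: matrix_mul_assoc[symmetric] assms)
  moreover have "(\<lambda>x::real^3^3. x ** C) \<in> borel_measurable borel"
    unfolding matrix_matrix_mult_def by (intro borel_measurable_continuous_onI continuous_intros)
  ultimately show ?thesis using measurable_sets[of "\<lambda>x. x ** C" borel borel E] assms(3) by simp
qed

lemma haar_left_word: "E \<in> sets borel \<Longrightarrow> emeasure haar ((\<lambda>x. word_mat w ** x) ` E) = emeasure haar E"
proof (induction w rule: word_mat.induct)
  case (2 s b w)
  let ?E = "(\<lambda>x. word_mat w ** x) ` E"
  have "?E \<in> sets borel" by (rule left_image_borel[OF word_mat_rev(2,1) 2(2)])
  moreover from this have "(\<lambda>x. reflection (axis s 1) ** x) ` ?E \<in> sets borel"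
    by (rule left_image_borel[OF reflection_axis_involution reflection_axis_involution])
  moreover have "(\<lambda>x. word_mat ((s, b) # w) ** x) ` E = (\<lambda>x. reflection (axis s 1) ** x) ` ?E"
    by (simp add: image_image matrix_mul_assoc)
  ultimately show ?case using 2 haar_left_generator by simp
qed simp

lemma haar_right:
  assumes g: "g \<in> carrier OB"
  shows "\<forall>E\<in>sets borel. emeasure haar ((\<lambda>x. x ** g) ` E) = emeasure haar E"
  using g
proof (induction rule: OB_induct)
  case minus_one
  show ?case
    using haar_right_minus_one right_image_borel[OF minus_one_involution minus_one_involution] by blast
next
  case (reflection v)
  then show ?case using haar_right_reflection right_image_borel reflection_involution by blast
next
  case (mult a b)
  show ?case
  proof
    fix E :: "(real^3^3) set" assume E: "E \<in> sets borel"
    have "invertible a" using mult by (simp add: orth_group_def)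
    then obtain a' where "a ** a' = mat 1" "a' ** a = mat 1" by (auto simp: invertible_def)
    then have "(\<lambda>x. x ** a) ` E \<in> sets borel" using E by (rule right_image_borel)
    moreover have "(\<lambda>x. x ** (a ** b)) ` E = (\<lambda>x. x ** b) ` ((\<lambda>x. x ** a) ` E)"
      by (simp add: image_image matrix_mul_assoc)
    ultimately show "emeasure haar ((\<lambda>x. x ** (a ** b)) ` E) = emeasure haar E" using mult E by simp
  qed
qed

text \<open>
  The adjoint of an isometry is its inverse. This explicit formula shows that inversion is
  continuous.
\<close>

lemma OB_inverse_apply:
  assumes A: "A \<in> carrier OB"
  shows "inv\<^bsub>OB\<^esub> A *v x = tits_form x (A *v axis 1 1) *\<^sub>R axis 1 1 + tits_form x (A *v axis 3 1) *\<^sub>R axis 3 1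
     - tits_form x (A *v base_point) *\<^sub>R base_point"
proof -
  let ?I = "inv\<^bsub>OB\<^esub> A"
  have I: "?I \<in> carrier OB" "A ** ?I = mat 1"
    using group.inv_closed[OF group_orth_group A] group.r_inv[OF group_orth_group A] by simp_all
  have *: "tits_form (?I *v x) z = tits_form x (A *v z)" for z
    using OB_isometry[OF A, of "?I *v x" z] I by (simp add: matrix_vector_mul_assoc)
  show ?thesis using orthogonal_expansion[of "?I *v x"] unfolding * .
qed

lemma OB_continuous_inverse: "continuous_on (carrier OB) (\<lambda>A. inv\<^bsub>OB\<^esub> A)"
proof -
  have t: "continuous_on UNIV (\<lambda>A :: real^3^3. tits_form x (A *v y))" for x y
    unfolding tits_form_expand by (intro continuous_on_add continuous_on_diff continuous_on_mult continuous_on_const continuous_matrix_vector_nth)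
  let ?f = "\<lambda>A x. tits_form x (A *v axis 1 1) *\<^sub>R axis 1 1 + tits_form x (A *v axis 3 1) *\<^sub>R axis 3 1
     - tits_form x (A *v base_point) *\<^sub>R base_point"
  have "continuous_on UNIV (\<lambda>A. matrix (?f A))"
    unfolding matrix_def
    by (intro continuous_on_vec_lambda continuous_on_component continuous_on_add continuous_on_diff continuous_on_scaleR continuous_on_const t)
  then have "continuous_on (carrier OB) (\<lambda>A. matrix (?f A))" by (rule continuous_on_subset) simp
  moreover have "matrix (?f A) = inv\<^bsub>OB\<^esub> A" if "A \<in> carrier OB" for A
    using OB_inverse_apply[OF that] matrix_of_matrix_vector_mul[of "inv\<^bsub>OB\<^esub> A"] by presburger
  ultimately show ?thesis by (simp cong: continuous_on_cong)
qed

theorem word_mat_lattice: "is_lattice OB (range word_mat)"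
proof -
  have "finite_volume_cover OB (range word_mat) haar chamber_frames"
  proof (rule finite_volume_cover.intro[OF group_orth_group], rule finite_volume_cover_axioms.intro)
    show "carrier OB \<in> sets borel" by (rule borel_closed[OF closed_OB])
    show "continuous_on (carrier OB \<times> carrier OB) (\<lambda>(x, y). x \<otimes>\<^bsub>OB\<^esub> y)"
      by (simp add: case_prod_unfold matrix_matrix_mult_def) (intro continuous_intros)
    show "chamber_frames \<subseteq> carrier OB" by (auto simp: chamber_frames_def)
    show "countable (range word_mat)" by simp
    fix g assume "g \<in> carrier OB"
    then show "\<exists>h\<in>range word_mat. h \<otimes>\<^bsub>OB\<^esub> g \<in> chamber_frames"
      using chamber_frames_cover by simp
  qed (auto simp: OB_continuous_inverse word_mat_subgroup word_mat_discrete sets_haar haar_left_word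
      haar_right haar_OB_nonzero chamber_frames_borel haar_chamber_frames_finite[simplified])
  then show ?thesis by (rule finite_volume_cover.lattice)
qed

section \<open>Normal forms and faithfulness\<close>

abbreviation word_eq :: "3 word \<Rightarrow> 3 word \<Rightarrow> bool" (infix "\<approx>\<^sub>W" 50) where
  "u \<approx>\<^sub>W v \<equiv> pres_eq W_relators u v"

lemma word_mat_respects: "u \<approx>\<^sub>W v \<Longrightarrow> word_mat u = word_mat v"
proof (induction rule: pres_eq.induct)
  case (cancel u s b v)
  have "word_mat [(s, b), (s, \<not> b)] = mat 1" by (simp add: reflection_axis_involution)
  then show ?case unfolding word_mat_append by simp
next
  case (relator r u v)
  have c: "word_mat [(1, False), (3, False), (1, False), (3, False)] = mat 1"
    unfolding matrix_eq
    by (intro allI sym_eqI) (simp_all add: reflection_axis_coords flip: matrix_vector_mul_assoc)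
  have "word_mat r = mat 1"
    using relator c by (auto simp: W_relators_def reflection_axis_involution)
  then show ?case unfolding word_mat_append by simp
qed auto

definition gens :: "3 list \<Rightarrow> 3 word" where
  "gens = map (\<lambda>s. (s, False))"

lemma gens_simps [simp]: "gens [] = []" "gens (s # l) = (s, False) # gens l" "gens (k @ l) = gens k @ gens l"
  by (simp_all add: gens_def)

lemma gens_relators: "gens [s, s] \<approx>\<^sub>W []" "gens [1, 3, 1, 3] \<approx>\<^sub>W []"
  using pres_eq.relator[of "gens [s, s]" W_relators "[]" "[]"]
    pres_eq.relator[of "gens [1, 3, 1, 3]" W_relators "[]" "[]"] exhaust_3[of s]
  by (auto simp: W_relators_def)

lemma gens_drop: "gens r \<approx>\<^sub>W [] \<Longrightarrow> gens (k @ r @ l) \<approx>\<^sub>W gens (k @ l)"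
  using pres_eq_context[of W_relators "gens r" "[]" "gens k" "gens l"] by simp

lemma gens_context: "gens k \<approx>\<^sub>W gens l \<Longrightarrow> gens (k @ m) \<approx>\<^sub>W gens (l @ m)"
  using pres_eq_context[of W_relators "gens k" "gens l" "[]" "gens m"] by simp

text \<open>
  A formal inverse equals its generator in the group, so normal forms need only positive letters.
\<close>

lemma letter_positive: "[(s, b)] \<approx>\<^sub>W gens [s]"
proof (cases b)
  case True
  have "[] @ gens [s, s] @ [(s, True)] \<approx>\<^sub>W [] @ [(s, True)]"
    using pres_eq_context[OF gens_relators(1)[of s], of "[]" "[(s, True)]"] by simp
  moreover have "gens [s] @ [(s, False), (s, \<not> False)] @ [] \<approx>\<^sub>W gens [s] @ []"
    by (rule pres_eq.cancel)
  ultimately show ?thesis using True by (auto intro: pres_eq.trans[OF pres_eq.sym])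
qed (simp add: pres_eq.refl)

lemma gens_commute: "gens [3, 1] \<approx>\<^sub>W gens [1, 3]"
proof -
  have "gens ([1] @ [1, 3, 1, 3] @ [3]) \<approx>\<^sub>W gens ([1] @ [3])"
    by (rule gens_drop[OF gens_relators(2)])
  moreover have "gens ([] @ [1, 1] @ [3, 1, 3, 3]) \<approx>\<^sub>W gens ([] @ [3, 1, 3, 3])"
    by (rule gens_drop[OF gens_relators(1)])
  moreover have "gens ([3, 1] @ [3, 3] @ []) \<approx>\<^sub>W gens ([3, 1] @ [])"
    by (rule gens_drop[OF gens_relators(1)])
  ultimately show ?thesis by simp (meson pres_eq.trans pres_eq.sym)
qed

text \<open>
  Normal forms in the free product of \<open>{1, s\<^sub>1, s\<^sub>3, s\<^sub>1 s\<^sub>3}\<close> and \<open>{1, s\<^sub>2}\<close>. The flag is true if the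
  first syllable is \<open>s\<^sub>2\<close> and false if it comes from the other factor; the empty word has both flags.
\<close>

inductive alternating :: "bool \<Rightarrow> 3 list \<Rightarrow> bool" where
  nil: "alternating b []"
| two: "alternating False l \<Longrightarrow> alternating True (2 # l)"
| four: "\<lbrakk>a \<in> {[1], [3], [1, 3]}; alternating True l\<rbrakk> \<Longrightarrow> alternating False (a @ l)"

lemma alternating_Cons:
  assumes "alternating b l"
  shows "\<exists>b' l'. gens (s # l) \<approx>\<^sub>W gens l' \<and> alternating b' l'"
proof (cases "s = 2")
  case True
  show ?thesis
    using assms
  proof cases
    case nil
    then show ?thesis using alternating.two[OF alternating.nil] True by (metis pres_eq.refl)
  next
    case (two l')
    have "gens ([] @ [2, 2] @ l') \<approx>\<^sub>W gens ([] @ l')" by (rule gens_drop[OF gens_relators(1)])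
    then show ?thesis using two True by auto
  next
    case (four a l')
    then show ?thesis using alternating.two[of l] assms True by (metis pres_eq.refl)
  qed
next
  case False
  then have s: "s = 1 \<or> s = 3" using exhaust_3[of s] by auto
  have *: ?thesis if "alternating True l"
  proof -
    have "alternating False ([s] @ l)" using s that by (intro alternating.four) auto
    then show ?thesis by (metis append_Cons append_Nil pres_eq.refl)
  qed
  show ?thesis
    using assms
  proof cases
    case nil
    then show ?thesis using * alternating.nil by blast
  next
    case two
    then show ?thesis using * assms by simp
  next
    case (four a l')
    have 11: "gens (s # [s]) \<approx>\<^sub>W gens []" by (simp add: gens_relators[simplified])
    have 113: "gens [1, 1, 3] \<approx>\<^sub>W gens [3]" using gens_drop[OF gens_relators(1), of "[]" 1 "[3]"] by simp
    have 313: "gens [3, 1, 3] \<approx>\<^sub>W gens [1]"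
      using pres_eq.trans[OF gens_context[OF gens_commute, of "[3]"]] gens_drop[OF gens_relators(1), of "[1]" 3 "[]"] by simp
    have "\<exists>a'. (a' = [] \<or> a' \<in> {[1], [3], [1, 3]}) \<and> gens (s # a) \<approx>\<^sub>W gens a'"
      using s four(3) 11 113 313 gens_commute pres_eq.refl[of W_relators "gens [1, 3]"]
      by (auto simp del: gens_simps)
    then obtain a' where a': "a' = [] \<or> a' \<in> {[1], [3], [1, 3]}" "gens (s # a) \<approx>\<^sub>W gens a'" by blast
    have "gens (s # l) \<approx>\<^sub>W gens (a' @ l')" using gens_context[OF a'(2), of l'] four by simp
    moreover have "\<exists>b'. alternating b' (a' @ l')"
      using a'(1) alternating.four[of a' l'] four by (metis append_Nil)
    ultimately show ?thesis by blast
  qed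
qed

lemma alternating_normal_form: "\<exists>b l. u \<approx>\<^sub>W gens l \<and> alternating b l"
proof (induction u)
  case Nil
  show ?case using alternating.nil pres_eq.refl by (metis gens_simps(1))
next
  case (Cons x u)
  obtain s c where x: "x = (s, c)" by fastforce
  obtain b l where l: "u \<approx>\<^sub>W gens l" "alternating b l" using Cons by blast
  have "[x] @ u \<approx>\<^sub>W gens [s] @ gens l" unfolding x by (intro pres_eq_append letter_positive l)
  then have "x # u \<approx>\<^sub>W gens (s # l)" by simp
  then show ?case using alternating_Cons[OF l(2), of s] pres_eq.trans by blast
qed

text \<open>
  The half-plane \<open>q > r\<close> beyond the wall of \<open>s\<^sub>2\<close> and the complement \<open>q < 0 \<or> p < r\<close> of the quadrant
  at the right-angled vertex are disjoint on positive definite matrices. Every nontrivial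
  element of one factor carries the region of the other factor, as well as the chamber point, into its
  own region.
\<close>

lemma ping_pong:
  assumes "alternating b l" "l \<noteq> []"
  shows "if b then sR (word_mat (gens l) *v chamber_point) < sQ (word_mat (gens l) *v chamber_point)
     else sQ (word_mat (gens l) *v chamber_point) < 0 \<or>
          sP (word_mat (gens l) *v chamber_point) < sR (word_mat (gens l) *v chamber_point)"
  using assms
proof (induction rule: alternating.induct)
  case (two l)
  define x where "x = word_mat (gens l) *v chamber_point"
  have x: "posdef x" unfolding x_def by (rule posdef_word[OF posdef_chamber_point])
  have "sQ x < sR x"
  proof (cases "l = []")
    case True
    then show ?thesis by (simp add: x_def chamber_point_def)
  next
    case False
    then consider "sQ x < 0" | "sP x < sR x" using two by (auto simp: x_def)
    then show ?thesis
    proof cases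
      case 2
      have "sQ x * sQ x < sP x * sR x" using x by (simp add: posdef_def tits_form_sym)
      also have "\<dots> < sR x * sR x" using 2 x by (simp add: posdef_def)
      finally show ?thesis using x by (meson mult_mono' not_le less_imp_le posdef_def)
    qed (use x in \<open>simp add: posdef_def\<close>)
  qed
  then show ?case by (simp add: x_def reflection_axis_coords flip: matrix_vector_mul_assoc)
next
  case (four a l)
  define x where "x = word_mat (gens l) *v chamber_point"
  have x: "posdef x" unfolding x_def by (rule posdef_word[OF posdef_chamber_point])
  have "0 < sQ x \<and> sR x < sP x"
  proof (cases "l = []")
    case True
    then show ?thesis by (simp add: x_def chamber_point_def)
  next
    case False
    then have 2: "sR x < sQ x" using four by (auto simp: x_def)
    then have q: "0 < sQ x" using x by (simp add: posdef_def)
    have "sR x * sR x < sQ x * sQ x" using 2 x by (simp add: posdef_def mult_strict_mono)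
    also have "\<dots> < sP x * sR x" using x by (simp add: posdef_def tits_form_sym)
    finally show ?thesis using q x by (simp add: posdef_def)
  qed
  then show ?case
    using four.hyps(1)
    by (auto simp: word_mat_append x_def reflection_axis_coords simp flip: matrix_vector_mul_assoc)
qed simp

text \<open>
  The chamber point lies in neither ping-pong region, so a nonempty normal form moves it.
\<close>

lemma word_mat_kernel: "word_mat u = mat 1 \<Longrightarrow> u \<approx>\<^sub>W []"
proof -
  assume u: "word_mat u = mat 1"
  obtain b l where l: "u \<approx>\<^sub>W gens l" "alternating b l" using alternating_normal_form by blast
  have "word_mat (gens l) = mat 1" using word_mat_respects[OF l(1)] u by simp
  then have "l = []" using ping_pong[OF l(2)] by (cases b) (auto simp: chamber_point_def)
  then show ?thesis using l(1) by simp
qed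

lemma word_mat_faithful:
  assumes "word_mat u = word_mat v"
  shows "u \<approx>\<^sub>W v"
proof -
  let ?i = "\<lambda>u :: 3 word. map (\<lambda>(s, b). (s, \<not> b)) (rev u)"
  have ii: "?i (?i u) = u" by (induction u) (auto simp: rev_map)
  have iu: "?i u @ u \<approx>\<^sub>W []" by (rule pres_eq_inverse)
  have ui: "u @ ?i u \<approx>\<^sub>W []" using pres_eq_inverse[of W_relators "?i u"] by (simp only: ii)
  have "word_mat (?i u @ v) = word_mat (?i u @ u)" by (simp only: word_mat_append assms)
  also have "\<dots> = mat 1" using word_mat_respects[OF iu] by simp
  finally have "?i u @ v \<approx>\<^sub>W []" by (rule word_mat_kernel)
  then have "u @ (?i u @ v) @ [] \<approx>\<^sub>W u @ [] @ []" by (rule pres_eq_context)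
  moreover have "[] @ (u @ ?i u) @ v \<approx>\<^sub>W [] @ [] @ v" using ui by (rule pres_eq_context)
  ultimately show ?thesis by simp (meson pres_eq.trans pres_eq.sym)
qed

section \<open>The geometric representation\<close>

lemma W_simps: "carrier W = range (pres_class W_relators)"
  "pres_class W_relators u \<otimes>\<^bsub>W\<^esub> pres_class W_relators v = pres_class W_relators (u @ v)"
  by (simp_all add: W_def presented_group_mult) (simp add: presented_group_def)

text \<open>
  A geometric representation is determined by the matrices of the generators. It therefore agrees
  with the evaluation of words.
\<close>

lemma geometric_rep_word:
  assumes \<rho>: "is_geometric_rep \<rho>"
  shows "\<rho> (pres_class W_relators u) = word_mat u"
proof (induction u)
  have hom: "\<rho> (pres_class W_relators (u @ v)) = \<rho> (pres_class W_relators u) ** \<rho> (pres_class W_relators v)"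
    and inv: "invertible (\<rho> (pres_class W_relators u))" for u v
    using \<rho> by (auto simp: is_geometric_rep_def hom_def GL_def W_simps)
  {
    case Nil
    let ?e = "\<rho> (pres_class W_relators [])"
    obtain f where f: "f ** ?e = mat 1" using inv[of "[]"] by (auto simp: invertible_def)
    have "f ** (?e ** ?e) = f ** ?e" using hom[of "[]" "[]"] by simp
    then show ?case using f by (simp add: matrix_mul_assoc)
  next
    case (Cons x u)
    obtain s b where x: "x = (s, b)" by fastforce
    have "pres_class W_relators [(s, b)] = cox_gen s"
      using letter_positive[of s b] by (simp add: cox_gen_def pres_class_eq_iff)
    moreover have "\<rho> (cox_gen s) = reflection (axis s 1)"
      using \<rho> by (intro matrix_eq_on_axes) (simp add: is_geometric_rep_def reflection_axis)
    ultimately show ?case using hom[of "[x]" u] Cons x by simp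
  }
qed

lemma geometric_rep_exists: "\<exists>\<rho>. is_geometric_rep \<rho>"
proof -
  define \<rho> where "\<rho> X = word_mat (SOME u. X = pres_class W_relators u)" for X
  have \<rho>: "\<rho> (pres_class W_relators u) = word_mat u" for u
  proof -
    have "pres_class W_relators u = pres_class W_relators (SOME v. pres_class W_relators u = pres_class W_relators v)"
      by (rule someI) (rule HOL.refl)
    then show ?thesis unfolding \<rho>_def pres_class_eq_iff using word_mat_respects by metis
  qed
  have "invertible (word_mat u)" for u using word_mat_OB[of u] by (simp add: orth_group_def)
  then have "\<rho> \<in> hom W GL"
    by (auto simp: hom_def GL_def W_simps \<rho> word_mat_append)
  then have "is_geometric_rep \<rho>"
    by (simp add: is_geometric_rep_def cox_gen_def \<rho> reflection_axis)
  then show ?thesis by blast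
qed

lemma geometric_rep_iso:
  assumes "is_geometric_rep \<rho>"
  shows "\<rho> \<in> iso W (OB\<lparr>carrier := \<rho> ` carrier W\<rparr>)" "\<rho> ` carrier W = range word_mat"
proof -
  note \<rho> = geometric_rep_word[OF assms]
  have "inj_on \<rho> (carrier W)"
    by (auto simp: inj_on_def W_simps \<rho> pres_class_eq_iff word_mat_faithful)
  then show "\<rho> \<in> iso W (OB\<lparr>carrier := \<rho> ` carrier W\<rparr>)"
    by (auto simp: iso_def hom_def bij_betw_def W_simps \<rho> word_mat_append)
  show "\<rho> ` carrier W = range word_mat"
    by (auto simp: W_simps \<rho> image_image)
qed

section \<open>Signature and the standard form\<close>

text \<open>
  The vectors \<open>e\<^sub>1\<close>, \<open>e\<^sub>3\<close> and \<open>(1, 1, 1)\<close> form an orthogonal basis with squares \<open>1\<close>, \<open>1\<close>, \<open>- 1\<close>.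
\<close>

lemma tits_signature: "has_signature tits_form 2 1"
proof -
  let ?P = "{axis 1 1, axis 3 1} :: (real^3) set" and ?N = "{base_point}"
  have card: "card ?P = 2" "card ?N = 1" by (simp_all add: axis_eq_axis)
  have "y \<in> span (?P \<union> ?N)" for y
    by (subst orthogonal_expansion[of y]) (intro span_diff span_add span_scale span_base; simp)
  then have span: "span (?P \<union> ?N) = UNIV" by auto
  have "card (?P \<union> ?N) \<le> 3" using card_Un_le[of ?P ?N] card by simp
  then have "independent (?P \<union> ?N)"
    by (intro card_le_dim_spanning[of _ UNIV]) (simp_all only: span dim_UNIV, simp_all)
  then show ?thesis
    unfolding has_signature_def
    using span card tits_form_bilinear tits_form_commute
    by (intro conjI exI[of _ ?P] exI[of _ ?N])
      (auto simp: pairwise_def tits_form_values base_point_products)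
qed

lemma orth_group_conjugate_iso:
  fixes P :: "real^'n^'n"
  assumes P: "invertible P" and form: "\<And>x y. B' x y = B (P *v x) (P *v y)"
  shows "(\<lambda>A. matrix_inv P ** A ** P) \<in> iso (orth_group B) (orth_group B')"
proof -
  let ?i = "matrix_inv P"
  note c = matrix_inv_cancel[OF P]
  have ci: "invertible ?i" using c invertible_def by blast
  have v: "P *v (?i *v x) = x" "?i *v (P *v x) = x" for x by (simp_all add: matrix_vector_mul_assoc c)
  have 1: "?i ** A ** P \<in> carrier (orth_group B')" if "A \<in> carrier (orth_group B)" for A
    using that P ci by (auto simp: orth_group_def form invertible_mult v simp flip: matrix_vector_mul_assoc)
  have form': "B x y = B' (?i *v x) (?i *v y)" for x y by (simp add: form v)
  have 2: "P ** A ** ?i \<in> carrier (orth_group B)" if "A \<in> carrier (orth_group B')" for A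
    using that P ci by (auto simp: orth_group_def form' invertible_mult v simp flip: matrix_vector_mul_assoc)
  have e: "?i ** (P ** A ** ?i) ** P = A" "P ** (?i ** A ** P) ** ?i = A" for A
    by (simp_all add: matrix_eq v flip: matrix_vector_mul_assoc)
  have "bij_betw (\<lambda>A. ?i ** A ** P) (carrier (orth_group B)) (carrier (orth_group B'))"
    by (rule bij_betw_byWitness[where f' = "\<lambda>A. P ** A ** ?i"]) (auto simp: e 1 2)
  moreover have "?i ** (A ** C) ** P = (?i ** A ** P) ** (?i ** C ** P)" for A C
    by (simp add: matrix_eq v flip: matrix_vector_mul_assoc)
  ultimately show ?thesis
    using 1 by (auto simp: iso_def hom_def) (simp_all add: orth_group_def)
qed

lemma tits_conjugate_standard:
  "\<exists>P :: real^3^3. invertible P \<and>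
     (\<lambda>A. matrix_inv P ** A ** P) \<in> iso (orth_group tits_form) (orth_group form_2_1)"
proof -
  obtain P :: "real^3^3" where P: "\<And>x. P *v x = x $ 1 *\<^sub>R axis 1 1 + x $ 2 *\<^sub>R axis 3 1 + x $ 3 *\<^sub>R base_point"
    using matrix_of_columns[of "\<lambda>i. if i = 1 then axis 1 1 else if i = 2 then axis 3 1 else base_point"] by auto
  have form: "form_2_1 x y = tits_form (P *v x) (P *v y)" for x y
    by (simp add: P form_2_1_def tits_form_algebra tits_form_values base_point_products)
  have "x = y" if "P *v x = P *v y" for x y
  proof -
    have "form_2_1 x z = form_2_1 y z" for z using that form by simp
    from this[of "axis 1 1"] this[of "axis 2 1"] this[of "axis 3 1"]
    show ?thesis by (simp add: form_2_1_def axis_def vec_eq_iff forall_3)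
  qed
  then have "inj ((*v) P)" by (rule injI)
  then have inv: "invertible P" by (simp add: invertible_left_inverse matrix_left_invertible_injective)
  have "(\<lambda>A. matrix_inv P ** A ** P) \<in> iso (orth_group tits_form) (orth_group form_2_1)"
    using inv by (rule orth_group_conjugate_iso) (rule form)
  with inv show ?thesis by (intro exI conjI)
qed

section \<open>Real rank\<close>

text \<open>
  Let \<open>q\<^sub>1, q\<^sub>2, q\<^sub>3\<close> be a common eigenbasis with eigenvalue functions \<open>t\<^sub>i\<close>. Each \<open>i\<close> has
  a partner \<open>k i\<close> with \<open>B(q\<^sub>i, q\<^bsub>k i\<^esub>) \<noteq> 0\<close>, and then \<open>t\<^sub>i\<close> and the eigenvalue at the partner are
  inverse to each other. By connectedness all \<open>t\<^sub>i\<close> are positive, so an index that is its own partner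
  has \<open>t\<^sub>i = 1\<close>. If some \<open>i\<close> has \<open>k i \<noteq> i\<close>, the partner of the third index shows that \<open>t\<^sub>i\<close>
  determines all eigenvalues.
\<close>

lemma split_torus_coordinate:
  assumes T: "split_torus OB T"
  shows "\<exists>f. continuous_on T (f :: real^3^3 \<Rightarrow> real) \<and> inj_on f T"
proof -
  obtain Q :: "real^3^3" where Q: "invertible Q"
      "\<And>A i j. A \<in> T \<Longrightarrow> i \<noteq> j \<Longrightarrow> (matrix_inv Q ** A ** Q) $ i $ j = 0"
    using T unfolding split_torus_def by (elim conjE exE) (rule that; blast)
  have sub: "subgroup T OB" and con: "connected T" using T by (auto simp: split_torus_def)
  have TO: "A \<in> carrier OB" if "A \<in> T" for A using subgroup.subset[OF sub] that by blast
  have one: "mat 1 \<in> T" using subgroup.one_closed[OF sub] by simp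
  note c = matrix_inv_cancel[OF Q(1)]
  define q where "q i = Q *v axis i 1" for i :: 3
  define t where "t i A = (matrix_inv Q ** A ** Q) $ i $ i" for i A
  have eig: "A *v q j = t j A *\<^sub>R q j" if A: "A \<in> T" for A j
  proof -
    let ?D = "matrix_inv Q ** A ** Q"
    have "?D *v axis j 1 = t j A *\<^sub>R axis j 1"
      unfolding vec_eq_iff matrix_axis_nth using Q(2)[OF A] by (simp add: t_def axis_def)
    then have "Q *v (?D *v axis j 1) = t j A *\<^sub>R q j" by (simp add: matrix_vector_mult_scaleR q_def)
    moreover have "Q *v (?D *v axis j 1) = (Q ** matrix_inv Q) *v (A *v q j)"
      by (simp only: q_def matrix_vector_mul_assoc matrix_mul_assoc)
    ultimately show ?thesis by (simp add: c)
  qed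
  have rel: "t i A * t j A = 1" if "A \<in> T" "tits_form (q i) (q j) \<noteq> 0" for A i j
    using OB_isometry[OF TO[OF that(1)], of "q i" "q j"] that by (simp add: eig tits_form_algebra mult.commute)
  have expand: "x = (\<Sum>i\<in>UNIV. (matrix_inv Q *v x) $ i *\<^sub>R q i)" for x
  proof -
    have "x = Q *v (matrix_inv Q *v x)" by (simp add: matrix_vector_mul_assoc c)
    also have "\<dots> = (\<Sum>i\<in>UNIV. (matrix_inv Q *v x) $ i *\<^sub>R q i)"
      unfolding q_def matrix_vector_mult_basis
      by (subst matrix_mult_sum) (simp only: scalar_mult_eq_scaleR)
    finally show ?thesis .
  qed
  have q0: "q i \<noteq> 0" for i
  proof
    assume "q i = 0"
    then have "matrix_inv Q *v q i = 0" by simp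
    then show False by (simp add: q_def matrix_vector_mul_assoc c)
  qed
  have "\<exists>j. tits_form (q i) (q j) \<noteq> 0" for i
  proof (rule ccontr)
    assume "\<nexists>j. tits_form (q i) (q j) \<noteq> 0"
    then have "tits_form (q i) x = 0" for x
      by (subst expand[of x]) (simp add: sum_3 tits_form_algebra)
    then show False using tits_form_nondegenerate q0 by blast
  qed
  then obtain k where k: "\<And>i. tits_form (q i) (q (k i)) \<noteq> 0" by metis
  have tk: "t i A * t (k i) A = 1" if "A \<in> T" for A i using rel[OF that k] .
  have cont: "continuous_on T (t i)" for i
    unfolding t_def matrix_matrix_mult_def by (auto intro!: continuous_intros)
  have pos: "t i A > 0" if "A \<in> T" for A i
  proof (rule ccontr)
    assume "\<not> t i A > 0"
    have "connected (t i ` T)" by (rule connected_continuous_image[OF cont con])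
    moreover have "t i (mat 1) = 1" unfolding t_def matrix_mul_rid c by (simp add: mat_def)
    moreover from this have "1 \<in> t i ` T" using one by (metis image_eqI)
    ultimately have "0 \<in> t i ` T"
      using that \<open>\<not> t i A > 0\<close> by (intro connectedD_interval[of "t i ` T" "t i A" 1 0]) auto
    then obtain C where "C \<in> T" "t i C = 0" by auto
    then show False using tk[of C i] by simp
  qed
  obtain j where j: "\<And>A C i. \<lbrakk>A \<in> T; C \<in> T; t j A = t j C\<rbrakk> \<Longrightarrow> t i A = t i C"
  proof (cases "\<exists>i. k i \<noteq> i")
    case True
    then obtain i where i: "k i \<noteq> i" by blast
    have ki: "t (k i) A = 1 / t i A" "t i A = 1 / t (k i) A" if "A \<in> T" for A i
      using tk[OF that, of i] pos[OF that, of i] pos[OF that, of "k i"] by (simp_all add: field_simps)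
    have "t l A = t l C" if A: "A \<in> T" "C \<in> T" "t i A = t i C" for A C l
    proof (cases "l = i \<or> l = k i")
      case False
      \<comment> \<open>There is no fourth index: the partner of \<open>l\<close> is \<open>i\<close>, \<open>k i\<close> or \<open>l\<close> itself.\<close>
      then have "card {i, k i, l} = CARD(3)" using i by auto
      then have "{i, k i, l} = UNIV" by (intro card_subset_eq) auto
      then have "k l = i \<or> k l = k i \<or> k l = l" by blast
      then consider "k l = i" | "k l = k i" | "k l = l" by blast
      then show ?thesis
      proof cases
        case 3
        have "t l A = 1" if "A \<in> T" for A
        proof -
          have "(t l A)\<^sup>2 = 1" using tk[OF that, of l] 3 by (simp add: power2_eq_square)
          then show ?thesis using pos[OF that, of l] by (auto simp: power2_eq_1_iff)
        qed
        then show ?thesis using A by simp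
      next
        case 1
        then show ?thesis using ki(2)[OF A(1), of l] ki(2)[OF A(2), of l] A(3) by simp
      next
        case 2
        then show ?thesis
          using ki(2)[OF A(1), of l] ki(2)[OF A(2), of l] ki(1)[OF A(1), of i] ki(1)[OF A(2), of i] A(3) by simp
      qed
    next
      case True
      then show ?thesis using A(3) ki(1)[OF A(1), of i] ki(1)[OF A(2), of i] by auto
    qed
    then show thesis by (rule that)
  next
    case False
    have "t l A = 1" if "A \<in> T" for A l
    proof -
      have "(t l A)\<^sup>2 = 1" using tk[OF that, of l] False by (simp add: power2_eq_square)
      then show ?thesis using pos[OF that, of l] by (auto simp: power2_eq_1_iff)
    qed
    then show thesis using that by simp
  qed
  have "inj_on (t j) T"
  proof (rule inj_onI)
    fix A C assume A: "A \<in> T" "C \<in> T" "t j A = t j C"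
    have AC: "A *v q i = C *v q i" for i using eig A j[OF A] by simp
    have M: "M *v x = (\<Sum>i\<in>UNIV. (matrix_inv Q *v x) $ i *\<^sub>R (M *v q i))" for M :: "real^3^3" and x
      using arg_cong[OF expand[of x], of "\<lambda>x. M *v x"]
      by (simp only: sum_3 matrix_vector_right_distrib matrix_vector_mult_scaleR)
    have "A *v x = C *v x" for x unfolding M[of A x] M[of C x] AC ..
    then show "A = C" by (simp add: matrix_eq)
  qed
  then show ?thesis using cont by blast
qed

text \<open>
  A patch of dimension at least two contains a plane, and the plane does not inject continuously
  into the line.
\<close>

lemma manifold_dim_le_1:
  fixes f :: "'a::topological_space \<Rightarrow> real"
  assumes T: "has_manifold_dim T d" "T \<noteq> {}" and f: "continuous_on T f" "inj_on f T"
  shows "d \<le> 1"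
proof (rule ccontr)
  assume d: "\<not> d \<le> 1"
  obtain U where U: "openin (top_of_set T) U" "top_of_set U homeomorphic_space Euclidean_space d"
    using T by (auto simp: has_manifold_dim_def)
  have UT: "U \<subseteq> T" using openin_subset[OF U(1)] by simp
  obtain h g where hg: "homeomorphic_maps (top_of_set U) (Euclidean_space d) h g"
    using U(2) by (auto simp: homeomorphic_space_def)
  then have g: "continuous_map (Euclidean_space d) (top_of_set U) g"
      "\<And>x. x \<in> topspace (Euclidean_space d) \<Longrightarrow> h (g x) = x"
    by (auto simp: homeomorphic_maps_def)
  define e :: "real \<times> real \<Rightarrow> nat \<Rightarrow> real" where
    "e p = (\<lambda>i. if i < d then (if i = 0 then fst p else if i = 1 then snd p else 0) else 0)" for p
  have e: "continuous_map euclidean (Euclidean_space d) e"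
  proof -
    have "continuous_map euclidean euclideanreal (\<lambda>p :: real \<times> real. if i = 0 then fst p else if i = 1 then snd p else 0)" for i :: nat
      by (cases "i = 0"; cases "i = 1") (auto intro!: continuous_intros)
    then show ?thesis unfolding e_def by (subst continuous_map_componentwise_Euclidean_space) blast
  qed
  have "continuous_map (top_of_set U) euclidean f"
    using continuous_on_subset[OF f(1) UT] by simp
  then have "continuous_map euclidean euclidean (f \<circ> (g \<circ> e))"
    using continuous_map_compose[OF continuous_map_compose[OF e g(1)]] by blast
  then have c: "continuous_on UNIV (f \<circ> (g \<circ> e))" by simp
  have "inj (f \<circ> (g \<circ> e))"
  proof (rule injI)
    fix p p' assume *: "(f \<circ> (g \<circ> e)) p = (f \<circ> (g \<circ> e)) p'"
    have et: "e p \<in> topspace (Euclidean_space d)" for p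
      using continuous_map_image_subset_topspace[OF e] by auto
    have gU: "g (e p) \<in> U" for p
      using continuous_map_image_subset_topspace[OF g(1)] et[of p] by (simp add: image_subset_iff)
    have "g (e p) = g (e p')"
    proof (rule inj_onD[OF f(2)])
      show "f (g (e p)) = f (g (e p'))" using * by simp
      show "g (e p) \<in> T" "g (e p') \<in> T" using gU UT by blast+
    qed
    then have "e p = e p'" using g(2)[OF et] by metis
    then have "e p 0 = e p' 0" "e p 1 = e p' 1" by simp_all
    then show "p = p'" using d by (simp add: e_def prod_eq_iff)
  qed
  then have "DIM(real \<times> real) \<le> DIM(real)"
    by (intro invariance_of_dimension[OF c]) (auto intro: inj_on_subset)
  then show False by simp
qed

text \<open>
  The action of the diagonal matrix with entries \<open>exp s\<close> and \<open>exp (- s)\<close>.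
\<close>

definition torus :: "real \<Rightarrow> real^3^3" where
  "torus s = spin (vector [exp s, 0], vector [0, exp (- s)])"

lemma torus_det: "det2 (vector [exp s, 0], vector [0, exp (- s)]) = 1"
  by (simp add: det2_def exp_minus)

lemma torus_coords:
  "sP (torus s *v x) = exp (2 * s) * sP x" "sQ (torus s *v x) = sQ x" "sR (torus s *v x) = exp (- 2 * s) * sR x"
  by (simp_all add: torus_def spin_apply congruence_coords torus_det flip: exp_add)

lemma torus_OB: "torus s \<in> carrier OB"
  unfolding torus_def by (rule spin_OB) (simp add: torus_det)

lemma torus_add: "torus s ** torus t = torus (s + t)"
  unfolding matrix_eq
  by (intro allI sym_eqI) (simp_all add: torus_coords algebra_simps flip: matrix_vector_mul_assoc exp_add)

lemma torus_0: "torus 0 = mat 1"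
  unfolding matrix_eq by (intro allI sym_eqI) (simp_all add: torus_coords)

lemma of_sym_linear: "of_sym p q r = p *\<^sub>R of_sym 1 0 0 + q *\<^sub>R of_sym 0 1 0 + r *\<^sub>R of_sym 0 0 1"
  by (rule sym_eqI) simp_all

lemma torus_continuous: "continuous_on UNIV torus"
proof -
  have eq: "(\<lambda>s. torus s *v x) = (\<lambda>s. (exp (2 * s) * sP x) *\<^sub>R of_sym 1 0 0 + sQ x *\<^sub>R of_sym 0 1 0
      + (exp (- 2 * s) * sR x) *\<^sub>R of_sym 0 0 1)" for x
    by (rule ext, rule sym_eqI) (simp_all add: torus_coords)
  have ct: "continuous_on UNIV (\<lambda>s. torus s *v x)" for x
    unfolding eq by (intro continuous_intros)
  have "continuous_on UNIV (\<lambda>s. matrix (\<lambda>x. torus s *v x))"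
    unfolding matrix_def by (intro continuous_on_vec_lambda continuous_on_component ct)
  then show ?thesis by simp
qed

text \<open>
  The symmetric matrix units are eigenvectors of the torus. For closedness, the torus is described inside
  \<open>O(B)\<close> by closed conditions on their images; the condition \<open>p \<ge> 0\<close> is as good as \<open>p > 0\<close> since the
  eigenvalues on the two isotropic lines are inverse to each other.
\<close>

lemma torus_split: "split_torus OB (range torus)"
  unfolding split_torus_def
proof (intro conjI)
  let ?T = "range torus"
  show "subgroup ?T OB"
  proof
    fix x assume "x \<in> ?T"
    then obtain s where s: "x = torus s" by auto
    have "inv\<^bsub>OB\<^esub> x = torus (- s)"
      using group.inv_equality[OF group_orth_group, of tits_form "torus (- s)" x] s torus_OB
      by (simp add: torus_add torus_0)
    then show "inv\<^bsub>OB\<^esub> x \<in> ?T" by simp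
  next
    show "\<one>\<^bsub>OB\<^esub> \<in> ?T" using torus_0 by (metis OB_simps(2) rangeI)
  qed (auto simp: torus_OB torus_add)
  let ?q1 = "of_sym 1 0 0" and ?q2 = "of_sym 0 1 0" and ?q3 = "of_sym 0 0 1"
  let ?C = "{A :: real^3^3. 0 \<le> sP (A *v ?q1)} \<inter> {A. sQ (A *v ?q1) = 0} \<inter> {A. sR (A *v ?q1) = 0} \<inter>
     {A. sP (A *v ?q2) = 0} \<inter> {A. sQ (A *v ?q2) = 1} \<inter> {A. sR (A *v ?q2) = 0} \<inter>
     {A. sP (A *v ?q3) = 0} \<inter> {A. sQ (A *v ?q3) = 0}"
  have "closed ?C"
    by (intro closed_Int closed_Collect_le closed_Collect_eq continuous_on_const continuous_sym_coords)
  moreover have "?T = carrier OB \<inter> ?C"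
  proof (intro equalityI subsetI)
    fix A assume A: "A \<in> carrier OB \<inter> ?C"
    define a where "a = sP (A *v ?q1)"
    have "tits_form (A *v ?q1) (A *v ?q3) = tits_form ?q1 ?q3" using A OB_isometry by blast
    then have ac: "a * sR (A *v ?q3) = 1" using A by (simp add: tits_form_sym a_def)
    have "0 \<le> a" using A by (simp add: a_def)
    then have a: "0 < a" using ac by (cases "a = 0") auto
    have r: "sR (A *v ?q3) = 1 / a" using ac a by (simp add: field_simps)
    have "A *v x = torus (ln a / 2) *v x" for x
    proof -
      have x: "x = sP x *\<^sub>R ?q1 + sQ x *\<^sub>R ?q2 + sR x *\<^sub>R ?q3"
        using of_sym_linear of_sym_inverse by metis
      have "A *v x = sP x *\<^sub>R (A *v ?q1) + sQ x *\<^sub>R (A *v ?q2) + sR x *\<^sub>R (A *v ?q3)"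
        using arg_cong[OF x, of "\<lambda>x. A *v x"] by (simp only: matrix_vector_right_distrib matrix_vector_mult_scaleR)
      then show ?thesis
        using A a r by (intro sym_eqI) (simp_all add: torus_coords a_def[symmetric] exp_minus field_simps)
    qed
    then have "A = torus (ln a / 2)" by (simp add: matrix_eq)
    then show "A \<in> ?T" by simp
  qed (auto simp: torus_OB torus_coords)
  ultimately show "closedin (top_of_set (carrier OB)) ?T" by (metis closedin_closed_Int)
  show "connected ?T" by (rule connected_continuous_image[OF torus_continuous]) simp
  obtain Q :: "real^3^3" where Q: "\<And>x. Q *v x = x $ 1 *\<^sub>R ?q1 + x $ 2 *\<^sub>R ?q2 + x $ 3 *\<^sub>R ?q3"
    using matrix_of_columns[of "\<lambda>i. if i = 1 then ?q1 else if i = 2 then ?q2 else ?q3"] by auto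
  have "x = y" if "Q *v x = Q *v y" for x y
    using arg_cong[OF that, of sP] arg_cong[OF that, of sQ] arg_cong[OF that, of sR]
    by (simp add: Q vec_eq_iff forall_3)
  then have "inj ((*v) Q)" by (rule injI)
  then have iQ: "invertible Q" by (simp add: invertible_left_inverse matrix_left_invertible_injective)
  have "(matrix_inv Q ** A ** Q) $ i $ j = 0" if A: "A \<in> ?T" and ij: "i \<noteq> j" for A i j
  proof -
    obtain s where s: "A = torus s" using A by auto
    have "\<exists>t. A *v (Q *v axis j 1) = t *\<^sub>R (Q *v axis j 1)"
    proof -
      consider "j = 1" | "j = 2" | "j = 3" using exhaust_3 by blast
      then show ?thesis
      proof cases
        case 1 then show ?thesis
          by (intro exI[of _ "exp (2 * s)"] sym_eqI) (simp_all add: s torus_coords Q axis_def)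
      next
        case 2 then show ?thesis
          by (intro exI[of _ 1] sym_eqI) (simp_all add: s torus_coords Q axis_def)
      next
        case 3 then show ?thesis
          by (intro exI[of _ "exp (- 2 * s)"] sym_eqI) (simp_all add: s torus_coords Q axis_def)
      qed
    qed
    then obtain t where t: "A *v (Q *v axis j 1) = t *\<^sub>R (Q *v axis j 1)" by blast
    have "(matrix_inv Q ** A ** Q) $ i $ j = ((matrix_inv Q ** A ** Q) *v axis j 1) $ i"
      by (simp add: matrix_axis_nth)
    also have "(matrix_inv Q ** A ** Q) *v axis j 1 = matrix_inv Q *v (A *v (Q *v axis j 1))"
      by (simp only: matrix_vector_mul_assoc matrix_mul_assoc)
    also have "\<dots> = t *\<^sub>R ((matrix_inv Q ** Q) *v axis j 1)"
      unfolding t by (simp only: matrix_vector_mult_scaleR matrix_vector_mul_assoc)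
    finally show ?thesis using ij by (simp add: matrix_inv_cancel[OF iQ] axis_def)
  qed
  then show "\<exists>P :: real^3^3. invertible P \<and> (\<forall>A\<in>?T. \<forall>i j. i \<noteq> j \<longrightarrow> (matrix_inv P ** A ** P) $ i $ j = 0)"
    using iQ by (intro exI[of _ Q] conjI ballI allI impI)
qed

lemma torus_manifold: "has_manifold_dim (range torus) 1"
proof -
  let ?T = "range torus" and ?E = "Euclidean_space 1" and ?q1 = "of_sym 1 0 0"
  define f :: "real^3^3 \<Rightarrow> nat \<Rightarrow> real" where "f A = (\<lambda>i. if i < 1 then ln (sP (A *v ?q1)) / 2 else 0)" for A
  define g :: "(nat \<Rightarrow> real) \<Rightarrow> real^3^3" where "g x = torus (x 0)" for x
  have fg: "f (torus s) = (\<lambda>i. if i < 1 then s else 0)" for s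
    by (rule ext) (simp add: f_def torus_coords)
  have c: "continuous_on ?T (\<lambda>A. sP (A *v ?q1))"
    by (rule continuous_sym_coords)
  have "continuous_on ?T (\<lambda>A. ln (sP (A *v ?q1)) / 2)"
    by (intro continuous_intros c) (auto simp: torus_coords)
  then have "continuous_map (top_of_set ?T) ?E f"
    unfolding f_def by (subst continuous_map_componentwise_Euclidean_space) simp
  moreover have "continuous_map ?E (top_of_set ?T) g"
  proof -
    have "continuous_map ?E euclideanreal (\<lambda>x. x 0)"
      unfolding Euclidean_space_def
      by (intro continuous_map_from_subtopology continuous_map_product_projection) simp
    moreover have "continuous_map euclideanreal (top_of_set ?T) torus"
      using torus_continuous by (simp add: continuous_map_in_subtopology)
    ultimately show ?thesis
      using continuous_map_compose[of ?E euclideanreal "\<lambda>x. x 0" "top_of_set ?T" torus] by (simp add: g_def[abs_def] o_def)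
  qed
  moreover have "f (g x) = x" if "x \<in> topspace ?E" for x
    using that by (auto simp: g_def fg topspace_Euclidean_space)
  ultimately have "homeomorphic_maps (top_of_set ?T) ?E f g"
    by (auto simp: homeomorphic_maps_def fg g_def)
  then have "top_of_set ?T homeomorphic_space ?E" by (auto simp: homeomorphic_space_def)
  then show ?thesis unfolding has_manifold_dim_def using openin_subtopology_self by blast
qed

lemma tits_real_rank: "has_real_rank OB 1"
  unfolding has_real_rank_def
proof (intro conjI allI impI)
  show "\<exists>T. split_torus OB T \<and> has_manifold_dim T 1" using torus_split torus_manifold by blast
  fix T d assume T: "split_torus OB T" "has_manifold_dim T d"
  have "mat 1 \<in> T" using T(1) subgroup.one_closed[of T OB] by (simp add: split_torus_def)
  then show "d \<le> 1" using split_torus_coordinate[OF T(1)] manifold_dim_le_1[OF T(2)] by blast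
qed

theorem mainTheorem2:
  shows "has_signature tits_form 2 1
    \<and> (\<exists>P :: real^3^3. invertible P \<and>
          (\<lambda>A. matrix_inv P ** A ** P) \<in> iso (orth_group tits_form) (orth_group form_2_1))
    \<and> has_real_rank (orth_group tits_form) 1
    \<and> (\<exists>\<rho>. is_geometric_rep \<rho>)
    \<and> (\<forall>\<rho>. is_geometric_rep \<rho> \<longrightarrow>
          \<rho> \<in> iso W ((orth_group tits_form)\<lparr>carrier := \<rho> ` carrier W\<rparr>)
          \<and> is_lattice (orth_group tits_form) (\<rho> ` carrier W))"
proof (intro conjI allI impI)
  fix \<rho> assume \<rho>: "is_geometric_rep \<rho>"
  show "\<rho> \<in> iso W (OB\<lparr>carrier := \<rho> ` carrier W\<rparr>)" by (rule geometric_rep_iso(1)[OF \<rho>])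
  show "is_lattice OB (\<rho> ` carrier W)"
    unfolding geometric_rep_iso(2)[OF \<rho>] by (rule word_mat_lattice)
qed (rule tits_signature tits_conjugate_standard tits_real_rank geometric_rep_exists)+

end
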